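(* Let $\theta>0$, let $f:S^1\to\mathbb{C}$ be real analytic, let $x\in S^1$, and let $S_n$ be endowed with the Ewens measure with parameter $\theta$. Assume that either (i) $x$ is not a root of unity and is of finite type, and all zeros of $f$ are roots of unity; or (ii) $x$ is a root of unity of order $p$ and $f(x^m)\neq0$ for all $1\le m\le p$. Let $\mathcal{N}=\mathcal{N}_a+i\mathcal{N}_b$ be the complex normal random variable that is the limit in distribution of $\frac{w^n(f)(x)}{\sqrt{\log n}}-\theta\sqrt{\log n}\,m(f)(x)$ (described explicitly in the context). Then, as $n\to\infty$, $$\mathrm{d}_W\left(\mathcal{N}_a,\ \mathrm{Re}\left(\frac{w^n(f)(x)}{\sqrt{\log n}}-\theta\sqrt{\log n}\; m(f)(x)\right)\right)=O\bigl(\log^{-1/2}(n)\bigr),$$ $$\mathrm{d}_W\left(\mathcal{N}_b,\ \mathrm{Im}\left(\frac{w^n(f)(x)}{\sqrt{\log n}}-\theta\sqrt{\log n}\; m(f)(x)\right)\right)=O\bigl(\log^{-1/2}(n)\bigr).$$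
   Context: Wasserstein distance: for real random variables $X_1,X_2$ (not necessarily on the same space), $\mathrm{d}_W(X_1,X_2)=\sup_{g\in\mathcal{G}}|\mathbb{E}[g(X_1)]-\mathbb{E}[g(X_2)]|$ with $\mathcal{G}=\{g\in C^1(\mathbb{R},\mathbb{R}):\sup_{t\in\mathbb{R}}|g'(t)|\le1\}$. Ewens measure: $\mathbb{P}_\theta[\sigma]=\frac{\theta^{\ell(\sigma)}}{\theta(\theta+1)\cdots(\theta+n-1)}$ for $\sigma\in S_n$, where $\ell(\sigma)$ is the total number of cycles of $\sigma$ (fixed points included). $C_m^{(n)}(\sigma)$ is the number of cycles of length $m$ of $\sigma\in S_n$. $S^1=\{z\in\mathbb{C}:|z|=1\}$ and $w^n(f)(x)=\sum_{m=1}^n C_m^{(n)}\log(f(x^m))$, where $\log$ is the principal branch, with $\log(-y)=\log(y)+i\pi$ for $y>0$ and $\log(0)=\infty$; $\arg$ denotes the imaginary part of this logarithm. $m(f)(x)=\frac1p\sum_{m=1}^p\log(f(x^m))$ if $x$ is a root of unity of order $p$ (i.e. $x^p=1$, $p\geq 1$ minimal), and $m(f)(x)=\int_0^1\log(f(e^{2\pi i s}))\,ds$ if $x$ is not a root of unity. Finite type: $x=e^{2\pi i t}$ ($t\in\mathbb{R}$) is of finite type if there exist $K,\gamma>0$ such that $\|\{mt\}\|>\frac{K}{|m|^\gamma}$ for all $m\in\mathbb{Z}\setminus\{0\}$, where $\{s\}=s-\lfloor s\rfloor$ and $\|s\|=\min\{s,1-s\}$ for $s\in[0,1]$. The limit $\mathcal{N}=\mathcal{N}_a+i\mathcal{N}_b$: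 $(\mathcal{N}_a,\mathcal{N}_b)$ is a centered (possibly degenerate) Gaussian vector with covariance matrix $\theta\begin{pmatrix} V_a & E_{ab} \\ E_{ab} & V_b \end{pmatrix}$, where, in case (i), with $a(s)=\log|f(e^{2\pi i s})|$ and $b(s)=\arg(f(e^{2\pi i s}))$, $V_a=\int_0^1a(s)^2ds$, $V_b=\int_0^1b(s)^2ds$, $E_{ab}=\int_0^1a(s)b(s)ds$; and in case (ii), with $a_m=\log|f(x^m)|$, $b_m=\arg(f(x^m))$, $V_a=\frac1p\sum_{m=1}^pa_m^2$, $V_b=\frac1p\sum_{m=1}^pb_m^2$, $E_{ab}=\frac1p\sum_{m=1}^pa_mb_m$. *)

theory Defs
  imports "HOL-Probability.Probability" "HOL-Combinatorics.Orbits"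
begin

section \<open>Permutations under the Ewens measure\<close>

text \<open>
  A permutation of \<open>{1..n}\<close> is a function on \<^typ>\<open>nat\<close> that is the identity outside \<open>{1..n}\<close>.
  Its cycles, fixed points included, are identified with its orbits on \<open>{1..n}\<close>.
\<close>

definition perms :: "nat \<Rightarrow> (nat \<Rightarrow> nat) set" where
  "perms n = {\<sigma>. \<sigma> permutes {1..n}}"

definition cycles_of :: "nat \<Rightarrow> (nat \<Rightarrow> nat) \<Rightarrow> nat set set" where
  "cycles_of n \<sigma> = orbit \<sigma> ` {1..n}"

definition num_cycles :: "nat \<Rightarrow> (nat \<Rightarrow> nat) \<Rightarrow> nat" where
  "num_cycles n \<sigma> = card (cycles_of n \<sigma>)"

definition cycle_count :: "nat \<Rightarrow> nat \<Rightarrow> (nat \<Rightarrow> nat) \<Rightarrow> nat" where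
  "cycle_count n m \<sigma> = card {c \<in> cycles_of n \<sigma>. card c = m}"

text \<open>\<^term>\<open>pochhammer \<theta> n\<close> is \<open>\<theta> (\<theta> + 1) \<dots> (\<theta> + n - 1)\<close>.\<close>

definition ewens :: "real \<Rightarrow> nat \<Rightarrow> (nat \<Rightarrow> nat) measure" where
  "ewens \<theta> n = point_measure (perms n) (\<lambda>\<sigma>. ennreal (\<theta> ^ num_cycles n \<sigma> / pochhammer \<theta> n))"

section \<open>Functions on the unit circle\<close>

text \<open>
  Functions on the unit circle are given as functions on \<^typ>\<open>complex\<close> of which only the values on
  \<^term>\<open>sphere 0 1 :: complex set\<close> matter. Real analyticity is with respect to the real-analytic
  structure of the circle, in the local coordinate \<open>t \<mapsto> e\<^sup>i\<^sup>t\<close>.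
\<close>

definition real_analytic_on_circle :: "(complex \<Rightarrow> complex) \<Rightarrow> bool" where
  "real_analytic_on_circle f \<longleftrightarrow>
     (\<forall>t\<^sub>0::real. \<exists>r>0. \<exists>c::nat \<Rightarrow> complex. \<forall>t. \<bar>t - t\<^sub>0\<bar> < r \<longrightarrow>
        (\<lambda>k. c k * of_real ((t - t\<^sub>0) ^ k)) sums f (cis t))"

definition root_of_unity :: "complex \<Rightarrow> bool" where
  "root_of_unity x \<longleftrightarrow> (\<exists>p\<ge>1. x ^ p = 1)"

definition unity_order :: "complex \<Rightarrow> nat" where
  "unity_order x = (LEAST p. p \<ge> 1 \<and> x ^ p = 1)"

text \<open>Distance to the nearest integer, for an argument in \<open>[0,1]\<close>.\<close>

definition unit_norm :: "real \<Rightarrow> real" where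
  "unit_norm s = min s (1 - s)"

text \<open>The condition on \<open>t\<close> depends on \<open>t\<close> modulo 1 only, i.e. only on \<open>x\<close>.\<close>

definition finite_type :: "complex \<Rightarrow> bool" where
  "finite_type x \<longleftrightarrow>
     (\<exists>t::real. x = cis (2 * pi * t) \<and>
       (\<exists>K>0. \<exists>\<gamma>>0. \<forall>m::int. m \<noteq> 0 \<longrightarrow>
          unit_norm (frac (of_int m * t)) > K / \<bar>of_int m\<bar> powr \<gamma>))"

text \<open>
  The mean of \<open>\<phi>\<close> along the sequence \<open>x, x\<^sup>2, x\<^sup>3, \<dots>\<close>: over one period if \<open>x\<close> is a root of unity,
  over the circle otherwise.
\<close>

definition circle_mean ::
    "complex \<Rightarrow> (complex \<Rightarrow> 'a) \<Rightarrow> 'a::{banach, second_countable_topology}" where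
  "circle_mean x \<phi> =
     (if root_of_unity x
      then (\<Sum>m = 1..unity_order x. \<phi> (x ^ m)) /\<^sub>R real (unity_order x)
      else (LINT s:{0..1}|lborel. \<phi> (cis (2 * pi * s))))"

text \<open>
  \<^term>\<open>Ln\<close> is the principal branch, with imaginary part in \<open>(-\<pi>, \<pi>]\<close>. The library value at \<open>0\<close> is
  \<open>0\<close>, not \<open>\<infinity>\<close>. This is harmless: if \<open>f (x ^ m) \<noteq> 0\<close> for all \<open>m \<ge> 1\<close>, then it enters only the
  integrals over the circle for \<open>x\<close> not a root of unity, and these it does not affect as long as the
  zeros of \<open>f\<close> on the circle form a null set, e.g. if they are all roots of unity.
\<close>

definition wn :: "nat \<Rightarrow> (complex \<Rightarrow> complex) \<Rightarrow> complex \<Rightarrow> (nat \<Rightarrow> nat) \<Rightarrow> complex" where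
  "wn n f x \<sigma> = (\<Sum>m = 1..n. of_nat (cycle_count n m \<sigma>) * Ln (f (x ^ m)))"

definition mean_log :: "(complex \<Rightarrow> complex) \<Rightarrow> complex \<Rightarrow> complex" where
  "mean_log f x = circle_mean x (\<lambda>z. Ln (f z))"

definition normalized_w ::
    "real \<Rightarrow> nat \<Rightarrow> (complex \<Rightarrow> complex) \<Rightarrow> complex \<Rightarrow> (nat \<Rightarrow> nat) \<Rightarrow> complex" where
  "normalized_w \<theta> n f x \<sigma> =
     wn n f x \<sigma> / of_real (sqrt (ln (real n))) - of_real (\<theta> * sqrt (ln (real n))) * mean_log f x"

definition V_a :: "(complex \<Rightarrow> complex) \<Rightarrow> complex \<Rightarrow> real" where
  "V_a f x = circle_mean x (\<lambda>z. (ln (cmod (f z)))\<^sup>2)"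

definition V_b :: "(complex \<Rightarrow> complex) \<Rightarrow> complex \<Rightarrow> real" where
  "V_b f x = circle_mean x (\<lambda>z. (Im (Ln (f z)))\<^sup>2)"

definition E_ab :: "(complex \<Rightarrow> complex) \<Rightarrow> complex \<Rightarrow> real" where
  "E_ab f x = circle_mean x (\<lambda>z. ln (cmod (f z)) * Im (Ln (f z)))"

section \<open>Gaussian vectors and the Wasserstein distance\<close>

text \<open>A real Gaussian variable may be degenerate, i.e. almost surely constant.\<close>

definition gaussian_rv :: "'w measure \<Rightarrow> ('w \<Rightarrow> real) \<Rightarrow> bool" where
  "gaussian_rv M X \<longleftrightarrow>
     X \<in> borel_measurable M \<and>
     ((\<exists>\<mu> \<sigma>. \<sigma> > 0 \<and> distributed M lborel X (normal_density \<mu> \<sigma>)) \<or>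
      (\<exists>\<mu>. AE \<omega> in M. X \<omega> = \<mu>))"

definition gaussian_vector2 :: "'w measure \<Rightarrow> ('w \<Rightarrow> real) \<Rightarrow> ('w \<Rightarrow> real) \<Rightarrow> bool" where
  "gaussian_vector2 M X Y \<longleftrightarrow>
     prob_space M \<and> X \<in> borel_measurable M \<and> Y \<in> borel_measurable M \<and>
     (\<forall>u v. gaussian_rv M (\<lambda>\<omega>. u * X \<omega> + v * Y \<omega>))"

definition covariance :: "'w measure \<Rightarrow> ('w \<Rightarrow> real) \<Rightarrow> ('w \<Rightarrow> real) \<Rightarrow> real" where
  "covariance M X Y =
     (\<integral>\<omega>. (X \<omega> - (\<integral>\<omega>'. X \<omega>' \<partial>M)) * (Y \<omega> - (\<integral>\<omega>'. Y \<omega>' \<partial>M)) \<partial>M)"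

definition centered_gaussian_vector2 ::
    "'w measure \<Rightarrow> ('w \<Rightarrow> real) \<Rightarrow> ('w \<Rightarrow> real) \<Rightarrow> real \<Rightarrow> real \<Rightarrow> real \<Rightarrow> bool" where
  "centered_gaussian_vector2 M X Y v\<^sub>X c v\<^sub>Y \<longleftrightarrow>
     gaussian_vector2 M X Y \<and>
     (\<integral>\<omega>. X \<omega> \<partial>M) = 0 \<and> (\<integral>\<omega>. Y \<omega> \<partial>M) = 0 \<and>
     covariance M X X = v\<^sub>X \<and> covariance M X Y = c \<and> covariance M Y Y = v\<^sub>Y"

definition wasserstein_tests :: "(real \<Rightarrow> real) set" where
  "wasserstein_tests = {g. g C1_differentiable_on UNIV \<and> (\<forall>t. \<bar>deriv g t\<bar> \<le> 1)}"

text \<open>The supremum is taken in \<open>[0, \<infinity>]\<close>, so it is meaningful also when it is infinite.\<close>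

definition wasserstein ::
    "'v measure \<Rightarrow> ('v \<Rightarrow> real) \<Rightarrow> 'w measure \<Rightarrow> ('w \<Rightarrow> real) \<Rightarrow> ennreal" where
  "wasserstein M X N Y =
     (SUP g\<in>wasserstein_tests. ennreal \<bar>(\<integral>\<omega>. g (X \<omega>) \<partial>M) - (\<integral>\<omega>. g (Y \<omega>) \<partial>N)\<bar>)"

end

theory Submission
  imports Defs "HOL-Library.Real_Mod" "HOL-Complex_Analysis.Complex_Analysis" "HOL-Real_Asymp.Real_Asymp"
begin

text \<open>
  Write the statistic as \<open>T = \<Sum>m. u\<^sub>m C\<^sub>m\<close> with real weights \<open>u\<^sub>m\<close>. Two identities for the Ewens
  measure drive the probabilistic part: removing the cycle of a uniformly chosen point, and the size bias
  identity for \<open>C\<^sub>m\<close>. The first shows that the expectation of a Lipschitz function of \<open>T\<close> is within a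
  constant of a weighted mean of the expectations for smaller permutations. Such means vary slowly, so
  \<open>n\<close> may be replaced by a random size with weights proportional to \<open>r\<^sup>k \<theta> (\<theta> + 1) \<dots> (\<theta> + k - 1) / k!\<close>,
  \<open>r = 1 - 1 / n\<close>. For the mixture the counts are independent Poisson variables with means
  \<open>\<theta> r\<^sup>m / m\<close>; this enters only through the Stein identity that the size bias identity becomes after
  summation. Stein's equation for the normal law then gives the rate, provided that \<open>\<Sum>m. u\<^sub>m r\<^sup>m / m\<close> and
  \<open>\<Sum>m. u\<^sub>m\<^sup>2 r\<^sup>m / m\<close> are \<open>\<mu> ln n + O(1)\<close> and \<open>V ln n + O(1)\<close>.

  By Abel summation the latter follows from a power saving in the averages of \<open>u\<^sub>m\<close> and \<open>u\<^sub>m\<^sup>2\<close>. If \<open>x\<close> is a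
  root of unity, these sequences are periodic. Otherwise rational approximation and the finite type
  condition give equidistribution of \<open>x\<^sup>m\<close> with a power saving for Lipschitz functions, and a cutoff extends
  it to functions with mild singularities, such as the real and imaginary part of \<open>log f\<close>, whose
  singularities are controlled by a lower bound for analytic functions near their zeros.
\<close>

section \<open>Cycle counts under the Ewens measure\<close>

text \<open>At fixed \<open>n\<close> the size bias identity relates permutations of size
  \<open>n\<close> to those of size \<open>n - m\<close>, so it is not a Stein identity for a single
  law. Weighting size \<open>k\<close> by \<open>r ^ k\<close> removes this obstacle: since
  \<open>r ^ k = r ^ m * r ^ (k - m)\<close>, the sum over \<open>m\<close> becomes a Cauchy product
  whose second factor is the whole mixture again. The choice \<open>r = 1 - 1 / n\<close> makes the
  series of \<open>r ^ m / m\<close> exactly \<open>ln n\<close>, the scale of mean and variance.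
  The rate has one source: after division by \<open>sqrt (ln n)\<close> the test function has
  Lipschitz constant \<open>1 / sqrt (ln n)\<close>, so every comparison made before scaling may
  have a bounded error. Any power saving in the averages is therefore enough. When the limiting
  variance is zero, the Stein equation cannot be scaled and a second moment bound replaces it. On
  the circle, ln |f| is unbounded, but it is singular only at zeros of f; these are roots of unity,
  which the orbit of x approaches at most polynomially fast. The argument of f also jumps at points
  over which the orbit has no such control, but it is bounded. So the two parts meet the growth
  condition for different reasons.\<close>

definition counts :: "nat \<Rightarrow> (nat \<Rightarrow> nat) \<Rightarrow> nat \<Rightarrow> nat" where
  "counts n \<sigma> m = cycle_count n m \<sigma>"

abbreviation incr :: "nat \<Rightarrow> (nat \<Rightarrow> nat) \<Rightarrow> nat \<Rightarrow> nat" where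
  "incr m c \<equiv> c(m := Suc (c m))"

abbreviation decr :: "nat \<Rightarrow> (nat \<Rightarrow> nat) \<Rightarrow> nat \<Rightarrow> nat" where
  "decr m c \<equiv> c(m := c m - 1)"

section \<open>Inserting a point into a permutation\<close>

lemma finite_perms [simp]: "finite (perms n)"
  by (simp add: perms_def finite_permutations)

lemma finite_cycles_of [simp]: "finite (cycles_of n \<sigma>)"
  by (simp add: cycles_of_def)

lemma perms_permutation: "\<sigma> \<in> perms n \<Longrightarrow> permutation \<sigma>"
  by (auto simp: perms_def permutation_permutes)

lemma perms_orbit_subset: "\<sigma> \<in> perms n \<Longrightarrow> b \<in> {1..n} \<Longrightarrow> orbit \<sigma> b \<subseteq> {1..n}"
  by (auto simp: perms_def dest: permutes_orbit_subset)

lemma cycle_subset: "\<sigma> \<in> perms n \<Longrightarrow> c \<in> cycles_of n \<sigma> \<Longrightarrow> c \<subseteq> {1..n}"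
  unfolding cycles_of_def using perms_orbit_subset by blast

lemma perms_orbit_eq: "\<sigma> \<in> perms n \<Longrightarrow> y \<in> orbit \<sigma> b \<Longrightarrow> orbit \<sigma> y = orbit \<sigma> b"
  by (rule orbit_cyclic_eq3[OF cyclic_on_orbit'[OF perms_permutation]])

lemma perms_self_in_orbit: "\<sigma> \<in> perms n \<Longrightarrow> b \<in> orbit \<sigma> b"
  by (rule permutation_self_in_orbit[OF perms_permutation])

lemma cycles_of_Suc_fixed:
  assumes "\<sigma> \<in> perms n"
  shows "cycles_of (Suc n) \<sigma> = insert {Suc n} (cycles_of n \<sigma>)"
proof -
  have "\<sigma> (Suc n) = Suc n" using assms by (auto simp: perms_def permutes_def)
  then have "orbit \<sigma> (Suc n) = {Suc n}" by (simp add: orbit_eq_singleton_iff)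
  moreover have "{1..Suc n} = insert (Suc n) {1..n}" by auto
  ultimately show ?thesis by (simp add: cycles_of_def)
qed

text \<open>Composing with the transposition puts \<open>Suc n\<close> into the cycle of
  \<open>b\<close>, right in front of \<open>b\<close>: the preimage of \<open>b\<close> is now sent
  to \<open>Suc n\<close>, and \<open>Suc n\<close> to \<open>b\<close>. Every other cycle avoids
  that preimage and stays as it is.\<close>

lemma cycles_of_Suc_inserted:
  assumes s: "\<sigma> \<in> perms n" and b: "b \<in> {1..n}"
  shows "cycles_of (Suc n) (Transposition.transpose (Suc n) b \<circ> \<sigma>) =
    insert (insert (Suc n) (orbit \<sigma> b)) (cycles_of n \<sigma> - {orbit \<sigma> b})"
proof -
  define a where "a = Suc n"
  define \<tau> where "\<tau> = Transposition.transpose a b \<circ> \<sigma>"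
  let ?O = "orbit \<sigma> b"
  have perm: "\<sigma> permutes {1..n}" using s by (simp add: perms_def)
  have OS: "?O \<subseteq> {1..n}" using perms_orbit_subset[OF s b] .
  have ain: "a \<notin> {1..n}" by (simp add: a_def)
  have sa: "\<sigma> a = a" using perm ain by (auto simp: permutes_def)
  have ta: "\<tau> a = b" by (simp add: \<tau>_def sa)
  have sin: "\<sigma> y \<in> {1..n}" if "y \<in> {1..n}" for y using permutes_in_image[OF perm] that by blast
  have t1: "\<tau> y = (if \<sigma> y = b then a else \<sigma> y)" if "y \<in> {1..n}" for y
    using sin[OF that] ain by (auto simp: \<tau>_def Transposition.transpose_def)
  have "\<tau> permutes {1..Suc n}"
  proof -
    have "\<sigma> permutes insert a {1..n}" using perm permutes_subset by blast
    then have "\<tau> permutes insert a {1..n}" unfolding \<tau>_def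
      using permutes_compose permutes_swap_id b by (metis insertI1 insertI2)
    then show ?thesis by (metis a_def atLeastAtMostSuc_conv le_add1 plus_1_eq_Suc)
  qed
  then have tp: "\<tau> \<in> perms (Suc n)" by (simp add: perms_def)
  have other: "orbit \<tau> y = orbit \<sigma> y" if y: "y \<in> {1..n}" "y \<notin> ?O" for y
  proof (rule orbit_cong)
    show "y \<in> orbit \<sigma> y" using perms_self_in_orbit[OF s] .
    fix z assume z: "z \<in> orbit \<sigma> y"
    then have zin: "z \<in> {1..n}" using perms_orbit_subset[OF s y(1)] by auto
    have "\<sigma> z \<noteq> b"
    proof
      assume "\<sigma> z = b"
      then have "b \<in> orbit \<sigma> y" using z by (metis orbit.step)
      then have "?O = orbit \<sigma> y" using perms_orbit_eq[OF s] by blast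
      then show False using y perms_self_in_orbit[OF s] by blast
    qed
    then show "\<tau> z = \<sigma> z" using t1[OF zin] by simp
  qed
  have aorb: "orbit \<tau> a = insert a ?O"
  proof (intro subset_antisym subsetI)
    fix z assume "z \<in> orbit \<tau> a"
    then show "z \<in> insert a ?O"
    proof induction
      case base then show ?case using ta perms_self_in_orbit[OF s] by simp
    next
      case (step y)
      then show ?case
      proof (cases "y = a")
        case True then show ?thesis using ta perms_self_in_orbit[OF s] by simp
      next
        case False
        then have yO: "y \<in> ?O" using step by auto
        then have "\<tau> y = (if \<sigma> y = b then a else \<sigma> y)" using t1 OS by blast
        then show ?thesis using yO by (auto intro: orbit.step)
      qed
    qed
  next
    fix z assume z: "z \<in> insert a ?O"
    have ba: "b \<in> orbit \<tau> a" using orbit.base[of \<tau> a] ta by simp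
    \<comment> \<open>The only arrow of \<sigma> that has been cut is the one into \<open>b\<close>,
      and \<open>b\<close> belongs to the new orbit anyway.\<close>
    have key: "\<sigma> y \<in> orbit \<tau> a" if "y \<in> {1..n}" "y \<in> orbit \<tau> a" for y
      using t1[OF that(1)] ba orbit.step[OF that(2)] by (auto split: if_splits)
    have "y \<in> orbit \<tau> a" if "y \<in> ?O" for y
      using that
    proof induction
      case base then show ?case using key b ba by blast
    next
      case (step y) then show ?case using key OS by blast
    qed
    then show "z \<in> orbit \<tau> a" using z perms_self_in_orbit[OF tp] by blast
  qed
  have same: "orbit \<tau> y = insert a ?O" if "y \<in> ?O" for y
    using perms_orbit_eq[OF tp, of y a] aorb that by auto
  have "{1..Suc n} = insert a (?O \<union> ({1..n} - ?O))" using OS by (auto simp: a_def)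
  then have "cycles_of (Suc n) \<tau> = insert (orbit \<tau> a) (orbit \<tau> ` ?O \<union> orbit \<tau> ` ({1..n} - ?O))"
    unfolding cycles_of_def by (simp only: image_Un image_insert)
  also have "orbit \<tau> ` ?O = {insert a ?O}" using same perms_self_in_orbit[OF s] by auto
  also have "orbit \<tau> ` ({1..n} - ?O) = orbit \<sigma> ` ({1..n} - ?O)" using other by auto
  also have "\<dots> = cycles_of n \<sigma> - {?O}" 
  proof -
    have "orbit \<sigma> y \<noteq> ?O" if "y \<notin> ?O" for y using that perms_self_in_orbit[OF s, of y] by auto
    moreover have "y \<notin> ?O" if "orbit \<sigma> y \<noteq> ?O" for y using that perms_orbit_eq[OF s, of y b] by auto
    ultimately show ?thesis by (auto simp: cycles_of_def)
  qed
  finally have "cycles_of (Suc n) \<tau> = insert (insert a ?O) (cycles_of n \<sigma> - {?O})"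
    by (simp add: aorb)
  then show ?thesis unfolding \<tau>_def a_def .
qed

lemma counts_Suc_fixed:
  assumes "\<sigma> \<in> perms n"
  shows "num_cycles (Suc n) \<sigma> = Suc (num_cycles n \<sigma>)" "counts (Suc n) \<sigma> = incr 1 (counts n \<sigma>)"
proof -
  have nin: "{Suc n} \<notin> cycles_of n \<sigma>"
    using cycle_subset[OF assms, of "{Suc n}"] by auto
  show "num_cycles (Suc n) \<sigma> = Suc (num_cycles n \<sigma>)"
    unfolding num_cycles_def cycles_of_Suc_fixed[OF assms] using nin by simp
  have "counts (Suc n) \<sigma> m = incr 1 (counts n \<sigma>) m" for m
  proof -
    have "{c \<in> insert {Suc n} (cycles_of n \<sigma>). card c = m} =
      (if m = 1 then insert {Suc n} {c \<in> cycles_of n \<sigma>. card c = m} else {c \<in> cycles_of n \<sigma>. card c = m})"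
      by auto
    then show ?thesis unfolding counts_def cycle_count_def cycles_of_Suc_fixed[OF assms]
      using nin by simp
  qed
  then show "counts (Suc n) \<sigma> = incr 1 (counts n \<sigma>)" by blast
qed

lemma counts_Suc_inserted:
  assumes s: "\<sigma> \<in> perms n" and b: "b \<in> {1..n}"
  defines "\<tau> \<equiv> Transposition.transpose (Suc n) b \<circ> \<sigma>" and "j \<equiv> card (orbit \<sigma> b)"
  shows "num_cycles (Suc n) \<tau> = num_cycles n \<sigma>"
    "counts (Suc n) \<tau> = incr (Suc j) (decr j (counts n \<sigma>))"
proof -
  let ?X = "insert (Suc n) (orbit \<sigma> b)"
  let ?S = "cycles_of n \<sigma>"
  have cyc: "cycles_of (Suc n) \<tau> = insert ?X (?S - {orbit \<sigma> b})"
    unfolding \<tau>_def by (rule cycles_of_Suc_inserted[OF s b])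
  have nin: "?X \<notin> ?S"
    using cycle_subset[OF s, of ?X] by auto
  have Oin: "orbit \<sigma> b \<in> ?S" using b by (simp add: cycles_of_def)
  have OS: "orbit \<sigma> b \<subseteq> {1..n}" using perms_orbit_subset[OF s b] .
  have cX: "card ?X = Suc j"
    using OS finite_subset[OF OS] by (subst card_insert_disjoint) (auto simp: j_def)
  show "num_cycles (Suc n) \<tau> = num_cycles n \<sigma>"
    unfolding num_cycles_def cyc using nin card_Suc_Diff1[OF finite_cycles_of Oin] by simp
  have "counts (Suc n) \<tau> m = incr (Suc j) (decr j (counts n \<sigma>)) m" for m
  proof -
    let ?D = "\<lambda>m. {c \<in> ?S. card c = m}"
    have "{c \<in> insert ?X (?S - {orbit \<sigma> b}). card c = m} =
      (if m = Suc j then insert ?X (?D m) else if m = j then ?D m - {orbit \<sigma> b} else ?D m)"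
      using cX by (auto simp: j_def)
    moreover have "orbit \<sigma> b \<in> ?D j" using Oin by (simp add: j_def)
    ultimately show ?thesis unfolding counts_def cycle_count_def cyc
      using nin by (auto simp: card_Diff_singleton)
  qed
  then show "counts (Suc n) \<tau> = incr (Suc j) (decr j (counts n \<sigma>))" by blast
qed

lemma card_orbit_size:
  assumes s: "\<sigma> \<in> perms n"
  shows "card {b \<in> {1..n}. card (orbit \<sigma> b) = m} = m * counts n \<sigma> m"
proof -
  let ?D = "{c \<in> cycles_of n \<sigma>. card c = m}"
  have "{b \<in> {1..n}. card (orbit \<sigma> b) = m} = \<Union>?D"
  proof (intro subset_antisym subsetI)
    fix b assume "b \<in> {b \<in> {1..n}. card (orbit \<sigma> b) = m}"
    then show "b \<in> \<Union>?D" using perms_self_in_orbit[OF s] by (auto simp: cycles_of_def)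
  next
    fix b assume "b \<in> \<Union>?D"
    then obtain y where "y \<in> {1..n}" "b \<in> orbit \<sigma> y" "card (orbit \<sigma> y) = m"
      by (auto simp: cycles_of_def)
    then show "b \<in> {b \<in> {1..n}. card (orbit \<sigma> b) = m}"
      using subsetD[OF perms_orbit_subset[OF s], of y b] perms_orbit_eq[OF s, of b y] by simp
  qed
  also have "card (\<Union>?D) = sum card ?D"
  proof (rule card_Union_disjoint)
    show "pairwise disjnt ?D"
      unfolding pairwise_def disjnt_def cycles_of_def using perms_orbit_eq[OF s] by blast
    show "finite A" if "A \<in> ?D" for A
      using that cycle_subset[OF s, of A] finite_subset by auto
  qed
  also have "\<dots> = m * counts n \<sigma> m" by (simp add: counts_def cycle_count_def)
  finally show ?thesis .
qed

text \<open>The points \<open>b\<close> are the places for an insertion. Exactly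
  \<open>m * counts n \<sigma> m\<close> of them lie in cycles of length \<open>m\<close>, which
  turns a sum over places into a sum over cycle lengths.\<close>

lemma sum_card_orbit:
  fixes F :: "nat \<Rightarrow> real"
  assumes s: "\<sigma> \<in> perms n"
  shows "(\<Sum>b\<in>{1..n}. F (card (orbit \<sigma> b))) = (\<Sum>m\<in>{1..n}. real m * real (counts n \<sigma> m) * F m)"
proof -
  have img: "(\<lambda>b. card (orbit \<sigma> b)) ` {1..n} \<subseteq> {1..n}"
  proof
    fix k assume "k \<in> (\<lambda>b. card (orbit \<sigma> b)) ` {1..n}"
    then obtain b where b: "b \<in> {1..n}" "k = card (orbit \<sigma> b)" by auto
    have sub: "orbit \<sigma> b \<subseteq> {1..n}" using perms_orbit_subset[OF s b(1)] .
    then have "k \<le> n" using card_mono[OF _ sub] b by simp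
    moreover have "k > 0" using b sub perms_self_in_orbit[OF s, of b] finite_subset[OF sub]
      by (auto simp: card_gt_0_iff)
    ultimately show "k \<in> {1..n}" by simp
  qed
  have "(\<Sum>b\<in>{1..n}. F (card (orbit \<sigma> b))) =
    (\<Sum>m\<in>{1..n}. \<Sum>b\<in>{b \<in> {1..n}. card (orbit \<sigma> b) = m}. F (card (orbit \<sigma> b)))"
    by (rule sum.group[symmetric]) (use img in auto)
  also have "\<dots> = (\<Sum>m\<in>{1..n}. real (card {b \<in> {1..n}. card (orbit \<sigma> b) = m}) * F m)"
    by (intro sum.cong) auto
  also have "\<dots> = (\<Sum>m\<in>{1..n}. real m * real (counts n \<sigma> m) * F m)"
    by (simp only: card_orbit_size[OF s] of_nat_mult)
  finally show ?thesis .
qed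

section \<open>Recursion and size bias\<close>

text \<open>Division by \<open>fact n\<close> instead of \<open>pochhammer \<theta> n\<close> keeps
  ratios of normalising constants out of the recursions. The expectation is the quotient by
  \<open>ewens_weight \<theta> n\<close>, see \<open>integral_ewens\<close>.\<close>

definition ewens_sum :: "real \<Rightarrow> nat \<Rightarrow> ((nat \<Rightarrow> nat) \<Rightarrow> real) \<Rightarrow> real" where
  "ewens_sum \<theta> n h = (\<Sum>\<sigma>\<in>perms n. \<theta> ^ num_cycles n \<sigma> * h (counts n \<sigma>)) / fact n"

text \<open>One step of the Chinese restaurant process.\<close>

lemma ewens_sum_Suc:
  "real (Suc n) * ewens_sum \<theta> (Suc n) h = \<theta> * ewens_sum \<theta> n (\<lambda>c. h (incr 1 c)) +
     (\<Sum>m=1..n. real m * ewens_sum \<theta> n (\<lambda>c. real (c m) * h (incr (Suc m) (decr m c))))"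
proof -
  let ?w = "\<lambda>n \<sigma>. \<theta> ^ num_cycles n \<sigma>"
  let ?g = "\<lambda>\<sigma>. ?w (Suc n) \<sigma> * h (counts (Suc n) \<sigma>)"
  have ins: "{1..Suc n} = insert (Suc n) {1..n}" by auto
  have "real (Suc n) * ewens_sum \<theta> (Suc n) h * fact n = (\<Sum>\<sigma>\<in>perms (Suc n). ?g \<sigma>)"
    by (simp add: ewens_sum_def del: of_nat_Suc)
  \<comment> \<open>Each permutation of \<open>{1..Suc n}\<close> is, in a unique way, a permutation
    of \<open>{1..n}\<close> followed by a transposition of \<open>Suc n\<close> with some
    \<open>b\<close>; for \<open>b = Suc n\<close> this is a new fixed point.\<close>
  also have "\<dots> = (\<Sum>b\<in>insert (Suc n) {1..n}. \<Sum>\<sigma>\<in>perms n. ?g (Transposition.transpose (Suc n) b \<circ> \<sigma>))"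
    unfolding perms_def ins by (rule sum_over_permutations_insert) auto
  also have "\<dots> = (\<Sum>\<sigma>\<in>perms n. ?g \<sigma>) + (\<Sum>b\<in>{1..n}. \<Sum>\<sigma>\<in>perms n. ?g (Transposition.transpose (Suc n) b \<circ> \<sigma>))"
    by (subst sum.insert) auto
  also have "(\<Sum>\<sigma>\<in>perms n. ?g \<sigma>) = \<theta> * ewens_sum \<theta> n (\<lambda>c. h (incr 1 c)) * fact n"
    by (simp add: ewens_sum_def counts_Suc_fixed sum_distrib_left mult.assoc)
  also have "(\<Sum>b\<in>{1..n}. \<Sum>\<sigma>\<in>perms n. ?g (Transposition.transpose (Suc n) b \<circ> \<sigma>)) =
    (\<Sum>\<sigma>\<in>perms n. \<Sum>b\<in>{1..n}. ?w n \<sigma> * h (incr (Suc (card (orbit \<sigma> b))) (decr (card (orbit \<sigma> b)) (counts n \<sigma>))))"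
    by (subst sum.swap) (intro sum.cong refl, simp only: counts_Suc_inserted)
  also have "\<dots> = (\<Sum>\<sigma>\<in>perms n. \<Sum>m\<in>{1..n}. real m * real (counts n \<sigma> m) * (?w n \<sigma> * h (incr (Suc m) (decr m (counts n \<sigma>)))))"
    by (intro sum.cong refl sum_card_orbit)
  also have "\<dots> = (\<Sum>m=1..n. \<Sum>\<sigma>\<in>perms n. real m * real (counts n \<sigma> m) * (?w n \<sigma> * h (incr (Suc m) (decr m (counts n \<sigma>)))))"
    by (rule sum.swap)
  also have "\<dots> = (\<Sum>m=1..n. real m * ewens_sum \<theta> n (\<lambda>c. real (c m) * h (incr (Suc m) (decr m c)))) * fact n"
    unfolding sum_distrib_right
    by (intro sum.cong refl) (simp add: ewens_sum_def sum_distrib_left[symmetric] mult.assoc mult.left_commute)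
  finally have "(real (Suc n) * ewens_sum \<theta> (Suc n) h) * fact n = (\<theta> * ewens_sum \<theta> n (\<lambda>c. h (incr 1 c)) +
     (\<Sum>m=1..n. real m * ewens_sum \<theta> n (\<lambda>c. real (c m) * h (incr (Suc m) (decr m c))))) * fact n"
    by (simp only: distrib_right)
  then show ?thesis by simp
qed

lemma counts_eq_0:
  assumes "\<sigma> \<in> perms n" "m > n"
  shows "counts n \<sigma> m = 0"
proof -
  have "card c \<le> n" if "c \<in> cycles_of n \<sigma>" for c
    using card_mono[OF _ cycle_subset[OF assms(1) that]] by simp
  then have "{c \<in> cycles_of n \<sigma>. card c = m} = {}" using assms(2) by (auto simp: not_le[symmetric])
  then show ?thesis unfolding counts_def cycle_count_def by simp
qed

lemma sum_counts:
  assumes "\<sigma> \<in> perms n"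
  shows "(\<Sum>m=1..n. real m * real (counts n \<sigma> m)) = real n"
  using sum_card_orbit[OF assms, of "\<lambda>_. 1"] by simp

lemma ewens_sum_cong:
  "(\<And>\<sigma>. \<sigma> \<in> perms n \<Longrightarrow> h (counts n \<sigma>) = k (counts n \<sigma>)) \<Longrightarrow> ewens_sum \<theta> n h = ewens_sum \<theta> n k"
  by (simp add: ewens_sum_def)

lemma ewens_sum_add: "ewens_sum \<theta> n (\<lambda>c. h c + k c) = ewens_sum \<theta> n h + ewens_sum \<theta> n k"
  by (simp add: ewens_sum_def distrib_left sum.distrib add_divide_distrib)

lemma ewens_sum_cmult: "ewens_sum \<theta> n (\<lambda>c. a * h c) = a * ewens_sum \<theta> n h"
  by (simp add: ewens_sum_def sum_distrib_left mult_ac)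

lemma ewens_sum_sum: "ewens_sum \<theta> n (\<lambda>c. \<Sum>i\<in>I. h i c) = (\<Sum>i\<in>I. ewens_sum \<theta> n (h i))"
  unfolding ewens_sum_def sum_distrib_left sum_divide_distrib by (subst sum.swap) simp

lemma ewens_sum_mono:
  assumes "\<theta> > 0" "\<And>\<sigma>. \<sigma> \<in> perms n \<Longrightarrow> h (counts n \<sigma>) \<le> k (counts n \<sigma>)"
  shows "ewens_sum \<theta> n h \<le> ewens_sum \<theta> n k"
  unfolding ewens_sum_def using assms by (intro divide_right_mono sum_mono mult_left_mono) auto

text \<open>The two identities imply each other one step further, so they are proved together.\<close>

lemma ewens_sum_identities:
  "(\<forall>k\<le>n. (\<forall>h. real k * ewens_sum \<theta> k h = \<theta> * (\<Sum>j=1..k. ewens_sum \<theta> (k - j) (\<lambda>c. h (incr j c)))) \<and>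
    (\<forall>h. \<forall>m\<in>{1..k}. ewens_sum \<theta> k (\<lambda>c. real (c m) * h c) =
        \<theta> / real m * ewens_sum \<theta> (k - m) (\<lambda>c. h (incr m c))))"
proof (induction n)
  case 0
  then show ?case by simp
next
  case (Suc n)
  let ?A = "ewens_sum \<theta>"
  have rec: "real k * ?A k h = \<theta> * (\<Sum>j=1..k. ?A (k - j) (\<lambda>c. h (incr j c)))" if "k \<le> n" for k h
    using Suc that by blast
  have bias: "?A k (\<lambda>c. real (c m) * h c) = \<theta> / real m * ?A (k - m) (\<lambda>c. h (incr m c))"
    if "k \<le> n" "m \<in> {1..k}" for k m h
    using Suc that by blast
  have rec': "real (Suc n) * ?A (Suc n) h = \<theta> * (\<Sum>j=1..Suc n. ?A (Suc n - j) (\<lambda>c. h (incr j c)))" for h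
  proof -
    \<comment> \<open>Size bias at size \<open>n\<close> absorbs the factor
      \<open>real (c m)\<close> and raises \<open>c m\<close> by one, which the later
      \<open>decr\<close> undoes. What remains is a cycle of length \<open>Suc m\<close> added to a
      permutation of size \<open>n - m\<close>.\<close>
    have "real m * ?A n (\<lambda>c. real (c m) * h (incr (Suc m) (decr m c))) =
        \<theta> * ?A (n - m) (\<lambda>c. h (incr (Suc m) c))" if "m \<in> {1..n}" for m
      using that by (simp add: bias)
    then have "real (Suc n) * ?A (Suc n) h = \<theta> * ?A n (\<lambda>c. h (incr 1 c)) +
       (\<Sum>m=1..n. \<theta> * ?A (n - m) (\<lambda>c. h (incr (Suc m) c)))"
      unfolding ewens_sum_Suc by simp
    also have "(\<Sum>m=1..n. \<theta> * ?A (n - m) (\<lambda>c. h (incr (Suc m) c))) =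
        (\<Sum>j=Suc 1..Suc n. \<theta> * ?A (Suc n - j) (\<lambda>c. h (incr j c)))"
      by (subst sum.atLeast_Suc_atMost_Suc_shift) simp
    also have "\<theta> * ?A n (\<lambda>c. h (incr 1 c)) + \<dots> = (\<Sum>j=1..Suc n. \<theta> * ?A (Suc n - j) (\<lambda>c. h (incr j c)))"
      by (subst (2) sum.atLeast_Suc_atMost) auto
    finally show ?thesis by (simp only: sum_distrib_left)
  qed
  have "?A (Suc n) (\<lambda>c. real (c m) * h c) = \<theta> / real m * ?A (Suc n - m) (\<lambda>c. h (incr m c))"
    if m: "m \<in> {1..Suc n}" for h m
  proof -
    have van: "?A k (\<lambda>c. real (c m) * h c) = 0" if "k < m" for k h
    proof -
      have "?A k (\<lambda>c. real (c m) * h c) = ?A k (\<lambda>c. 0)"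
        by (rule ewens_sum_cong) (use counts_eq_0 that in simp)
      then show ?thesis by (simp add: ewens_sum_def)
    qed
    \<comment> \<open>The recursion is applied to the product \<open>c m * h c\<close>. Raising
      \<open>c j\<close> changes the first factor only for \<open>j = m\<close>, and then by 1; this
      gives the two sums.\<close>
    have "real (Suc n) * ?A (Suc n) (\<lambda>c. real (c m) * h c) =
      \<theta> * (\<Sum>j=1..Suc n. ?A (Suc n - j) (\<lambda>c. real (c m) * h (incr j c) + (if j = m then 1 else 0) * h (incr j c)))"
    proof -
      have "real ((incr j c) m) * h (incr j c) = real (c m) * h (incr j c) + (if j = m then 1 else 0) * h (incr j c)"
        for j c by (auto simp: algebra_simps)
      then show ?thesis unfolding rec' by presburger
    qed
    also have "\<dots> = \<theta> * (\<Sum>j=1..Suc n. ?A (Suc n - j) (\<lambda>c. real (c m) * h (incr j c))) +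
        \<theta> * (\<Sum>j=1..Suc n. (if j = m then 1 else 0) * ?A (Suc n - j) (\<lambda>c. h (incr j c)))"
      by (simp only: ewens_sum_add ewens_sum_cmult sum.distrib distrib_left)
    also have "(\<Sum>j=1..Suc n. (if j = m then 1 else 0) * ?A (Suc n - j) (\<lambda>c. h (incr j c))) =
        ?A (Suc n - m) (\<lambda>c. h (incr m c))"
    proof -
      have "(\<Sum>j=1..Suc n. (if j = m then 1 else 0) * ?A (Suc n - j) (\<lambda>c. h (incr j c))) =
        (\<Sum>j=1..Suc n. if j = m then ?A (Suc n - j) (\<lambda>c. h (incr j c)) else 0)"
        by (intro sum.cong) auto
      then show ?thesis using m by (simp only: sum.delta finite_atLeastAtMost if_True)
    qed
    also have "(\<Sum>j=1..Suc n. ?A (Suc n - j) (\<lambda>c. real (c m) * h (incr j c))) =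
        (\<Sum>j\<in>{1..Suc n - m}. ?A (Suc n - j) (\<lambda>c. real (c m) * h (incr j c)))"
      by (rule sum.mono_neutral_right) (use van m in auto)
    also have "\<dots> = (\<Sum>j\<in>{1..Suc n - m}. \<theta> / real m * ?A (Suc n - m - j) (\<lambda>c. h (incr m (incr j c))))"
    proof (intro sum.cong refl)
      fix j assume j: "j \<in> {1..Suc n - m}"
      then have "?A (Suc n - j) (\<lambda>c. real (c m) * h (incr j c)) =
        \<theta> / real m * ?A (Suc n - j - m) (\<lambda>c. h (incr j (incr m c)))"
        using m by (subst bias) auto
      moreover have "incr j (incr m c) = incr m (incr j c)" for c :: "nat \<Rightarrow> nat" by auto
      moreover have "Suc n - j - m = Suc n - m - j" by simp
      ultimately show "?A (Suc n - j) (\<lambda>c. real (c m) * h (incr j c)) =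
        \<theta> / real m * ?A (Suc n - m - j) (\<lambda>c. h (incr m (incr j c)))"
        by (simp only:)
    qed
    \<comment> \<open>The recursion at the smaller size \<open>Suc n - m\<close>, read
      backwards.\<close>
    also have "\<theta> * \<dots> = \<theta> / real m * (real (Suc n - m) * ?A (Suc n - m) (\<lambda>c. h (incr m c)))"
      using m by (subst rec) (auto simp: sum_distrib_left)
    finally have *: "real (Suc n) * ?A (Suc n) (\<lambda>c. real (c m) * h c) =
      \<theta> / real m * (real (Suc n - m) * ?A (Suc n - m) (\<lambda>c. h (incr m c))) + \<theta> * ?A (Suc n - m) (\<lambda>c. h (incr m c))" .
    \<comment> \<open>With \<open>N = Suc n\<close> and \<open>M = m\<close>, the two terms are
      multiples of \<open>\<theta> / M * Y\<close> by \<open>N - M\<close> and \<open>M\<close>,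
      which add up to \<open>N\<close>.\<close>
    have "X = \<theta> / M * Y" if "N * X = \<theta> / M * ((N - M) * Y) + \<theta> * Y" "M \<noteq> 0" "N \<noteq> 0" for N M X Y :: real
    proof -
      have "N * X = N * (\<theta> / M * Y)" using that by (simp add: field_simps)
      then show ?thesis using mult_left_cancel[OF that(3)] by blast
    qed
    from this[OF *[unfolded of_nat_diff[OF \<open>m \<in> {1..Suc n}\<close>[unfolded atLeastAtMost_iff, THEN conjunct2]]]]
    show ?thesis using m by (simp del: of_nat_Suc)
  qed
  then have bias': "\<forall>h. \<forall>m\<in>{1..Suc n}. ?A (Suc n) (\<lambda>c. real (c m) * h c) = \<theta> / real m * ?A (Suc n - m) (\<lambda>c. h (incr m c))"
    by blast
  show ?case
  proof (intro allI impI)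
    fix k assume "k \<le> Suc n"
    then consider "k \<le> n" | "k = Suc n" by linarith
    then show "(\<forall>h. real k * ?A k h = \<theta> * (\<Sum>j=1..k. ?A (k - j) (\<lambda>c. h (incr j c)))) \<and>
      (\<forall>h. \<forall>m\<in>{1..k}. ?A k (\<lambda>c. real (c m) * h c) = \<theta> / real m * ?A (k - m) (\<lambda>c. h (incr m c)))"
    proof cases
      case 1
      then show ?thesis using Suc.IH by blast
    next
      case 2
      show ?thesis unfolding 2 using rec' bias' by blast
    qed
  qed
qed

lemma ewens_sum_recursion:
  "real n * ewens_sum \<theta> n h = \<theta> * (\<Sum>j=1..n. ewens_sum \<theta> (n - j) (\<lambda>c. h (incr j c)))"
  using ewens_sum_identities by blast

lemma ewens_sum_size_bias:
  "m \<in> {1..n} \<Longrightarrow> ewens_sum \<theta> n (\<lambda>c. real (c m) * h c) =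
     \<theta> / real m * ewens_sum \<theta> (n - m) (\<lambda>c. h (incr m c))"
  using ewens_sum_identities by blast

section \<open>Total mass and linear statistics\<close>

lemma abs_le_one_plus_square: "\<bar>x\<bar> \<le> 1 + x\<^sup>2" for x :: real
proof -
  have "2 * \<bar>x\<bar> \<le> 1 + x\<^sup>2" using zero_le_power2[of "\<bar>x\<bar> - 1"] by (simp add: power2_diff)
  then show ?thesis using abs_ge_zero[of x] by linarith
qed

text \<open>The coefficient of z^n in (1 - z)^(-\<theta>); by \<open>ewens_sum_1\<close> it is the
  total mass of \<open>ewens_sum\<close>.\<close>

definition ewens_weight :: "real \<Rightarrow> nat \<Rightarrow> real" where
  "ewens_weight \<theta> n = pochhammer \<theta> n / fact n"

lemma ewens_weight_0 [simp]: "ewens_weight \<theta> 0 = 1"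
  by (simp add: ewens_weight_def)

lemma ewens_weight_Suc: "real (Suc n) * ewens_weight \<theta> (Suc n) = (\<theta> + real n) * ewens_weight \<theta> n"
  by (simp add: ewens_weight_def pochhammer_Suc mult.commute del: of_nat_Suc)

lemma ewens_weight_pos: "\<theta> > 0 \<Longrightarrow> ewens_weight \<theta> n > 0"
  by (simp add: ewens_weight_def pochhammer_pos)

text \<open>For F(z) = (1 - z)^(-\<theta>) this is F' = \<theta> F / (1 - z) in terms of
  coefficients. It says that the numbers \<open>\<theta> * ewens_weight \<theta> (n - j) / (n *
  ewens_weight \<theta> n)\<close> for \<open>j = 1, ..., n\<close> are a probability distribution:
  the law of the length of the cycle that contains a uniformly chosen point.\<close>

lemma sum_ewens_weight: "\<theta> * (\<Sum>i<n. ewens_weight \<theta> i) = real n * ewens_weight \<theta> n"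
proof (induction n)
  case (Suc n)
  then show ?case using ewens_weight_Suc[of n \<theta>] by (simp add: algebra_simps)
qed simp

lemma ewens_sum_1: "ewens_sum \<theta> n (\<lambda>_. 1) = ewens_weight \<theta> n"
proof (induction n)
  case 0
  have "perms 0 = {id}" by (simp add: perms_def)
  then show ?case by (simp add: ewens_sum_def num_cycles_def cycles_of_def)
next
  case (Suc n)
  have "(\<Sum>m=1..n. real m * ewens_sum \<theta> n (\<lambda>c. real (c m) * 1)) = ewens_sum \<theta> n (\<lambda>c. \<Sum>m=1..n. real m * real (c m))"
    by (simp add: ewens_sum_sum ewens_sum_cmult)
  also have "\<dots> = ewens_sum \<theta> n (\<lambda>c. real n * 1)"
    by (rule ewens_sum_cong) (use sum_counts in simp)
  also have "\<dots> = real n * ewens_weight \<theta> n" using Suc by (subst ewens_sum_cmult) simp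
  finally have "real (Suc n) * ewens_sum \<theta> (Suc n) (\<lambda>_. 1) = real (Suc n) * ewens_weight \<theta> (Suc n)"
    unfolding ewens_sum_Suc ewens_weight_Suc using Suc by (simp add: algebra_simps)
  then show ?case by (simp del: of_nat_Suc)
qed

text \<open>Not normalised: the total mass is \<open>ewens_weight \<theta> n\<close>, so expectations are quotients by it.\<close>

definition lin_stat :: "real \<Rightarrow> (nat \<Rightarrow> real) \<Rightarrow> nat \<Rightarrow> (real \<Rightarrow> real) \<Rightarrow> real" where
  "lin_stat \<theta> u n g = ewens_sum \<theta> n (\<lambda>c. g (\<Sum>m=1..n. u m * real (c m)))"

text \<open>The upper limit of the sum may be \<open>n\<close> or \<open>n - j\<close>, because a
  permutation of size \<open>n - j\<close> has no longer cycles; the added cycle contributes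
  \<open>u j\<close>.\<close>

lemma lin_stat_shift:
  assumes "j \<in> {1..n}"
  shows "ewens_sum \<theta> (n - j) (\<lambda>c. g (\<Sum>m=1..n. u m * real ((incr j c) m))) =
    lin_stat \<theta> u (n - j) (\<lambda>x. g (x + u j))"
  unfolding lin_stat_def
proof (rule ewens_sum_cong)
  fix \<sigma> assume s: "\<sigma> \<in> perms (n - j)"
  let ?c = "counts (n - j) \<sigma>"
  have "(\<Sum>m=1..n. u m * real ((incr j ?c) m)) = (\<Sum>m=1..n. u m * real (?c m) + (if m = j then u j else 0))"
    by (intro sum.cong) (auto simp: algebra_simps)
  also have "\<dots> = (\<Sum>m=1..n. u m * real (?c m)) + u j"
    using assms by (simp add: sum.distrib)
  also have "(\<Sum>m=1..n. u m * real (?c m)) = (\<Sum>m=1..n-j. u m * real (?c m))"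
    by (rule sum.mono_neutral_right) (use counts_eq_0[OF s] in auto)
  finally show "g (\<Sum>m=1..n. u m * real ((incr j ?c) m)) = g ((\<Sum>m=1..n-j. u m * real (?c m)) + u j)"
    by simp
qed

lemma lin_stat_recursion:
  "real n * lin_stat \<theta> u n g = \<theta> * (\<Sum>j=1..n. lin_stat \<theta> u (n - j) (\<lambda>x. g (x + u j)))"
proof -
  have "real n * lin_stat \<theta> u n g = \<theta> * (\<Sum>j=1..n. ewens_sum \<theta> (n - j) (\<lambda>c. g (\<Sum>m=1..n. u m * real ((incr j c) m))))"
    by (subst lin_stat_def) (rule ewens_sum_recursion)
  also have "(\<Sum>j=1..n. ewens_sum \<theta> (n - j) (\<lambda>c. g (\<Sum>m=1..n. u m * real ((incr j c) m)))) =
    (\<Sum>j=1..n. lin_stat \<theta> u (n - j) (\<lambda>x. g (x + u j)))"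
    by (rule sum.cong[OF refl]) (rule lin_stat_shift)
  finally show ?thesis .
qed

lemma lin_stat_size_bias:
  "lin_stat \<theta> u n (\<lambda>x. x * g x) = (\<Sum>m=1..n. \<theta> * u m / real m * lin_stat \<theta> u (n - m) (\<lambda>x. g (x + u m)))"
proof -
  let ?T = "\<lambda>c. \<Sum>m=1..n. u m * real (c m)"
  have "lin_stat \<theta> u n (\<lambda>x. x * g x) = ewens_sum \<theta> n (\<lambda>c. \<Sum>m=1..n. u m * (real (c m) * g (?T c)))"
    by (simp add: lin_stat_def sum_distrib_right mult.assoc)
  also have "\<dots> = (\<Sum>m=1..n. u m * ewens_sum \<theta> n (\<lambda>c. real (c m) * g (?T c)))"
    by (simp only: ewens_sum_sum ewens_sum_cmult)
  also have "\<dots> = (\<Sum>m=1..n. \<theta> * u m / real m * lin_stat \<theta> u (n - m) (\<lambda>x. g (x + u m)))"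
  proof (rule sum.cong[OF refl])
    fix m assume m: "m \<in> {1..n}"
    have "ewens_sum \<theta> n (\<lambda>c. real (c m) * g (?T c)) = \<theta> / real m * lin_stat \<theta> u (n - m) (\<lambda>x. g (x + u m))"
      using ewens_sum_size_bias[OF m, of \<theta> "\<lambda>c. g (?T c)"] lin_stat_shift[OF m, of \<theta> g u] by simp
    then show "u m * ewens_sum \<theta> n (\<lambda>c. real (c m) * g (?T c)) = \<theta> * u m / real m * lin_stat \<theta> u (n - m) (\<lambda>x. g (x + u m))"
      by simp
  qed
  finally show ?thesis .
qed

lemma lin_stat_0 [simp]: "lin_stat \<theta> u 0 g = g 0"
  using ewens_sum_cmult[of \<theta> 0 "g 0" "\<lambda>_. 1"] by (simp add: lin_stat_def ewens_sum_1)

lemma lin_stat_add: "lin_stat \<theta> u n (\<lambda>x. g x + h x) = lin_stat \<theta> u n g + lin_stat \<theta> u n h"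
  by (simp add: lin_stat_def ewens_sum_add)

lemma lin_stat_cmult: "lin_stat \<theta> u n (\<lambda>x. a * g x) = a * lin_stat \<theta> u n g"
  by (simp add: lin_stat_def ewens_sum_cmult)

lemma lin_stat_diff: "lin_stat \<theta> u n (\<lambda>x. g x - h x) = lin_stat \<theta> u n g - lin_stat \<theta> u n h"
  using lin_stat_add[of \<theta> u n g "\<lambda>x. (-1) * h x"] unfolding lin_stat_cmult by simp

lemma lin_stat_const: "lin_stat \<theta> u n (\<lambda>_. a) = a * ewens_weight \<theta> n"
  using ewens_sum_cmult[of \<theta> n a "\<lambda>_. 1"] by (simp add: lin_stat_def ewens_sum_1)

lemma lin_stat_mono:
  assumes "\<theta> > 0" "\<And>x. g x \<le> h x"
  shows "lin_stat \<theta> u n g \<le> lin_stat \<theta> u n h"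
  unfolding lin_stat_def using assms by (intro ewens_sum_mono)

lemma lin_stat_abs_le:
  assumes "\<theta> > 0" "\<And>x. \<bar>g x\<bar> \<le> h x"
  shows "\<bar>lin_stat \<theta> u n g\<bar> \<le> lin_stat \<theta> u n h"
proof -
  have "g x \<le> h x" "(-1) * g x \<le> h x" for x using assms(2)[of x] by auto
  then have "lin_stat \<theta> u n g \<le> lin_stat \<theta> u n h" "lin_stat \<theta> u n (\<lambda>x. (-1) * g x) \<le> lin_stat \<theta> u n h"
    by (intro lin_stat_mono[OF assms(1)]; simp)+
  then show ?thesis unfolding lin_stat_cmult by simp
qed

text \<open>Since \<Sum> m c_m = n, the statistic is at most C n in absolute value. This is far from
  its true size, but polynomial growth is harmless against \<open>r ^ k\<close>, so the mixture
  converges for test functions of quadratic growth.\<close>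

lemma lin_stat_growth:
  assumes th: "\<theta> > 0" and u: "\<And>m. m \<ge> 1 \<Longrightarrow> \<bar>u m\<bar> \<le> C * real m" and "C \<ge> 0"
    and g: "\<And>x. \<bar>g x\<bar> \<le> D * (1 + x\<^sup>2)" and "D \<ge> 0"
  shows "\<bar>lin_stat \<theta> u n g\<bar> \<le> D * (1 + C\<^sup>2) * (ewens_weight \<theta> n * (1 + real n)\<^sup>2)"
proof -
  have T: "(\<Sum>m=1..n. u m * real (counts n \<sigma> m))\<^sup>2 \<le> (C * real n)\<^sup>2" if "\<sigma> \<in> perms n" for \<sigma>
  proof -
    have "\<bar>\<Sum>m=1..n. u m * real (counts n \<sigma> m)\<bar> \<le> (\<Sum>m=1..n. C * (real m * real (counts n \<sigma> m)))"
      by (intro order_trans[OF sum_abs] sum_mono) (simp add: abs_mult u mult_right_mono flip: mult.assoc)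
    also have "\<dots> = C * real n" using sum_counts[OF that] by (simp flip: sum_distrib_left)
    finally show ?thesis by (metis abs_le_square_iff abs_of_nonneg \<open>C \<ge> 0\<close> mult_nonneg_nonneg of_nat_0_le_iff)
  qed
  have "lin_stat \<theta> u n (\<lambda>x. D * (1 + x\<^sup>2)) \<le> ewens_sum \<theta> n (\<lambda>_. D * (1 + (C * real n)\<^sup>2) * 1)"
    unfolding lin_stat_def using T \<open>D \<ge> 0\<close> by (intro ewens_sum_mono[OF th]) (auto intro!: mult_left_mono)
  also have "\<dots> = D * (1 + (C * real n)\<^sup>2) * ewens_weight \<theta> n"
    by (subst ewens_sum_cmult) (simp add: ewens_sum_1)
  also have "1 + (C * real n)\<^sup>2 \<le> (1 + C\<^sup>2) * (1 + real n)\<^sup>2"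
    using \<open>C \<ge> 0\<close> by (simp add: power2_eq_square algebra_simps)
  finally have "lin_stat \<theta> u n (\<lambda>x. D * (1 + x\<^sup>2)) \<le> D * ((1 + C\<^sup>2) * (1 + real n)\<^sup>2) * ewens_weight \<theta> n"
    using \<open>D \<ge> 0\<close> ewens_weight_pos[OF th, of n] by (simp add: mult_left_mono mult_right_mono)
  moreover have "\<bar>lin_stat \<theta> u n g\<bar> \<le> lin_stat \<theta> u n (\<lambda>x. D * (1 + x\<^sup>2))"
    by (rule lin_stat_abs_le[OF th g])
  ultimately show ?thesis by (simp add: mult_ac)
qed

lemma summable_ewens_weight:
  assumes "\<theta> > 0" "0 < r" "r < 1"
  shows "summable (\<lambda>k. r ^ k * (ewens_weight \<theta> k * (1 + real k)\<^sup>2))"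
proof -
  have "(\<lambda>k. r * ((\<theta> + real k) / (1 + real k)) * ((2 + real k) / (1 + real k))\<^sup>2) \<longlonglongrightarrow> r"
    by real_asymp
  then have "eventually (\<lambda>k. r * ((\<theta> + real k) / (1 + real k)) * ((2 + real k) / (1 + real k))\<^sup>2 < (1 + r) / 2) sequentially"
    by (rule order_tendstoD) (use assms in simp)
  then obtain N where N: "\<And>k. k \<ge> N \<Longrightarrow> r * ((\<theta> + real k) / (1 + real k)) * ((2 + real k) / (1 + real k))\<^sup>2 < (1 + r) / 2"
    by (auto simp: eventually_sequentially)
  show ?thesis
  proof (rule summable_ratio_test[of "(1 + r) / 2" N])
    show "(1 + r) / 2 < 1" using assms by simp
    fix k assume k: "N \<le> k"
    have a: "ewens_weight \<theta> (Suc k) = (\<theta> + real k) / (1 + real k) * ewens_weight \<theta> k"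
      using ewens_weight_Suc[of k \<theta>] by (simp add: field_simps)
    have pos: "0 \<le> r ^ k * (ewens_weight \<theta> k * (1 + real k)\<^sup>2)" for k
      using assms ewens_weight_pos[of \<theta> k] by simp
    have "r ^ Suc k * (ewens_weight \<theta> (Suc k) * (1 + real (Suc k))\<^sup>2) =
      (r * ((\<theta> + real k) / (1 + real k)) * ((2 + real k) / (1 + real k))\<^sup>2) * (r ^ k * (ewens_weight \<theta> k * (1 + real k)\<^sup>2))"
      unfolding a by (simp add: divide_simps)
    also have "\<dots> \<le> (1 + r) / 2 * (r ^ k * (ewens_weight \<theta> k * (1 + real k)\<^sup>2))"
      using N[OF k] pos by (intro mult_right_mono) auto
    finally show "norm (r ^ Suc k * (ewens_weight \<theta> (Suc k) * (1 + real (Suc k))\<^sup>2)) \<le>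
      (1 + r) / 2 * norm (r ^ k * (ewens_weight \<theta> k * (1 + real k)\<^sup>2))"
      using pos[of k] pos[of "Suc k"] by simp
  qed
qed

section \<open>Poissonisation\<close>

text \<open>Not normalised, like \<open>lin_stat\<close>: the expectation for the random size is the
  quotient by \<open>mix_total\<close>, which is the value of (1 - z)^(-\<theta>) at
  \<open>r\<close>.\<close>

definition mix_stat :: "real \<Rightarrow> (nat \<Rightarrow> real) \<Rightarrow> real \<Rightarrow> (real \<Rightarrow> real) \<Rightarrow> real" where
  "mix_stat \<theta> u r g = (\<Sum>k. r ^ k * lin_stat \<theta> u k g)"

abbreviation mix_total :: "real \<Rightarrow> real \<Rightarrow> real" where
  "mix_total \<theta> r \<equiv> (\<Sum>k. r ^ k * ewens_weight \<theta> k)"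

context
  fixes \<theta> r C :: real and u :: "nat \<Rightarrow> real"
  assumes th: "\<theta> > 0" and r: "0 < r" "r < 1" and u: "\<And>m. m \<ge> 1 \<Longrightarrow> \<bar>u m\<bar> \<le> C * real m"
begin

lemma summable_mix_stat_abs:
  assumes g: "\<And>x. \<bar>g x\<bar> \<le> D * (1 + x\<^sup>2)"
  shows "summable (\<lambda>k. \<bar>r ^ k * lin_stat \<theta> u k g\<bar>)"
proof -
  have C: "C \<ge> 0" using u[of 1] by simp
  have D: "D \<ge> 0" using g[of 0] by simp
  have "summable (\<lambda>k. D * (1 + C\<^sup>2) * (r ^ k * (ewens_weight \<theta> k * (1 + real k)\<^sup>2)))"
    by (intro summable_mult summable_ewens_weight th r)
  then show ?thesis
  proof (rule summable_comparison_test')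
    fix k :: nat assume "k \<ge> 0"
    have "r ^ k * \<bar>lin_stat \<theta> u k g\<bar> \<le> r ^ k * (D * (1 + C\<^sup>2) * (ewens_weight \<theta> k * (1 + real k)\<^sup>2))"
      using lin_stat_growth[OF th u C g D] r by (intro mult_left_mono) auto
    then show "norm \<bar>r ^ k * lin_stat \<theta> u k g\<bar> \<le> D * (1 + C\<^sup>2) * (r ^ k * (ewens_weight \<theta> k * (1 + real k)\<^sup>2))"
      using r by (simp add: abs_mult mult_ac)
  qed
qed

lemma summable_mix_stat:
  "(\<And>x. \<bar>g x\<bar> \<le> D * (1 + x\<^sup>2)) \<Longrightarrow> summable (\<lambda>k. r ^ k * lin_stat \<theta> u k g)"
  using summable_rabs_cancel[OF summable_mix_stat_abs] .

end

lemma summable_mix_total: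
  assumes "\<theta> > 0" "0 < r" "r < 1"
  shows "summable (\<lambda>k. r ^ k * ewens_weight \<theta> k)" "summable (\<lambda>k. r ^ k * (real k * ewens_weight \<theta> k))"
proof -
  have *: "0 \<le> r ^ k * ewens_weight \<theta> k" for k using assms ewens_weight_pos[of \<theta> k] by simp
  have **: "1 \<le> (1 + real k)\<^sup>2" "real k \<le> (1 + real k)\<^sup>2" for k
    by (simp_all add: power2_eq_square algebra_simps)
  show "summable (\<lambda>k. r ^ k * ewens_weight \<theta> k)"
    using summable_ewens_weight[OF assms]
  proof (rule summable_comparison_test')
    fix k :: nat assume "k \<ge> 0"
    show "norm (r ^ k * ewens_weight \<theta> k) \<le> r ^ k * (ewens_weight \<theta> k * (1 + real k)\<^sup>2)"
      using mult_left_mono[OF **(1)[of k] *[of k]] *[of k] by (simp add: mult_ac)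
  qed
  show "summable (\<lambda>k. r ^ k * (real k * ewens_weight \<theta> k))"
    using summable_ewens_weight[OF assms]
  proof (rule summable_comparison_test')
    fix k :: nat assume "k \<ge> 0"
    have "norm (r ^ k * (real k * ewens_weight \<theta> k)) = r ^ k * ewens_weight \<theta> k * real k"
      using *[of k] by (simp add: mult_ac)
    also have "\<dots> \<le> r ^ k * ewens_weight \<theta> k * (1 + real k)\<^sup>2"
      using mult_left_mono[OF **(2)[of k] *[of k]] .
    finally show "norm (r ^ k * (real k * ewens_weight \<theta> k)) \<le> r ^ k * (ewens_weight \<theta> k * (1 + real k)\<^sup>2)"
      by (simp add: mult.assoc)
  qed
qed

lemma mix_total_pos:
  assumes "\<theta> > 0" "0 < r" "r < 1"
  shows "mix_total \<theta> r > 0"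
proof (rule suminf_pos)
  show "summable (\<lambda>k. r ^ k * ewens_weight \<theta> k)" using summable_mix_total[OF assms] by simp
  show "\<And>k. 0 < r ^ k * ewens_weight \<theta> k" using assms ewens_weight_pos by simp
qed

text \<open>This is r F'(r) = \<theta> r F(r) / (1 - r) for F(z) = (1 - z)^(-\<theta>). For r = 1 -
  1 / n the mean size is thus \<theta> (n - 1), of order n.\<close>

lemma mix_mean:
  assumes "\<theta> > 0" "0 < r" "r < 1"
  shows "(1 - r) * (\<Sum>k. r ^ k * (real k * ewens_weight \<theta> k)) = \<theta> * r * mix_total \<theta> r"
proof -
  let ?f = "\<lambda>k. r ^ k * (real k * ewens_weight \<theta> k)"
  note s = summable_mix_total[OF assms]
  have "suminf ?f = (\<Sum>k. ?f (Suc k))"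
    using suminf_split_head[OF s(2)] by simp
  also have "\<dots> = (\<Sum>k. (\<theta> * r) * (r ^ k * ewens_weight \<theta> k) + r * ?f k)"
  proof (rule suminf_cong)
    fix k
    have "?f (Suc k) = r ^ Suc k * ((\<theta> + real k) * ewens_weight \<theta> k)" by (simp only: ewens_weight_Suc)
    then show "?f (Suc k) = (\<theta> * r) * (r ^ k * ewens_weight \<theta> k) + r * ?f k"
      by (simp add: algebra_simps)
  qed
  also have "\<dots> = \<theta> * r * mix_total \<theta> r + r * suminf ?f"
    using s by (subst suminf_add[symmetric]) (auto intro!: summable_mult simp: suminf_mult)
  finally show ?thesis by (simp add: algebra_simps)
qed

section \<open>Comparison of fixed and random size\<close>

lemma sum_reflect: "(\<Sum>j=1..k. f (k - j)) = (\<Sum>i<k. f i)" for f :: "nat \<Rightarrow> real"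
proof -
  have "(\<Sum>j=1..k. f (k - j)) = (\<Sum>j\<in>Suc ` {..<k}. f (k - j))"
    by (simp add: image_Suc_lessThan)
  also have "\<dots> = (\<Sum>i<k. f (k - Suc i))"
    by (subst sum.reindex) auto
  also have "\<dots> = (\<Sum>i<k. f i)" by (rule sum.nat_diff_reindex)
  finally show ?thesis .
qed

text \<open>
  With \<open>a\<^sub>i\<close> the weights and \<open>e\<^sub>i\<close> the expectations, \<open>lin_stat_recursion\<close> says that \<open>e\<^sub>n\<close> is close to the
  weighted mean of \<open>e\<^sub>0, \<dots>, e\<^sub>n\<^sub>-\<^sub>1\<close>. Such means vary slowly.
\<close>

lemma weighted_mean_slow:
  fixes e :: "nat \<Rightarrow> real" and \<theta> :: real
  defines "a \<equiv> ewens_weight \<theta>"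
  defines "F \<equiv> (\<lambda>k. if k = 0 then e 0 else (\<Sum>i<k. a i * e i) / (\<Sum>i<k. a i))"
  assumes th: "\<theta> > 0" and near: "\<And>k. k \<ge> 1 \<Longrightarrow> \<bar>e k - F k\<bar> \<le> \<beta>" and n: "n \<ge> 1"
  shows "\<bar>e n - e k\<bar> \<le> 2 * \<beta> + \<theta> * \<beta> * (real k / real n + (\<Sum>l\<in>{k..<n}. 1 / (\<theta> + real l)))"
proof -
  let ?s = "\<lambda>k. \<Sum>i<k. a i"
  have apos: "a k > 0" for k using ewens_weight_pos[OF th] by (simp add: a_def)
  have beta: "\<beta> \<ge> 0" using near[of 1] by linarith
  have near': "\<bar>e k - F k\<bar> \<le> \<beta>" for k using near[of k] beta by (cases "k = 0") (auto simp: F_def)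
  have sF: "?s k * F k = (\<Sum>i<k. a i * e i)" for k
  proof (cases "k = 0")
    case False
    then have "?s k > 0" using apos by (intro sum_pos) auto
    then show ?thesis using False by (simp add: F_def)
  qed (simp add: F_def)
  \<comment> \<open>A new term moves a weighted mean by its share of the total weight, here
    \<open>\<theta> / (\<theta> + k)\<close> by \<open>sum_ewens_weight\<close>, times its deviation
    from the old mean, which is at most \<beta>.\<close>
  have incr: "\<bar>F (Suc k) - F k\<bar> \<le> \<theta> * \<beta> * (1 / (\<theta> + real k))" for k
  proof -
    have s1: "\<theta> * ?s (Suc k) = (\<theta> + real k) * a k"
      using sum_ewens_weight[of \<theta> "Suc k"] ewens_weight_Suc[of k \<theta>] unfolding a_def by simp
    have "?s (Suc k) * (F (Suc k) - F k) = a k * (e k - F k)"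
      using sF[of k] sF[of "Suc k"] by (simp add: algebra_simps)
    then have "\<theta> * ?s (Suc k) * (F (Suc k) - F k) = \<theta> * (a k * (e k - F k))" by (simp only: mult.assoc)
    then have "a k * ((\<theta> + real k) * (F (Suc k) - F k)) = a k * (\<theta> * (e k - F k))"
      unfolding s1 by (simp only: mult_ac)
    then have "(\<theta> + real k) * (F (Suc k) - F k) = \<theta> * (e k - F k)" using apos[of k] by simp
    then have "F (Suc k) - F k = \<theta> * (e k - F k) / (\<theta> + real k)" using th by (simp add: field_simps)
    also have "\<bar>\<dots>\<bar> = \<theta> * \<bar>e k - F k\<bar> / (\<theta> + real k)" using th by (simp add: abs_mult)
    also have "\<dots> \<le> \<theta> * \<beta> / (\<theta> + real k)" using th near'[of k] by (intro divide_right_mono mult_left_mono) auto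
    finally show ?thesis by simp
  qed
  have tele: "\<bar>F j - F i\<bar> \<le> \<theta> * \<beta> * (\<Sum>l\<in>{i..<j}. 1 / (\<theta> + real l))" if "i \<le> j" for i j
    using that
  proof (induction j rule: dec_induct)
    case (step j)
    have "\<bar>F (Suc j) - F i\<bar> \<le> \<bar>F (Suc j) - F j\<bar> + \<bar>F j - F i\<bar>" by simp
    then show ?case using step incr[of j] by (simp add: distrib_left)
  qed simp
  have nonneg: "0 \<le> (\<Sum>l\<in>{i..<j}. 1 / (\<theta> + real l))" for i j using th by (intro sum_nonneg) simp
  have "\<bar>F n - F k\<bar> \<le> \<theta> * \<beta> * (real k / real n + (\<Sum>l\<in>{k..<n}. 1 / (\<theta> + real l)))"
  proof (cases "k \<le> n")
    case True
    have "\<theta> * \<beta> * (\<Sum>l\<in>{k..<n}. 1 / (\<theta> + real l)) \<le> \<theta> * \<beta> * (real k / real n + (\<Sum>l\<in>{k..<n}. 1 / (\<theta> + real l)))"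
      using th beta by (intro mult_left_mono) auto
    then show ?thesis using tele[OF True] by simp
  next
    case False
    \<comment> \<open>From \<open>n\<close> on each term is at most \<open>1 / n\<close>, and there
      are fewer than \<open>k\<close> of them; this is the origin of the summand
      \<open>k / n\<close>.\<close>
    have "(\<Sum>l\<in>{n..<k}. 1 / (\<theta> + real l)) \<le> real (card {n..<k}) * (1 / real n)"
      using th n by (intro sum_bounded_above) (auto intro!: frac_le)
    also have "\<dots> \<le> real k / real n" using False n by (simp add: divide_right_mono)
    finally have "(\<Sum>l\<in>{n..<k}. 1 / (\<theta> + real l)) \<le> real k / real n + (\<Sum>l\<in>{k..<n}. 1 / (\<theta> + real l))"
      using nonneg[where i=k and j=n] by linarith
    then have "\<theta> * \<beta> * (\<Sum>l\<in>{n..<k}. 1 / (\<theta> + real l)) \<le> \<theta> * \<beta> * (real k / real n + (\<Sum>l\<in>{k..<n}. 1 / (\<theta> + real l)))"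
      using th beta by (intro mult_left_mono) auto
    then show ?thesis using tele[of n k] False by (simp add: abs_minus_commute)
  qed
  moreover have "\<bar>e n - e k\<bar> \<le> \<bar>e n - F n\<bar> + \<bar>e k - F k\<bar> + \<bar>F n - F k\<bar>" by linarith
  ultimately show ?thesis using near'[of n] near'[of k] by linarith
qed

text \<open>The inverse of 1 - 1 / n is 1 + 1 / (n - 1), whose k-th power is at most e for k \<le> n
  - 1. Sums over k < n may therefore be weighted by \<open>r ^ k\<close> at the cost of a factor
  e.\<close>

lemma power_one_minus_inverse_ge:
  assumes "n \<ge> 2" "k < n"
  shows "1 \<le> exp 1 * (1 - 1 / real n) ^ k"
proof -
  define x where "x = 1 / (real n - 1)"
  have x: "x > 0" "(1 - 1 / real n) * (1 + x) = 1" using assms by (auto simp: x_def field_simps)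
  have r0: "0 < 1 - 1 / real n" using assms by simp
  have "(1 + x) ^ k \<le> exp x ^ k" using x by (intro power_mono) auto
  also have "\<dots> = exp (real k * x)" by (simp add: exp_of_nat_mult)
  also have "\<dots> \<le> exp 1" using assms by (simp add: x_def)
  finally have "(1 - 1 / real n) ^ k * (1 + x) ^ k \<le> (1 - 1 / real n) ^ k * exp 1"
    using r0 by (intro mult_left_mono) auto
  moreover have "(1 - 1 / real n) ^ k * (1 + x) ^ k = 1" using x(2) by (simp flip: power_mult_distrib)
  ultimately show ?thesis by (simp add: mult.commute)
qed

text \<open>The hypothesis on \<beta> bounds the mean of |u_j| when j is the length of the cycle of
  a random point; for a 1-Lipschitz \<open>g\<close> this is the error made in the recursion by
  dropping that cycle. The constant comes from averaging \<open>weighted_mean_slow\<close> over the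
  mixture: 2 as it stands, \<theta>^2 because k / n has mean at most \<theta>, and e because the
  harmonic sums have mean at most e / \<theta>.\<close>

lemma lin_stat_mix_stat_close:
  fixes \<theta> \<beta> C :: real and u :: "nat \<Rightarrow> real" and n :: nat
  defines "r \<equiv> 1 - 1 / real n"
  assumes th: "\<theta> > 0" and u: "\<And>m. m \<ge> 1 \<Longrightarrow> \<bar>u m\<bar> \<le> C * real m"
    and beta: "\<And>k. k \<ge> 1 \<Longrightarrow> \<theta> * (\<Sum>j=1..k. ewens_weight \<theta> (k - j) * \<bar>u j\<bar>) \<le> real k * ewens_weight \<theta> k * \<beta>"
    and g: "\<And>x y. \<bar>g x - g y\<bar> \<le> \<bar>x - y\<bar>" and n: "n \<ge> 2"
  shows "\<bar>lin_stat \<theta> u n g / ewens_weight \<theta> n - mix_stat \<theta> u r g / mix_total \<theta> r\<bar> \<le> \<beta> * (2 + \<theta>\<^sup>2 + exp 1)"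
proof -
  define a where "a = ewens_weight \<theta>"
  define e where "e k = lin_stat \<theta> u k g / a k" for k
  define Z where "Z = mix_total \<theta> r"
  have r: "0 < r" "r < 1" using n by (simp_all add: r_def)
  have apos: "a k > 0" for k using ewens_weight_pos[OF th] by (simp add: a_def)
  have ae: "a k * e k = lin_stat \<theta> u k g" for k using apos[of k] by (simp add: e_def)
  have "\<theta> * \<bar>u 1\<bar> \<le> a 1 * \<beta>" using beta[of 1] by (simp add: a_def)
  moreover have "0 \<le> \<theta> * \<bar>u 1\<bar>" using th by simp
  ultimately have b0: "\<beta> \<ge> 0" using apos[of 1] zero_le_mult_iff[of "a 1" \<beta>] by linarith
  have near: "\<bar>e k - (if k = 0 then e 0 else (\<Sum>i<k. a i * e i) / (\<Sum>i<k. a i))\<bar> \<le> \<beta>" if k: "k \<ge> 1" for k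
  proof -
    let ?L = "lin_stat \<theta> u"
    have "\<bar>?L (k - j) (\<lambda>x. g (x + u j)) - ?L (k - j) g\<bar> \<le> a (k - j) * \<bar>u j\<bar>" for j
    proof -
      have "\<bar>g (x + u j) - g x\<bar> \<le> \<bar>u j\<bar>" for x using g[of "x + u j" x] by simp
      from lin_stat_abs_le[OF th, of "\<lambda>x. g (x + u j) - g x" "\<lambda>_. \<bar>u j\<bar>" u "k - j", OF this]
      show ?thesis by (simp add: lin_stat_diff lin_stat_const a_def mult.commute)
    qed
    then have "\<bar>(\<Sum>j=1..k. ?L (k - j) (\<lambda>x. g (x + u j)) - ?L (k - j) g)\<bar> \<le> (\<Sum>j=1..k. a (k - j) * \<bar>u j\<bar>)"
      by (intro order_trans[OF sum_abs] sum_mono)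
    then have "\<theta> * \<bar>(\<Sum>j=1..k. ?L (k - j) (\<lambda>x. g (x + u j)) - ?L (k - j) g)\<bar> \<le> real k * a k * \<beta>"
      using beta[OF k] mult_left_mono[of _ _ \<theta>] th unfolding a_def by (meson less_imp_le order_trans)
    also have "\<theta> * \<bar>(\<Sum>j=1..k. ?L (k - j) (\<lambda>x. g (x + u j)) - ?L (k - j) g)\<bar> =
      \<bar>real k * ?L k g - \<theta> * (\<Sum>j=1..k. ?L (k - j) g)\<bar>"
      unfolding lin_stat_recursion using th by (simp add: sum_subtractf right_diff_distrib[symmetric] abs_mult)
    also have "(\<Sum>j=1..k. ?L (k - j) g) = (\<Sum>i<k. a i * e i)"
      unfolding ae by (rule sum_reflect)
    finally have "\<bar>real k * (a k * e k) - \<theta> * (\<Sum>i<k. a i * e i)\<bar> \<le> real k * a k * \<beta>" unfolding ae .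
    moreover have sk: "real k * a k = \<theta> * (\<Sum>i<k. a i)" using sum_ewens_weight[of \<theta> k] by (simp add: a_def)
    moreover have spos: "(\<Sum>i<k. a i) > 0" using apos k by (intro sum_pos) (auto simp: lessThan_empty_iff)
    moreover have "real k * (a k * e k) - \<theta> * (\<Sum>i<k. a i * e i) =
       \<theta> * (\<Sum>i<k. a i) * (e k - (\<Sum>i<k. a i * e i) / (\<Sum>i<k. a i))"
      using sk spos by (simp add: field_simps)
    ultimately have "\<theta> * (\<Sum>i<k. a i) * \<bar>e k - (\<Sum>i<k. a i * e i) / (\<Sum>i<k. a i)\<bar> \<le> \<theta> * (\<Sum>i<k. a i) * \<beta>"
      using th by (simp add: abs_mult)
    then show ?thesis using k spos th by simp
  qed
  let ?h = "\<lambda>k. \<Sum>l\<in>{k..<n}. 1 / (\<theta> + real l)"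
  have diff: "\<bar>e n - e k\<bar> \<le> 2 * \<beta> + \<theta> * \<beta> * (real k / real n + ?h k)" for k
    using near n by (intro weighted_mean_slow[OF th]) (auto simp: a_def)
  note sm = summable_mix_total[OF th r, folded a_def]
  have Zpos: "Z > 0" unfolding Z_def by (rule mix_total_pos[OF th r])
  have gg: "\<bar>g x\<bar> \<le> (\<bar>g 0\<bar> + 1) * (1 + x\<^sup>2)" for x
  proof -
    have "\<bar>g x\<bar> \<le> \<bar>g 0\<bar> + \<bar>x\<bar>" using g[of x 0] by simp
    moreover have "\<bar>x\<bar> \<le> 1 + x\<^sup>2" using zero_le_power2[of "\<bar>x\<bar> - 1"] by (simp add: power2_diff)
    moreover have "0 \<le> \<bar>g 0\<bar> * x\<^sup>2" by simp
    ultimately show ?thesis unfolding distrib_left distrib_right by linarith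
  qed
  have sg: "summable (\<lambda>k. r ^ k * (a k * e k))"
    unfolding ae by (rule summable_mix_stat[OF th r u gg])
  have hs: "(\<lambda>k. r ^ k * (a k * ?h k)) sums (\<Sum>k<n. r ^ k * (a k * ?h k))"
    by (rule sums_finite) auto
  \<comment> \<open>Without the powers of \<open>r\<close> the sums can be interchanged: the weights
    up to \<open>l\<close> add up to \<open>(\<theta> + l) * a l / \<theta>\<close>, which cancels
    the denominator. Afterwards \<open>r ^ l\<close> is restored at the cost of e.\<close>
  have "(\<Sum>k<n. r ^ k * (a k * ?h k)) \<le> (\<Sum>k<n. a k * ?h k)"
  proof (rule sum_mono)
    fix k
    have "0 \<le> a k * ?h k" using apos[of k] th by (intro mult_nonneg_nonneg sum_nonneg) auto
    then show "r ^ k * (a k * ?h k) \<le> a k * ?h k" using r by (intro mult_left_le_one_le) (auto simp: power_le_one)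
  qed
  also have "\<dots> = (\<Sum>k<n. \<Sum>l<n. if k \<le> l then a k / (\<theta> + real l) else 0)"
  proof (rule sum.cong[OF refl])
    fix k
    have "(\<Sum>l<n. if k \<le> l then a k / (\<theta> + real l) else 0) = (\<Sum>l\<in>{l\<in>{..<n}. k \<le> l}. a k / (\<theta> + real l))"
      by (rule sum.inter_filter[symmetric]) simp
    also have "{l\<in>{..<n}. k \<le> l} = {k..<n}" by auto
    finally show "a k * ?h k = (\<Sum>l<n. if k \<le> l then a k / (\<theta> + real l) else 0)"
      by (simp add: sum_distrib_left)
  qed
  also have "\<dots> = (\<Sum>l<n. \<Sum>k<n. if k \<le> l then a k / (\<theta> + real l) else 0)" by (rule sum.swap)
  also have "\<dots> = (\<Sum>l<n. a l / \<theta>)"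
  proof (rule sum.cong[OF refl])
    fix l assume l: "l \<in> {..<n}"
    have "(\<Sum>k<n. if k \<le> l then a k / (\<theta> + real l) else 0) = (\<Sum>k\<in>{k\<in>{..<n}. k \<le> l}. a k / (\<theta> + real l))"
      by (rule sum.inter_filter[symmetric]) simp
    also have "{k\<in>{..<n}. k \<le> l} = {..<Suc l}" using l by auto
    also have "(\<Sum>k<Suc l. a k / (\<theta> + real l)) = (\<Sum>k<Suc l. a k) / (\<theta> + real l)"
      by (simp only: sum_divide_distrib)
    also have "(\<Sum>k<Suc l. a k) = (\<theta> + real l) * a l / \<theta>"
      using sum_ewens_weight[of \<theta> "Suc l"] ewens_weight_Suc[of l \<theta>] th unfolding a_def by (simp add: field_simps)
    finally show "(\<Sum>k<n. if k \<le> l then a k / (\<theta> + real l) else 0) = a l / \<theta>" using th by simp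
  qed
  also have "\<dots> \<le> (\<Sum>l<n. exp 1 * (r ^ l * a l) / \<theta>)"
  proof (intro sum_mono divide_right_mono)
    fix l assume "l \<in> {..<n}"
    then have "1 \<le> exp 1 * r ^ l" unfolding r_def using n by (intro power_one_minus_inverse_ge) auto
    from mult_right_mono[OF this, of "a l"] show "a l \<le> exp 1 * (r ^ l * a l)" using apos[of l] by (simp add: mult.assoc)
  qed (use th in simp)
  also have "\<dots> = exp 1 * (\<Sum>l<n. r ^ l * a l) / \<theta>" by (simp add: sum_distrib_left sum_divide_distrib)
  also have "\<dots> \<le> exp 1 * Z / \<theta>"
    unfolding Z_def a_def[symmetric] using apos r th
    by (intro divide_right_mono mult_left_mono sum_le_suminf sm(1)) (auto intro!: mult_nonneg_nonneg less_imp_le)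
  finally have hle: "(\<Sum>k. r ^ k * (a k * ?h k)) \<le> exp 1 * Z / \<theta>" using sums_unique[OF hs] by simp
  have mean: "(\<Sum>k. r ^ k * (real k * a k)) / real n \<le> \<theta> * Z"
  proof -
    have "(1 - r) * (\<Sum>k. r ^ k * (real k * a k)) = \<theta> * r * Z"
      using mix_mean[OF th r] by (simp add: a_def Z_def)
    also have "\<dots> \<le> \<theta> * 1 * Z" using th r Zpos by (intro mult_mono) auto
    finally show ?thesis by (simp add: r_def)
  qed
  let ?B = "\<lambda>k. 2 * \<beta> * (r ^ k * a k) + \<theta> * \<beta> * ((r ^ k * (real k * a k)) / real n + r ^ k * (a k * ?h k))"
  have sB: "?B sums (2 * \<beta> * Z + \<theta> * \<beta> * ((\<Sum>k. r ^ k * (real k * a k)) / real n + (\<Sum>k. r ^ k * (a k * ?h k))))"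
    unfolding Z_def a_def[symmetric]
    by (intro sums_add sums_mult sums_divide summable_sums sm sums_summable[OF hs])
  have sd: "(\<lambda>k. e n * (r ^ k * a k) - r ^ k * (a k * e k)) sums (e n * Z - mix_stat \<theta> u r g)"
    unfolding Z_def mix_stat_def a_def[symmetric] ae[symmetric]
    by (intro sums_diff sums_mult summable_sums sm sg)
  have "\<bar>e n * (r ^ k * a k) - r ^ k * (a k * e k)\<bar> \<le> ?B k" for k
  proof -
    have "\<bar>e n * (r ^ k * a k) - r ^ k * (a k * e k)\<bar> = (r ^ k * a k) * \<bar>e n - e k\<bar>"
    proof -
      have "e n * (r ^ k * a k) - r ^ k * (a k * e k) = (r ^ k * a k) * (e n - e k)" by (simp add: algebra_simps)
      moreover have "\<bar>r ^ k * a k\<bar> = r ^ k * a k" using r apos[of k] by (simp add: abs_mult)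
      ultimately show ?thesis by (simp only: abs_mult[of "r ^ k * a k"])
    qed
    also have "\<dots> \<le> (r ^ k * a k) * (2 * \<beta> + \<theta> * \<beta> * (real k / real n + ?h k))"
      using diff[of k] r apos[of k] by (intro mult_left_mono) auto
    also have "\<dots> = ?B k" by (simp add: algebra_simps)
    finally show ?thesis .
  qed
  then have "\<bar>e n * Z - mix_stat \<theta> u r g\<bar> \<le> 2 * \<beta> * Z + \<theta> * \<beta> * ((\<Sum>k. r ^ k * (real k * a k)) / real n + (\<Sum>k. r ^ k * (a k * ?h k)))"
    using norm_suminf_le[OF _ sums_summable[OF sB], of "\<lambda>k. e n * (r ^ k * a k) - r ^ k * (a k * e k)"]
      sums_unique[OF sB] sums_unique[OF sd] by simp
  also have "\<dots> \<le> 2 * \<beta> * Z + \<theta> * \<beta> * (\<theta> * Z + exp 1 * Z / \<theta>)"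
    using hle mean th b0 by (intro add_mono order_refl mult_left_mono) auto
  also have "\<dots> = \<beta> * (2 + \<theta>\<^sup>2 + exp 1) * Z" using th by (simp add: field_simps power2_eq_square)
  finally have "\<bar>e n * Z - mix_stat \<theta> u r g\<bar> / Z \<le> \<beta> * (2 + \<theta>\<^sup>2 + exp 1)"
    using Zpos by (simp add: pos_divide_le_eq)
  also have "\<bar>e n * Z - mix_stat \<theta> u r g\<bar> / Z = \<bar>e n - mix_stat \<theta> u r g / Z\<bar>"
    proof -
      have "e n - mix_stat \<theta> u r g / Z = (e n * Z - mix_stat \<theta> u r g) / Z" using Zpos by (simp add: field_simps)
      then show ?thesis using Zpos by (simp only: abs_divide abs_of_pos)
    qed
  finally show ?thesis by (simp add: e_def a_def Z_def)
qed

section \<open>The Stein identity for the mixture\<close>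

lemma summable_log_moment:
  fixes u :: "nat \<Rightarrow> real"
  assumes r: "0 < r" "r < 1" and u: "\<And>m. m \<ge> 1 \<Longrightarrow> \<bar>u m\<bar> \<le> C * real m" and i: "1 \<le> i" "i \<le> 3"
  shows "summable (\<lambda>m. \<bar>u m ^ i / real m * r ^ m\<bar>)"
proof -
  have C: "C \<ge> 0" using u[of 1] by simp
  have cb: "\<bar>u m ^ i / real m\<bar> \<le> (1 + C) ^ 3 * (1 + real m)\<^sup>2" for m
  proof (cases "m = 0")
    case False
    then have m: "real m \<ge> 1" by simp
    have "\<bar>u m\<bar> ^ i \<le> (C * real m) ^ i" using u[of m] m by (intro power_mono) auto
    also have "\<dots> = C ^ i * real m ^ (i - 1) * real m" using i by (simp add: power_mult_distrib power_eq_if)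
    also have "\<dots> \<le> (1 + C) ^ 3 * (1 + real m)\<^sup>2 * real m"
    proof (intro mult_right_mono mult_mono)
      have "C ^ i \<le> (1 + C) ^ i" using C by (intro power_mono) auto
      also have "\<dots> \<le> (1 + C) ^ 3" using C i by (intro power_increasing) auto
      finally show "C ^ i \<le> (1 + C) ^ 3" .
      have "real m ^ (i - 1) \<le> (1 + real m) ^ (i - 1)" by (intro power_mono) auto
      also have "\<dots> \<le> (1 + real m)\<^sup>2" using i by (intro power_increasing) auto
      finally show "real m ^ (i - 1) \<le> (1 + real m)\<^sup>2" .
    qed (use C in auto)
    finally show ?thesis using m by (simp add: divide_le_eq power_abs)
  qed (use C in simp)
  \<comment> \<open>For \<theta> = 1 all weights are 1, so \<open>summable_ewens_weight\<close>
    covers the series of \<open>r ^ m * (1 + m)^2\<close>.\<close>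
  have w1: "ewens_weight 1 k = 1" for k by (simp add: ewens_weight_def pochhammer_fact[symmetric])
  show ?thesis
  proof (rule summable_comparison_test')
    show "summable (\<lambda>m. (1 + C) ^ 3 * (r ^ m * (ewens_weight 1 m * (1 + real m)\<^sup>2)))"
      by (intro summable_mult summable_ewens_weight r) simp
    fix m :: nat assume "m \<ge> 0"
    show "norm \<bar>u m ^ i / real m * r ^ m\<bar> \<le> (1 + C) ^ 3 * (r ^ m * (ewens_weight 1 m * (1 + real m)\<^sup>2))"
      using mult_right_mono[OF cb[of m], of "r ^ m"] r by (simp add: w1 abs_mult mult_ac)
  qed
qed

text \<open>
  The size bias identity produces \<open>h\<close> at \<open>x + u\<^sub>m\<close>; the moments \<open>m1\<close>, \<open>m2\<close>, \<open>m3\<close> are those of the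
  compound Poisson law, paired with the terms of a Taylor expansion of \<open>h\<close>.
\<close>

lemma mix_stat_stein:
  fixes \<theta> r C D M :: real and u :: "nat \<Rightarrow> real" and h h' :: "real \<Rightarrow> real"
  defines "m1 \<equiv> (\<Sum>m. \<theta> * u m / real m * r ^ m)" and "m2 \<equiv> (\<Sum>m. \<theta> * (u m)\<^sup>2 / real m * r ^ m)"
    and "m3 \<equiv> (\<Sum>m. \<theta> * \<bar>u m\<bar> ^ 3 / real m * r ^ m)"
  assumes th: "\<theta> > 0" and r: "0 < r" "r < 1" and u: "\<And>m. m \<ge> 1 \<Longrightarrow> \<bar>u m\<bar> \<le> C * real m"
    and taylor: "\<And>x y. \<bar>h (x + y) - h x - y * h' x\<bar> \<le> M / 2 * y\<^sup>2"
    and bd: "\<And>x. \<bar>x * h x\<bar> \<le> D * (1 + x\<^sup>2)" "\<And>x. \<bar>h x\<bar> \<le> D * (1 + x\<^sup>2)" "\<And>x. \<bar>h' x\<bar> \<le> D * (1 + x\<^sup>2)"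
  shows "\<bar>mix_stat \<theta> u r (\<lambda>x. x * h x) - m1 * mix_stat \<theta> u r h - m2 * mix_stat \<theta> u r h'\<bar> \<le> M / 2 * m3 * mix_total \<theta> r"
proof -
  let ?L = "lin_stat \<theta> u" and ?a = "ewens_weight \<theta>"
  define c where "c i m = \<theta> * u m ^ i / real m" for i m
  have sc: "summable (\<lambda>m. norm (c i m * r ^ m))" if "1 \<le> i" "i \<le> 3" for i
    using summable_mult[OF summable_log_moment[OF r u that], of \<theta>] th by (simp add: c_def abs_mult mult_ac)
  have s1: "summable (\<lambda>m. norm (c 1 m * r ^ m))" and s2: "summable (\<lambda>m. norm (c 2 m * r ^ m))" using sc by auto
  have s3: "summable (\<lambda>m. norm (M / 2 * \<bar>c 3 m\<bar> * r ^ m))"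
    using summable_mult[OF sc[of 3], of "\<bar>M\<bar> / 2"] r by (simp add: abs_mult mult_ac)
  have sL: "summable (\<lambda>k. norm (r ^ k * ?L k g))" if "\<And>x. \<bar>g x\<bar> \<le> D * (1 + x\<^sup>2)" for g
    using summable_mix_stat_abs[OF th r u that] by simp
  have sa: "summable (\<lambda>k. norm (r ^ k * ?a k))"
    using summable_mix_total(1)[OF th r] r ewens_weight_pos[OF th] by (simp add: abs_mult less_imp_le abs_of_pos)
  \<comment> \<open>Coefficients of Cauchy products of a moment series with the mixture, one each
    for the constant term, the linear term and the remainder of the expansion of
    \<open>h\<close>.\<close>
  let ?p = "\<lambda>k. \<Sum>i\<le>k. (c 1 i * r ^ i) * (r ^ (k - i) * ?L (k - i) h)"
  let ?q = "\<lambda>k. \<Sum>i\<le>k. (c 2 i * r ^ i) * (r ^ (k - i) * ?L (k - i) h')"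
  let ?w = "\<lambda>k. \<Sum>i\<le>k. (M / 2 * \<bar>c 3 i\<bar> * r ^ i) * (r ^ (k - i) * ?a (k - i))"
  have P: "?p sums (m1 * mix_stat \<theta> u r h)"
    using Cauchy_product_sums[OF s1 sL[OF bd(2)]] by (simp add: m1_def mix_stat_def c_def)
  have Q: "?q sums (m2 * mix_stat \<theta> u r h')"
    using Cauchy_product_sums[OF s2 sL[OF bd(3)]] by (simp add: m2_def mix_stat_def c_def)
  have "(\<Sum>m. M / 2 * \<bar>c 3 m\<bar> * r ^ m) = M / 2 * m3"
  proof -
    have "\<bar>c 3 m\<bar> = \<theta> * \<bar>u m\<bar> ^ 3 / real m" for m using th by (simp add: c_def abs_mult power_abs)
    moreover have "summable (\<lambda>m. \<bar>c 3 m\<bar> * r ^ m)" using sc[of 3] r by (simp add: abs_mult)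
    ultimately show ?thesis unfolding m3_def using suminf_mult[of "\<lambda>m. \<bar>c 3 m\<bar> * r ^ m" "M / 2"] by (simp add: mult.assoc)
  qed
  then have W: "?w sums (M / 2 * m3 * mix_total \<theta> r)"
    using Cauchy_product_sums[OF s3 sa] by (simp only:)
  have X: "(\<lambda>k. r ^ k * ?L k (\<lambda>x. x * h x)) sums mix_stat \<theta> u r (\<lambda>x. x * h x)"
    unfolding mix_stat_def using summable_rabs_cancel[OF sL[OF bd(1), unfolded real_norm_def]] by (rule summable_sums)
  have key: "\<bar>r ^ k * ?L k (\<lambda>x. x * h x) - ?p k - ?q k\<bar> \<le> ?w k" for k
  proof -
    have alg: "X * Y * (c * A) - c * X * (Y * B) - c * v * X * (Y * D) = X * Y * (c * (A - B - v * D))"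
      for X Y c A B v D :: real by (simp add: algebra_simps)
    have rk: "r ^ k = r ^ i * r ^ (k - i)" if "i \<le> k" for i using that by (simp flip: power_add)
    have "?L k (\<lambda>x. x * h x) = (\<Sum>i=1..k. c 1 i * ?L (k - i) (\<lambda>x. h (x + u i)))"
      unfolding lin_stat_size_bias by (simp add: c_def)
    \<comment> \<open>The new term \<open>i = 0\<close> is zero because division by zero gives
      0.\<close>
    also have "\<dots> = (\<Sum>i\<le>k. c 1 i * ?L (k - i) (\<lambda>x. h (x + u i)))"
      by (rule sum.mono_neutral_left) (auto simp: c_def not_le)
    finally have Lk: "r ^ k * ?L k (\<lambda>x. x * h x) = (\<Sum>i\<le>k. r ^ k * (c 1 i * ?L (k - i) (\<lambda>x. h (x + u i))))"
      by (simp add: sum_distrib_left)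
    have eq: "r ^ k * ?L k (\<lambda>x. x * h x) - ?p k - ?q k = (\<Sum>i\<le>k. r ^ k * (c 1 i * ?L (k - i) (\<lambda>x. h (x + u i) - h x - u i * h' x)))"
      unfolding Lk sum_subtractf[symmetric]
    proof (rule sum.cong[OF refl])
      fix i assume "i \<in> {..k}"
      then have rki: "r ^ k = r ^ i * r ^ (k - i)" by (intro rk) simp
      have c2: "c 2 i = c 1 i * u i" by (simp add: c_def power2_eq_square)
      have e: "?L (k - i) (\<lambda>x. h (x + u i) - h x - u i * h' x) = ?L (k - i) (\<lambda>x. h (x + u i)) - ?L (k - i) h - u i * ?L (k - i) h'"
        by (simp only: lin_stat_diff lin_stat_cmult)
      show "r ^ k * (c 1 i * ?L (k - i) (\<lambda>x. h (x + u i))) - c 1 i * r ^ i * (r ^ (k - i) * ?L (k - i) h) -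
         c 2 i * r ^ i * (r ^ (k - i) * ?L (k - i) h') = r ^ k * (c 1 i * ?L (k - i) (\<lambda>x. h (x + u i) - h x - u i * h' x))"
        unfolding e rki c2 by (rule alg)
    qed
    show ?thesis unfolding eq
    proof (intro order_trans[OF sum_abs] sum_mono)
      fix i assume "i \<in> {..k}"
      then have rki: "r ^ k = r ^ i * r ^ (k - i)" by (intro rk) simp
      have "\<bar>?L (k - i) (\<lambda>x. h (x + u i) - h x - u i * h' x)\<bar> \<le> ?L (k - i) (\<lambda>_. M / 2 * (u i)\<^sup>2)"
        by (rule lin_stat_abs_le[OF th taylor])
      then have "\<bar>c 1 i\<bar> * \<bar>?L (k - i) (\<lambda>x. h (x + u i) - h x - u i * h' x)\<bar> \<le> \<bar>c 1 i\<bar> * (M / 2 * (u i)\<^sup>2 * ?a (k - i))"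
        by (intro mult_left_mono) (simp_all add: lin_stat_const)
      also have "\<dots> = M / 2 * \<bar>c 3 i\<bar> * ?a (k - i)"
      proof -
        have "c 3 i = c 1 i * (u i)\<^sup>2" by (simp add: c_def power3_eq_cube power2_eq_square)
        then show ?thesis by (simp add: abs_mult)
      qed
      finally have "r ^ k * (\<bar>c 1 i\<bar> * \<bar>?L (k - i) (\<lambda>x. h (x + u i) - h x - u i * h' x)\<bar>) \<le>
          r ^ k * (M / 2 * \<bar>c 3 i\<bar> * ?a (k - i))"
        by (rule mult_left_mono) (use r in simp)
      also have "r ^ k * (M / 2 * \<bar>c 3 i\<bar> * ?a (k - i)) = M / 2 * \<bar>c 3 i\<bar> * r ^ i * (r ^ (k - i) * ?a (k - i))"
        unfolding rki by (simp only: mult_ac)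
      finally show "\<bar>r ^ k * (c 1 i * ?L (k - i) (\<lambda>x. h (x + u i) - h x - u i * h' x))\<bar>
          \<le> M / 2 * \<bar>c 3 i\<bar> * r ^ i * (r ^ (k - i) * ?a (k - i))"
        using r by (simp only: abs_mult abs_of_pos[OF zero_less_power])
    qed
  qed
  have "\<bar>mix_stat \<theta> u r (\<lambda>x. x * h x) - m1 * mix_stat \<theta> u r h - m2 * mix_stat \<theta> u r h'\<bar> =
    \<bar>\<Sum>k. r ^ k * ?L k (\<lambda>x. x * h x) - ?p k - ?q k\<bar>"
    by (simp only: sums_unique[OF sums_diff[OF sums_diff[OF X P] Q]])
  also have "\<dots> \<le> suminf ?w"
    using norm_suminf_le[of "\<lambda>k. r ^ k * ?L k (\<lambda>x. x * h x) - ?p k - ?q k" ?w, OF _ sums_summable[OF W]] key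
    by (simp only: real_norm_def)
  finally show ?thesis unfolding sums_unique[OF W, symmetric] .
qed

lemma mix_stat_const:
  assumes "\<theta> > 0" "0 < r" "r < 1"
  shows "mix_stat \<theta> u r (\<lambda>_. a) = a * mix_total \<theta> r"
  unfolding mix_stat_def lin_stat_const using suminf_mult[OF summable_mix_total(1)[OF assms], of a]
  by (simp add: mult.left_commute)

context
  fixes \<theta> r C :: real and u :: "nat \<Rightarrow> real"
  assumes th: "\<theta> > 0" and r: "0 < r" "r < 1" and u: "\<And>m. m \<ge> 1 \<Longrightarrow> \<bar>u m\<bar> \<le> C * real m"
begin

lemma mix_stat_add:
  assumes "\<And>x. \<bar>g x\<bar> \<le> D * (1 + x\<^sup>2)" "\<And>x. \<bar>h x\<bar> \<le> E * (1 + x\<^sup>2)"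
  shows "mix_stat \<theta> u r (\<lambda>x. g x + h x) = mix_stat \<theta> u r g + mix_stat \<theta> u r h"
proof -
  have "summable (\<lambda>k. r ^ k * lin_stat \<theta> u k g)" "summable (\<lambda>k. r ^ k * lin_stat \<theta> u k h)"
    using summable_mix_stat[OF th r u assms(1)] summable_mix_stat[OF th r u assms(2)] by simp_all
  then show ?thesis unfolding mix_stat_def lin_stat_add distrib_left by (rule suminf_add[symmetric])
qed

lemma mix_stat_cmult:
  assumes "\<And>x. \<bar>g x\<bar> \<le> D * (1 + x\<^sup>2)"
  shows "mix_stat \<theta> u r (\<lambda>x. a * g x) = a * mix_stat \<theta> u r g"
proof -
  have "summable (\<lambda>k. r ^ k * lin_stat \<theta> u k g)" using summable_mix_stat[OF th r u assms] by simp
  from suminf_mult[OF this, of a] show ?thesis unfolding mix_stat_def lin_stat_cmult by (simp add: mult.left_commute)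
qed

lemma mix_stat_abs_le:
  assumes "\<And>x. \<bar>g x\<bar> \<le> h x" "\<And>x. h x \<le> D * (1 + x\<^sup>2)"
  shows "\<bar>mix_stat \<theta> u r g\<bar> \<le> mix_stat \<theta> u r h"
proof -
  have h: "\<bar>h x\<bar> \<le> D * (1 + x\<^sup>2)" for x using assms[of x] by linarith
  have "norm (r ^ k * lin_stat \<theta> u k g) \<le> r ^ k * lin_stat \<theta> u k h" for k
    using lin_stat_abs_le[OF th assms(1), of u k] r by (simp add: abs_mult)
  moreover have "summable (\<lambda>k. r ^ k * lin_stat \<theta> u k h)" using summable_mix_stat[OF th r u h] by simp
  ultimately show ?thesis
    unfolding mix_stat_def using norm_suminf_le[of "\<lambda>k. r ^ k * lin_stat \<theta> u k g"] by simp
qed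

text \<open>For \<open>h = 1\<close> and \<open>h x = x\<close> there is no Taylor remainder, so
  \<open>mix_stat_stein\<close> with \<open>M = 0\<close> is an equation. It yields mean
  \<open>m1\<close> and variance \<open>m2\<close> for the mixture.\<close>

lemma mix_stat_second_moment:
  defines "m1 \<equiv> (\<Sum>m. \<theta> * u m / real m * r ^ m)" and "m2 \<equiv> (\<Sum>m. \<theta> * (u m)\<^sup>2 / real m * r ^ m)"
  shows "mix_stat \<theta> u r (\<lambda>x. (x - \<tau>)\<^sup>2) = ((m1 - \<tau>)\<^sup>2 + m2) * mix_total \<theta> r"
proof -
  let ?Z = "mix_total \<theta> r"
  have bd: "\<bar>x\<bar> \<le> 1 * (1 + x\<^sup>2)" for x :: real using zero_le_power2[of "\<bar>x\<bar> - 1"] by (simp add: power2_diff)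
  have c1: "mix_stat \<theta> u r (\<lambda>_. 1) = ?Z" using mix_stat_const[OF th r, of u 1] by simp
  have e1: "mix_stat \<theta> u r (\<lambda>x. x * 1) = m1 * ?Z"
    using mix_stat_stein[OF th r u, of "\<lambda>_. 1" "\<lambda>_. 0" 0 1] bd c1 mix_stat_const[OF th r, of u 0] by (simp add: m1_def)
  have e2: "mix_stat \<theta> u r (\<lambda>x. x * x) = m1 * mix_stat \<theta> u r (\<lambda>x. x) + m2 * ?Z"
    using mix_stat_stein[OF th r u, of "\<lambda>x. x" "\<lambda>_. 1" 0 1] bd c1 by (simp add: m1_def m2_def power2_eq_square)
  have "(\<lambda>x. (x - \<tau>)\<^sup>2) = (\<lambda>x. x * x + ((- 2 * \<tau>) * x + \<tau>\<^sup>2))"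
    by (auto simp: power2_eq_square algebra_simps)
  then have "mix_stat \<theta> u r (\<lambda>x. (x - \<tau>)\<^sup>2) = mix_stat \<theta> u r (\<lambda>x. x * x + ((- 2 * \<tau>) * x + \<tau>\<^sup>2))"
    by (simp only:)
  also have "\<dots> = mix_stat \<theta> u r (\<lambda>x. x * x) + mix_stat \<theta> u r (\<lambda>x. (- 2 * \<tau>) * x + \<tau>\<^sup>2)"
  proof (rule mix_stat_add[of _ 1 _ "\<bar>2 * \<tau>\<bar> + \<tau>\<^sup>2"])
    show "\<bar>(- 2 * \<tau>) * x + \<tau>\<^sup>2\<bar> \<le> (\<bar>2 * \<tau>\<bar> + \<tau>\<^sup>2) * (1 + x\<^sup>2)" for x
    proof -
      have "\<bar>(- 2 * \<tau>) * x + \<tau>\<^sup>2\<bar> \<le> \<bar>2 * \<tau>\<bar> * \<bar>x\<bar> + \<tau>\<^sup>2 * 1" using abs_triangle_ineq[of "(- 2 * \<tau>) * x" "\<tau>\<^sup>2"] by (simp add: abs_mult)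
      also have "\<dots> \<le> \<bar>2 * \<tau>\<bar> * (1 + x\<^sup>2) + \<tau>\<^sup>2 * (1 + x\<^sup>2)"
        using bd[of x] by (intro add_mono mult_left_mono) auto
      finally show ?thesis by (simp only: distrib_right)
    qed
  qed (simp add: power2_eq_square)
  also have "mix_stat \<theta> u r (\<lambda>x. (- 2 * \<tau>) * x + \<tau>\<^sup>2) = mix_stat \<theta> u r (\<lambda>x. (- 2 * \<tau>) * x) + mix_stat \<theta> u r (\<lambda>_. \<tau>\<^sup>2)"
  proof (rule mix_stat_add[of _ "\<bar>2 * \<tau>\<bar>" _ "\<tau>\<^sup>2"])
    show "\<bar>(- 2 * \<tau>) * x\<bar> \<le> \<bar>2 * \<tau>\<bar> * (1 + x\<^sup>2)" for x
      using mult_left_mono[OF bd[of x], of "\<bar>2 * \<tau>\<bar>"] by (simp add: abs_mult)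
    show "\<bar>\<tau>\<^sup>2\<bar> \<le> \<tau>\<^sup>2 * (1 + x\<^sup>2)" for x by (simp add: distrib_left)
  qed
  also have "mix_stat \<theta> u r (\<lambda>x. (- 2 * \<tau>) * x) = (- 2 * \<tau>) * mix_stat \<theta> u r (\<lambda>x. x)"
    by (rule mix_stat_cmult[OF bd])
  finally show ?thesis using e1 e2 mix_stat_const[OF th r, of u "\<tau>\<^sup>2"]
    by (simp add: power2_eq_square algebra_simps)
qed

end

section \<open>The equation of Stein\<close>

text \<open>The barrier \<open>\<alpha> + C / (1 + w)\<close> satisfies \<open>B' - w B \<le> - (\<alpha> w + c)\<close> for \<open>w \<ge> 0\<close> when \<open>C = 4 c / 3\<close>.\<close>

lemma ode_barrier_upper:
  fixes F H :: "real \<Rightarrow> real"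
  assumes F: "\<And>w. w \<ge> 0 \<Longrightarrow> (F has_real_derivative w * F w + H w) (at w)"
    and H: "\<And>w. w \<ge> 0 \<Longrightarrow> \<bar>H w\<bar> \<le> \<alpha> * w + c"
    and lim: "((\<lambda>w. exp (- w\<^sup>2 / 2) * F w) \<longlongrightarrow> 0) at_top" and c: "c \<ge> 0" and w: "w \<ge> 0"
  shows "F w \<le> \<alpha> + 4 * c / 3 / (1 + w)"
proof -
  define C where "C = 4 * c / 3"
  \<comment> \<open>The gap below the barrier, multiplied by the integrating factor of F' = w F + H.
    It is nonincreasing with limit 0, hence nonnegative.\<close>
  define K where "K w = exp (- w\<^sup>2 / 2) * (\<alpha> + C / (1 + w) - F w)" for w
  have der: "(K has_real_derivative exp (- w\<^sup>2 / 2) * (- w * (\<alpha> + C / (1 + w)) - C / (1 + w)\<^sup>2 - H w)) (at w)"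
    if w: "w \<ge> 0" for w
  proof -
    have e: "((\<lambda>w. exp (- w\<^sup>2 / 2)) has_real_derivative exp (- w\<^sup>2 / 2) * (- w)) (at w)"
      by (auto intro!: derivative_eq_intros)
    have b: "((\<lambda>w. C / (1 + w)) has_real_derivative - (C / (1 + w)\<^sup>2)) (at w)"
      using w by (auto intro!: derivative_eq_intros simp: power2_eq_square)
    show ?thesis unfolding K_def
      by (rule DERIV_cong[OF DERIV_mult[OF e DERIV_diff[OF DERIV_add[OF DERIV_const b] F[OF w]]]])
        (simp add: algebra_simps)
  qed
  have neg: "exp (- w\<^sup>2 / 2) * (- w * (\<alpha> + C / (1 + w)) - C / (1 + w)\<^sup>2 - H w) \<le> 0" if w: "w \<ge> 0" for w
  proof -
    have "c \<le> C * ((w * (1 + w) + 1) / (1 + w)\<^sup>2)"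
    proof -
      \<comment> \<open>Here the factor 4 / 3 is decided: the difference of the two sides is (w -
        1)^2.\<close>
      have "3 * (1 + w)\<^sup>2 \<le> 4 * (w * (1 + w) + 1)" using zero_le_power2[of "w - 1"] by (simp add: power2_eq_square algebra_simps)
      then have "3 / 4 \<le> (w * (1 + w) + 1) / (1 + w)\<^sup>2" using w by (simp add: field_simps)
      from mult_left_mono[OF this, of C] show ?thesis using c by (simp add: C_def)
    qed
    also have "\<dots> = w * (C / (1 + w)) + C / (1 + w)\<^sup>2" using w by (simp add: divide_simps power2_eq_square) (simp add: algebra_simps)
    finally have "- w * (\<alpha> + C / (1 + w)) - C / (1 + w)\<^sup>2 - H w \<le> 0" using H[OF w] by (simp add: algebra_simps)
    then show ?thesis by (intro mult_nonneg_nonpos) auto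
  qed
  have mono: "K y \<le> K w" if "w \<le> y" for y
    using that
  proof (rule DERIV_nonpos_imp_nonincreasing)
    fix x assume "w \<le> x" "x \<le> y"
    then show "\<exists>z. (K has_real_derivative z) (at x) \<and> z \<le> 0" using der[of x] neg[of x] w by force
  qed
  have "((\<lambda>w. exp (- w\<^sup>2 / 2) * (\<alpha> + C / (1 + w)) - exp (- w\<^sup>2 / 2) * F w) \<longlongrightarrow> 0 - 0) at_top"
    by (intro tendsto_diff lim) real_asymp
  then have "(K \<longlongrightarrow> 0) at_top" by (simp add: K_def[abs_def] right_diff_distrib)
  moreover have "eventually (\<lambda>y. K y \<le> K w) at_top" using eventually_ge_at_top[of w] by eventually_elim (rule mono)
  ultimately have "0 \<le> K w" by (intro tendsto_upperbound[of K 0 at_top]) auto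
  then show ?thesis by (simp add: K_def C_def zero_le_mult_iff)
qed

lemma ode_barrier:
  fixes F H :: "real \<Rightarrow> real"
  assumes F: "\<And>w. (F has_real_derivative w * F w + H w) (at w)"
    and H: "\<And>w. \<bar>H w\<bar> \<le> \<alpha> * \<bar>w\<bar> + c"
    and lim: "((\<lambda>w. exp (- w\<^sup>2 / 2) * F w) \<longlongrightarrow> 0) at_top" "((\<lambda>w. exp (- w\<^sup>2 / 2) * F w) \<longlongrightarrow> 0) at_bot"
    and c: "c \<ge> 0"
  shows "\<bar>F w\<bar> \<le> \<alpha> + 4 * c / 3 / (1 + \<bar>w\<bar>)"
proof -
  have main: "\<bar>F w\<bar> \<le> \<alpha> + 4 * c / 3 / (1 + w)"
    if F: "\<And>w. (F has_real_derivative w * F w + H w) (at w)" and H: "\<And>w. \<bar>H w\<bar> \<le> \<alpha> * \<bar>w\<bar> + c"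
      and lim: "((\<lambda>w. exp (- w\<^sup>2 / 2) * F w) \<longlongrightarrow> 0) at_top" and w: "w \<ge> 0" for F H :: "real \<Rightarrow> real" and w
  proof -
    have "F w \<le> \<alpha> + 4 * c / 3 / (1 + w)"
      by (rule ode_barrier_upper[of F H]) (use F H[of w] H lim c w in \<open>auto, metis abs_of_nonneg\<close>)
    moreover have "- F w \<le> \<alpha> + 4 * c / 3 / (1 + w)"
    proof (rule ode_barrier_upper[of "\<lambda>w. - F w" "\<lambda>w. - H w"])
      show "((\<lambda>w. - F w) has_real_derivative w * - F w + - H w) (at w)" for w
        using DERIV_minus[OF F[of w]] by simp
      show "\<bar>- H w\<bar> \<le> \<alpha> * w + c" if "w \<ge> 0" for w using H[of w] that by simp
      show "((\<lambda>w. exp (- w\<^sup>2 / 2) * - F w) \<longlongrightarrow> 0) at_top" using tendsto_minus[OF lim] by simp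
    qed (use c w in auto)
    ultimately show ?thesis by linarith
  qed
  show ?thesis
  proof (cases "w \<ge> 0")
    case True
    then show ?thesis using main[of F H w] F H lim by simp
  next
    case False
    \<comment> \<open>F(-w) solves the equation with right hand side -H(-w), which reduces negative
      arguments to positive ones.\<close>
    have "((\<lambda>w. F (- w)) has_real_derivative w * F (- w) + - H (- w)) (at w)" for w
      by (rule DERIV_cong[OF DERIV_chain2[where f=F and g=uminus and x=w, OF F[of "- w"] DERIV_minus[OF DERIV_ident]]])
        (simp add: algebra_simps)
    moreover have "\<bar>- H (- w)\<bar> \<le> \<alpha> * \<bar>w\<bar> + c" for w using H[of "- w"] by simp
    moreover have "((\<lambda>w. exp (- w\<^sup>2 / 2) * F (- w)) \<longlongrightarrow> 0) at_top"
      using lim(2) unfolding filterlim_at_bot_mirror by simp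
    ultimately show ?thesis using main[of "\<lambda>w. F (- w)" "\<lambda>w. - H (- w)" "- w"] False by simp
  qed
qed

text \<open>For a standard normal Z the difference is at most |x| + E|Z|. The bound E|Z| \<le> 1
  comes from |y| \<le> (1 + y^2) / 2 and E Z^2 = 1, without computing E|Z|.\<close>

lemma std_normal_expectation_lipschitz:
  fixes g :: "real \<Rightarrow> real"
  assumes g: "\<And>x y. \<bar>g x - g y\<bar> \<le> \<bar>x - y\<bar>"
  shows "integrable lborel (\<lambda>x. std_normal_density x * g x)"
    "\<bar>g x - (\<integral>x. std_normal_density x * g x \<partial>lborel)\<bar> \<le> \<bar>x\<bar> + 1"
proof -
  let ?\<rho> = std_normal_density
  have i0: "integrable lborel ?\<rho>" by simp
  have i1: "integrable lborel (\<lambda>x. ?\<rho> x * \<bar>x\<bar>)" using integrable_std_normal_moment_abs[of 1] by simp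
  have i2: "integrable lborel (\<lambda>x. ?\<rho> x * x\<^sup>2)" by (rule integrable_std_normal_moment)
  have cont: "continuous_on UNIV g"
  proof (rule lipschitz_on_continuous_on[of 1])
    show "1-lipschitz_on UNIV g" using g by (auto simp: lipschitz_on_def dist_real_def)
  qed
  have meas: "g \<in> borel_measurable borel" using cont by (rule borel_measurable_continuous_onI)
  have ig: "integrable lborel (\<lambda>x. ?\<rho> x * g x)"
  proof (rule Bochner_Integration.integrable_bound[OF Bochner_Integration.integrable_add[OF i1 integrable_mult_left[OF i0]]])
    show "(\<lambda>x. ?\<rho> x * g x) \<in> borel_measurable lborel" using meas by simp
    show "AE x in lborel. norm (?\<rho> x * g x) \<le> norm (?\<rho> x * \<bar>x\<bar> + ?\<rho> x * \<bar>g 0\<bar>)"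
    proof (rule AE_I2)
      fix x
      have "\<bar>g x\<bar> \<le> \<bar>x\<bar> + \<bar>g 0\<bar>" using g[of x 0] by simp
      from mult_left_mono[OF this, of "?\<rho> x"] show "norm (?\<rho> x * g x) \<le> norm (?\<rho> x * \<bar>x\<bar> + ?\<rho> x * \<bar>g 0\<bar>)"
        by (simp add: abs_mult distrib_left)
    qed
  qed
  then show "integrable lborel (\<lambda>x. ?\<rho> x * g x)" .
  have "\<bar>\<integral>y. ?\<rho> y * (g x - g y) \<partial>lborel\<bar> \<le> (\<integral>y. ?\<rho> y * (\<bar>x\<bar> + 1 / 2) + 1 / 2 * (?\<rho> y * y\<^sup>2) \<partial>lborel)"
  proof (rule integral_abs_bound_integral)
    show "integrable lborel (\<lambda>y. ?\<rho> y * (g x - g y))"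
      using Bochner_Integration.integrable_diff[OF integrable_mult_left[OF i0, of "g x"] ig] by (simp add: right_diff_distrib)
    show "integrable lborel (\<lambda>y. ?\<rho> y * (\<bar>x\<bar> + 1 / 2) + 1 / 2 * (?\<rho> y * y\<^sup>2))"
      by (intro Bochner_Integration.integrable_add integrable_mult_left integrable_mult_right i0 i2)
    fix y :: real
    have "\<bar>g x - g y\<bar> \<le> \<bar>x\<bar> + \<bar>y\<bar>" using g[of x y] by linarith
    also have "\<bar>y\<bar> \<le> 1 / 2 + 1 / 2 * y\<^sup>2" using zero_le_power2[of "\<bar>y\<bar> - 1"] by (simp add: power2_diff)
    finally have "\<bar>g x - g y\<bar> \<le> (\<bar>x\<bar> + 1 / 2) + 1 / 2 * y\<^sup>2" by simp
    from mult_left_mono[OF this, of "?\<rho> y"]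
    show "\<bar>?\<rho> y * (g x - g y)\<bar> \<le> ?\<rho> y * (\<bar>x\<bar> + 1 / 2) + 1 / 2 * (?\<rho> y * y\<^sup>2)"
      by (simp add: abs_mult distrib_left)
  qed
  also have "\<dots> = (\<bar>x\<bar> + 1 / 2) + 1 / 2 * 1"
  proof (subst Bochner_Integration.integral_add)
    show "(\<integral>y. ?\<rho> y * (\<bar>x\<bar> + 1 / 2) \<partial>lborel) + (\<integral>y. 1 / 2 * (?\<rho> y * y\<^sup>2) \<partial>lborel) = (\<bar>x\<bar> + 1 / 2) + 1 / 2 * 1"
      using integral_std_normal_moment_even[of 1] by (simp add: fact_numeral)
  qed (intro integrable_mult_left integrable_mult_right i0 i2)+
  also have "(\<integral>y. ?\<rho> y * (g x - g y) \<partial>lborel) = g x - (\<integral>x. ?\<rho> x * g x \<partial>lborel)"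
    using Bochner_Integration.integral_diff[OF integrable_mult_left[OF i0, of "g x"] ig] by (simp add: right_diff_distrib)
  finally show "\<bar>g x - (\<integral>x. ?\<rho> x * g x \<partial>lborel)\<bar> \<le> \<bar>x\<bar> + 1" by simp
qed

text \<open>Up to the factor sqrt(2 pi) exp(w^2 / 2), \<open>G\<close> becomes the solution of
  Stein's equation. Its limits are the boundary conditions that \<open>ode_barrier\<close> asks for;
  the one at the top is where the mean zero enters.\<close>

lemma tail_integral_properties:
  fixes q :: "real \<Rightarrow> real"
  assumes cont: "continuous_on UNIV q" and int: "integrable lborel q" and zero: "(\<integral>x. q x \<partial>lborel) = 0"
  defines "G \<equiv> (\<lambda>w. LINT x:{..w}|lborel. q x)"
  shows "(G has_real_derivative q w) (at w)" "(G \<longlongrightarrow> 0) at_top" "(G \<longlongrightarrow> 0) at_bot"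
proof -
  have si: "set_integrable lborel A q" if "A \<in> sets borel" for A
    using int that unfolding set_integrable_def by (intro integrable_mult_indicator) auto
  have step: "G b = G a + (LINT x:{a..b}|lborel. q x)" if "a \<le> b" for a b
  proof -
    have "G b = (LINT x:{..a} \<union> {a<..b}|lborel. q x)" using that by (simp add: G_def ivl_disj_un)
    also have "\<dots> = G a + (LINT x:{a<..b}|lborel. q x)" unfolding G_def by (intro set_integral_Un si) auto
    also have "(LINT x:{a<..b}|lborel. q x) = (LINT x:{a..b}|lborel. q x)"
      using interval_integral_Icc[OF that, of q] interval_integral_Ioc[OF that, of q] by simp
    finally show ?thesis .
  qed
  have stepI: "G b = G a + integral {a..b} q" if "a \<le> b" for a b
    using step[OF that] set_borel_integral_eq_integral(2)[OF si[of "{a..b}"]] by simp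
  have "((\<lambda>x. G (w - 1) + integral {w - 1..x} q) has_real_derivative 0 + q w) (at w within {w - 1..w + 1})"
    by (intro DERIV_add DERIV_const integral_has_real_derivative continuous_on_subset[OF cont]) auto
  then have "((\<lambda>x. G (w - 1) + integral {w - 1..x} q) has_real_derivative q w) (at w)"
    using at_within_interior[of w "{w - 1..w + 1}"] by simp
  then show "(G has_real_derivative q w) (at w)"
  proof (rule has_field_derivative_transform_within_open[where S="{w - 1<..<w + 1}"])
    fix x assume "x \<in> {w - 1<..<w + 1}"
    then show "G (w - 1) + integral {w - 1..x} q = G x" using stepI[of "w - 1" x] by simp
  qed auto
  show "(G \<longlongrightarrow> 0) at_top"
    using tendsto_integral_at_top[OF _ int] zero unfolding G_def set_lebesgue_integral_def by simp
  have "((\<lambda>a. G 0 - (LINT x:{a..0}|lborel. q x)) \<longlongrightarrow> G 0 - G 0) at_bot"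
    by (intro tendsto_diff tendsto_const) (unfold G_def, intro tendsto_set_lebesgue_integral_at_bot si, auto)
  then have "((\<lambda>a. G 0 - (LINT x:{a..0}|lborel. q x)) \<longlongrightarrow> 0) at_bot" by simp
  moreover have "eventually (\<lambda>a. G 0 - (LINT x:{a..0}|lborel. q x) = G a) at_bot"
    using eventually_le_at_bot[of "0::real"] by eventually_elim (use step[of _ 0] in auto)
  ultimately show "(G \<longlongrightarrow> 0) at_bot" by (rule Lim_transform_eventually)
qed

text \<open>
  The derivative \<open>F = f'\<close> of the Stein solution solves \<open>F' - w F = f + g'\<close>, an equation of the same
  type with bounded right hand side, so the barrier estimate applies twice.
\<close>

lemma stein_solution:
  fixes g g' :: "real \<Rightarrow> real"
  assumes g: "\<And>x. (g has_real_derivative g' x) (at x)" and g1: "\<And>x. \<bar>g' x\<bar> \<le> 1"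
  defines "c \<equiv> (\<integral>x. std_normal_density x * g x \<partial>lborel)"
  obtains f f' where "\<And>x. f' x - x * f x = g x - c" "\<And>x. \<bar>f x\<bar> \<le> 8" "\<And>x. \<bar>f' x\<bar> \<le> 8"
    "\<And>x y. \<bar>f (x + y) - f x - y * f' x\<bar> \<le> 8 * y\<^sup>2"
proof -
  let ?\<rho> = std_normal_density
  let ?e = "\<lambda>w::real. exp (- w\<^sup>2 / 2)"
  have lip: "\<bar>g x - g y\<bar> \<le> \<bar>x - y\<bar>" for x y
    using field_differentiable_bound[of UNIV g g' 1 x y] g g1 by auto
  note I = std_normal_expectation_lipschitz[OF lip, folded c_def]
  define q where "q x = ?\<rho> x * (g x - c)" for x
  have gc: "continuous_on UNIV g" using g by (meson DERIV_continuous_on has_field_derivative_at_within)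
  have qc: "continuous_on UNIV q" unfolding q_def std_normal_density_def by (intro continuous_intros gc) auto
  have qi: "integrable lborel q"
    unfolding q_def right_diff_distrib by (intro Bochner_Integration.integrable_diff I integrable_mult_left) simp
  have q0: "(\<integral>x. q x \<partial>lborel) = 0"
    unfolding q_def right_diff_distrib
    by (subst Bochner_Integration.integral_diff) (auto intro: I integrable_mult_left simp: c_def)
  define G where "G w = (LINT x:{..w}|lborel. q x)" for w
  note GP = tail_integral_properties[OF qc qi q0, folded G_def]
  define f where "f w = sqrt (2 * pi) * (exp (w\<^sup>2 / 2) * G w)" for w
  define f' where "f' w = w * f w + (g w - c)" for w
  have ee: "exp (w\<^sup>2 / 2) * ?e w = 1" for w :: real by (simp flip: exp_add)
  have fd: "(f has_real_derivative f' w) (at w)" for w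
  proof -
    have "((\<lambda>w::real. exp (w\<^sup>2 / 2)) has_real_derivative exp (w\<^sup>2 / 2) * w) (at w)"
      by (auto intro!: derivative_eq_intros)
    from DERIV_cmult[OF DERIV_mult[OF this GP(1)], of "sqrt (2 * pi)"]
    have "(f has_real_derivative sqrt (2 * pi) * (exp (w\<^sup>2 / 2) * w * G w + exp (w\<^sup>2 / 2) * q w)) (at w)"
      unfolding f_def by (simp add: mult.commute)
    also have "sqrt (2 * pi) * (exp (w\<^sup>2 / 2) * w * G w + exp (w\<^sup>2 / 2) * q w) =
        w * f w + (exp (w\<^sup>2 / 2) * ?e w) * (sqrt (2 * pi) / sqrt (2 * pi)) * (g w - c)"
    proof -
      have "s * (E * w * G + E * (1 / s * e * d)) = w * (s * (E * G)) + E * e * (s / s) * d" for s E G e d :: real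
        by (simp add: algebra_simps)
      then show ?thesis unfolding f_def q_def std_normal_density_def .
    qed
    also have "\<dots> = f' w" unfolding ee by (simp add: f'_def)
    finally show ?thesis .
  qed
  have ef: "?e w * f w = sqrt (2 * pi) * G w" for w
    using ee[of w] by (simp add: f_def mult_ac)
  have "\<bar>f w\<bar> \<le> 1 + 4 * 1 / 3 / (1 + \<bar>w\<bar>)" for w
  proof (rule ode_barrier[of f "\<lambda>w. g w - c"])
    show "(f has_real_derivative w * f w + (g w - c)) (at w)" for w using fd[of w] by (simp add: f'_def)
    show "\<bar>g w - c\<bar> \<le> 1 * \<bar>w\<bar> + 1" for w using I(2)[of w] by simp
    show "((\<lambda>w. ?e w * f w) \<longlongrightarrow> 0) at_top" unfolding ef using tendsto_mult_left[OF GP(2), of "sqrt (2 * pi)"] by simp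
    show "((\<lambda>w. ?e w * f w) \<longlongrightarrow> 0) at_bot" unfolding ef using tendsto_mult_left[OF GP(3), of "sqrt (2 * pi)"] by simp
  qed simp
  moreover have "1 + 4 * 1 / 3 / (1 + \<bar>w\<bar>) \<le> 7 / 3" for w :: real by (simp add: divide_simps)
  ultimately have fb: "\<bar>f w\<bar> \<le> 7 / 3" for w by (meson order_trans)
  define H where "H w = f w + g' w" for w
  have f'd: "(f' has_real_derivative w * f' w + H w) (at w)" for w
    using DERIV_cong[OF DERIV_add[OF DERIV_mult[OF DERIV_ident fd] DERIV_diff[OF g DERIV_const]], of w "w * f' w + H w"]
    unfolding f'_def[abs_def] H_def by simp
  have Hb: "\<bar>H w\<bar> \<le> 10 / 3" for w using fb[of w] g1[of w] unfolding H_def by linarith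
  \<comment> \<open>A crude bound with linear growth of f' is enough for the boundary conditions of
    the second barrier argument.\<close>
  have f'lin: "\<bar>?e w * f' w\<bar> \<le> ?e w * (5 + 4 * w\<^sup>2)" for w
  proof -
    have "\<bar>w * f w\<bar> \<le> \<bar>w\<bar> * (7 / 3)" unfolding abs_mult using fb[of w] by (intro mult_left_mono) auto
    then have "\<bar>f' w\<bar> \<le> 4 * \<bar>w\<bar> + 1" using I(2)[of w] unfolding f'_def by linarith
    also have "\<dots> \<le> 5 + 4 * w\<^sup>2" using zero_le_power2[of "\<bar>w\<bar> - 1"] by (simp add: power2_diff)
    finally show ?thesis by (simp add: abs_mult)
  qed
  have f'b: "\<bar>f' w\<bar> \<le> 0 + 4 * (10 / 3) / 3 / (1 + \<bar>w\<bar>)" for w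
  proof (rule ode_barrier[OF f'd])
    show "\<bar>H w\<bar> \<le> 0 * \<bar>w\<bar> + 10 / 3" for w using Hb[of w] by simp
    have "((\<lambda>w. ?e w * (5 + 4 * w\<^sup>2)) \<longlongrightarrow> 0) at_top" by real_asymp
    then show "((\<lambda>w. ?e w * f' w) \<longlongrightarrow> 0) at_top"
      by (rule Lim_null_comparison[rotated]) (use f'lin in simp)
    have "((\<lambda>w. ?e w * (5 + 4 * w\<^sup>2)) \<longlongrightarrow> 0) at_bot" by real_asymp
    then show "((\<lambda>w. ?e w * f' w) \<longlongrightarrow> 0) at_bot"
      by (rule Lim_null_comparison[rotated]) (use f'lin in simp)
  qed simp
  \<comment> \<open>With \<alpha> = 0 the barrier decays like 1 / (1 + |w|), so it bounds w f' as
    well as f'.\<close>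
  have f'8: "\<bar>f' w\<bar> \<le> 40 / 9" "\<bar>w * f' w\<bar> \<le> 40 / 9" for w
  proof -
    have p: "1 + \<bar>w\<bar> > 0" by simp
    have *: "(1 + \<bar>w\<bar>) * \<bar>f' w\<bar> \<le> 40 / 9" 
    proof -
      have "0 + 4 * (10 / 3) / 3 / (1 + \<bar>w\<bar>) = (40 / 9) / (1 + \<bar>w\<bar>)" by simp
      then have "\<bar>f' w\<bar> \<le> (40 / 9) / (1 + \<bar>w\<bar>)" using f'b[of w] by (simp only:)
      then show ?thesis unfolding pos_le_divide_eq[OF p] by (simp only: mult.commute)
    qed
    have "\<bar>f' w\<bar> + \<bar>w\<bar> * \<bar>f' w\<bar> \<le> 40 / 9" using * by (simp add: distrib_right)
    moreover have "0 \<le> \<bar>w\<bar> * \<bar>f' w\<bar>" by simp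
    ultimately show "\<bar>f' w\<bar> \<le> 40 / 9" "\<bar>w * f' w\<bar> \<le> 40 / 9" unfolding abs_mult by linarith+
  qed
  \<comment> \<open>This is the second derivative of f; 40 / 9 + 10 / 3 = 70 / 9 is below 8.\<close>
  have "\<bar>w * f' w + H w\<bar> \<le> 8" for w using f'8(2)[of w] Hb[of w] by linarith
  then have f'lip: "\<bar>f' x - f' y\<bar> \<le> 8 * \<bar>x - y\<bar>" for x y
    using field_differentiable_bound[of UNIV f' "\<lambda>w. w * f' w + H w" 8 x y] f'd by auto
  have taylor: "\<bar>f (x + y) - f x - y * f' x\<bar> \<le> 8 * y\<^sup>2" for x y
  proof -
    have "\<bar>(f (x + y) - (x + y) * f' x) - (f x - x * f' x)\<bar> \<le> (8 * \<bar>y\<bar>) * \<bar>(x + y) - x\<bar>"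
    proof (rule field_differentiable_bound[of "closed_segment x (x + y)" _ "\<lambda>z. f' z - f' x", unfolded real_norm_def])
      fix z assume z: "z \<in> closed_segment x (x + y)"
      show "((\<lambda>z. f z - z * f' x) has_real_derivative f' z - f' x) (at z within closed_segment x (x + y))"
        using DERIV_diff[OF has_field_derivative_at_within[OF fd] DERIV_cmult_right[OF DERIV_ident]] by simp
      have "\<bar>z - x\<bar> \<le> \<bar>y\<bar>" using z by (auto simp: closed_segment_eq_real_ivl split: if_splits)
      from mult_left_mono[OF this, of 8] show "\<bar>f' z - f' x\<bar> \<le> 8 * \<bar>y\<bar>"
        using order_trans[OF f'lip[of z x]] by simp
    qed auto
    moreover have "(f (x + y) - (x + y) * f' x) - (f x - x * f' x) = f (x + y) - f x - y * f' x"
      by (simp add: algebra_simps)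
    moreover have "(8 * \<bar>y\<bar>) * \<bar>(x + y) - x\<bar> = 8 * y\<^sup>2" by (simp add: power2_eq_square)
    ultimately show ?thesis by (simp only:)
  qed
  show ?thesis
  proof (rule that[of f' f])
    show "f' x - x * f x = g x - c" for x by (simp add: f'_def)
    show "\<bar>f x\<bar> \<le> 8" "\<bar>f' x\<bar> \<le> 8" for x using fb[of x] f'8(1)[of x] by linarith+
  qed (rule taylor)
qed

section \<open>The central limit theorem for linear statistics\<close>

lemma sum_by_parts_lessThan:
  fixes x w :: "nat \<Rightarrow> real"
  shows "(\<Sum>i<N. x i * w i) = (\<Sum>i<N. (\<Sum>j<Suc i. x j) * (w i - w (Suc i))) + (\<Sum>j<N. x j) * w N"
  by (induction N) (simp_all add: algebra_simps)

text \<open>The domination is between partial sums and not term by term, so cancellation in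
  \<open>x\<close> is kept; summation by parts carries it over to nonincreasing nonnegative
  weights.\<close>

lemma abel_domination:
  fixes x y w :: "nat \<Rightarrow> real"
  assumes xy: "\<And>N. \<bar>\<Sum>i<N. x i\<bar> \<le> (\<Sum>i<N. y i)" and dec: "\<And>i. w (Suc i) \<le> w i" and pos: "\<And>i. 0 \<le> w i"
  shows "\<bar>\<Sum>i<N. x i * w i\<bar> \<le> (\<Sum>i<N. y i * w i)"
proof -
  have Y: "0 \<le> (\<Sum>i<N. y i)" for N using xy[of N] by linarith
  have "\<bar>\<Sum>i<N. x i * w i\<bar> \<le> (\<Sum>i<N. \<bar>(\<Sum>j<Suc i. x j) * (w i - w (Suc i))\<bar>) + \<bar>(\<Sum>j<N. x j) * w N\<bar>"
    unfolding sum_by_parts_lessThan[of x] by (intro order_trans[OF abs_triangle_ineq] add_mono sum_abs order_refl)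
  also have "\<dots> \<le> (\<Sum>i<N. (\<Sum>j<Suc i. y j) * (w i - w (Suc i))) + (\<Sum>j<N. y j) * w N"
    unfolding abs_mult using dec pos by (intro add_mono sum_mono mult_mono xy Y) auto
  also have "\<dots> = (\<Sum>i<N. y i * w i)" by (rule sum_by_parts_lessThan[symmetric])
  finally show ?thesis .
qed

lemma log_series_domination:
  fixes x y :: "nat \<Rightarrow> real"
  assumes r: "0 < r" "r < 1" and xy: "\<And>N. \<bar>\<Sum>m=1..N. x m\<bar> \<le> (\<Sum>m=1..N. y m)"
    and sx: "summable (\<lambda>m. x m / real m * r ^ m)" and sy: "summable (\<lambda>m. y m / real m * r ^ m)"
  shows "\<bar>\<Sum>m. x m / real m * r ^ m\<bar> \<le> (\<Sum>m. y m / real m * r ^ m)"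
proof -
  let ?w = "\<lambda>i. r ^ Suc i / real (Suc i)"
  have shift: "(\<Sum>m=1..N. z m) = (\<Sum>i<N. z (Suc i))" for N and z :: "nat \<Rightarrow> real"
    using sum.shift_bounds_Suc_ivl[of z 0 N] by (simp add: atLeastLessThanSuc_atLeastAtMost lessThan_atLeast0)
  have "\<bar>\<Sum>i<N. x (Suc i) * ?w i\<bar> \<le> (\<Sum>i<N. y (Suc i) * ?w i)" for N
  proof (rule abel_domination)
    show "\<bar>\<Sum>i<N. x (Suc i)\<bar> \<le> (\<Sum>i<N. y (Suc i))" for N using xy[of N] unfolding shift .
    show "?w (Suc i) \<le> ?w i" for i using r by (intro frac_le) (auto intro!: mult_left_le_one_le)
    show "0 \<le> ?w i" for i using r by simp
  qed
  moreover have "(\<Sum>i<N. z (Suc i) * ?w i) = (\<Sum>m<Suc N. z m / real m * r ^ m)" for N and z :: "nat \<Rightarrow> real"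
    by (subst sum.lessThan_Suc_shift) simp
  ultimately have le: "\<bar>\<Sum>m<Suc N. x m / real m * r ^ m\<bar> \<le> (\<Sum>m<Suc N. y m / real m * r ^ m)" for N
    by simp
  have "(\<lambda>N. \<bar>\<Sum>m<Suc N. x m / real m * r ^ m\<bar>) \<longlonglongrightarrow> \<bar>\<Sum>m. x m / real m * r ^ m\<bar>"
    using LIMSEQ_Suc[OF summable_LIMSEQ[OF sx]] by (rule tendsto_rabs)
  moreover have "(\<lambda>N. \<Sum>m<Suc N. y m / real m * r ^ m) \<longlonglongrightarrow> (\<Sum>m. y m / real m * r ^ m)"
    using LIMSEQ_Suc[OF summable_LIMSEQ[OF sy]] .
  ultimately show ?thesis by (rule LIMSEQ_le) (use le in auto)
qed

lemma log_series:
  assumes "n \<ge> 2"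
  shows "(\<lambda>m. 1 / real m * (1 - 1 / real n) ^ m) sums ln (real n)"
proof -
  let ?r = "1 - 1 / real n"
  have r: "0 < ?r" "?r < 1" using assms by auto
  have "summable (\<lambda>m. 1 / real m * ?r ^ m)"
  proof (rule summable_comparison_test'[of "\<lambda>m. ?r ^ m" 0])
    show "summable (\<lambda>m. ?r ^ m)" using r by (intro summable_geometric) auto
    show "norm (1 / real m * ?r ^ m) \<le> ?r ^ m" for m
    proof -
      have "1 / real m \<le> 1" by (cases "m = 0") auto
      from mult_right_mono[OF this, of "?r ^ m"] show ?thesis using r by (simp add: abs_mult)
    qed
  qed
  then have s: "(\<lambda>m. 1 / real m * ?r ^ m) sums (\<Sum>m. 1 / real m * ?r ^ m)" by (rule summable_sums)
  have "ln (1 / real n) = (\<Sum>k. (-1) ^ k * (1 / real (k + 1)) * (1 / real n - 1) ^ Suc k)"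
    using assms by (intro ln_series) (auto simp: divide_less_eq)
  also have "\<dots> = (\<Sum>k. - (1 / real (Suc k) * ?r ^ Suc k))"
  proof (rule suminf_cong)
    fix k
    have "(1 / real n - 1) ^ Suc k = (- 1) ^ Suc k * ?r ^ Suc k" by (simp only: power_mult_distrib[symmetric]) simp
    moreover have "(-1) ^ k * a * ((-1) ^ Suc k * b) = - (a * b)" for a b :: real
      by (simp flip: power_mult_distrib)
    ultimately show "(-1) ^ k * (1 / real (k + 1)) * (1 / real n - 1) ^ Suc k = - (1 / real (Suc k) * ?r ^ Suc k)"
      by (simp only: Suc_eq_plus1[symmetric])
  qed
  also have "\<dots> = - (\<Sum>k. 1 / real (Suc k) * ?r ^ Suc k)"
    using summable_Suc_iff[of "\<lambda>m. 1 / real m * ?r ^ m"] sums_summable[OF s] by (intro suminf_minus) (simp only:)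
  also have "(\<Sum>k. 1 / real (Suc k) * ?r ^ Suc k) = (\<Sum>m. 1 / real m * ?r ^ m)"
    using suminf_split_head[OF sums_summable[OF s]] by simp
  finally have "ln (real n) = (\<Sum>m. 1 / real m * ?r ^ m)" using assms by (simp add: ln_div)
  then show ?thesis using s by (simp only:)
qed

text \<open>It replaces a power of N by the partial sums of a nonnegative sequence, the form
  required by \<open>log_series_domination\<close>.\<close>

lemma sum_powr_le_powr:
  assumes "\<delta> < 1" "0 \<le> \<delta>"
  shows "real N powr (1 - \<delta>) \<le> (\<Sum>m=1..N. real m powr (- \<delta>))"
proof (cases "N = 0")
  case False
  have "real N powr (1 - \<delta>) = (\<Sum>m=1..N. real N powr (- \<delta>))" using False by (simp add: powr_diff powr_minus divide_inverse)
  also have "\<dots> \<le> (\<Sum>m=1..N. real m powr (- \<delta>))" using assms by (intro sum_mono powr_mono2') auto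
  finally show ?thesis .
qed simp

text \<open>The error is dominated by the series of C m^(-\<delta>) r^m / m, which stays bounded as
  r tends to 1 thanks to the power saving. Summability is a premise inside the conclusion so that
  one \<open>K\<close> serves all \<open>n\<close>.\<close>

lemma log_average_bounded:
  fixes x :: "nat \<Rightarrow> real"
  assumes "0 < \<delta>" "\<delta> < 1" and x: "\<And>N. \<bar>\<Sum>m=1..N. x m - \<mu>\<bar> \<le> C * real N powr (1 - \<delta>)"
  obtains K where "\<And>n. n \<ge> 2 \<Longrightarrow> summable (\<lambda>m. x m / real m * (1 - 1 / real n) ^ m) \<Longrightarrow>
    \<bar>(\<Sum>m. x m / real m * (1 - 1 / real n) ^ m) - \<mu> * ln (real n)\<bar> \<le> K"
proof -
  have C: "C \<ge> 0" using x[of 1] by simp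
  have sp: "summable (\<lambda>m. real m powr (-1 - \<delta>))" using assms by (simp add: summable_real_powr_iff)
  show ?thesis
  proof (rule that[of "C * (\<Sum>m. real m powr (-1 - \<delta>))"])
    fix n :: nat assume n: "n \<ge> 2" and sx: "summable (\<lambda>m. x m / real m * (1 - 1 / real n) ^ m)"
    let ?r = "1 - 1 / real n"
    have r: "0 < ?r" "?r < 1" using n by auto
    have L: "(\<lambda>m. \<mu> * (1 / real m * ?r ^ m)) sums (\<mu> * ln (real n))" by (intro sums_mult log_series n)
    have D: "(\<lambda>m. (x m - \<mu>) / real m * ?r ^ m) sums ((\<Sum>m. x m / real m * ?r ^ m) - \<mu> * ln (real n))"
      using sums_diff[OF summable_sums[OF sx] L] by (simp add: diff_divide_distrib left_diff_distrib)
    have yb: "norm (C * real m powr (- \<delta>) / real m * ?r ^ m) \<le> C * real m powr (-1 - \<delta>)" for m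
    proof (cases "m = 0")
      case False
      then have "real m powr (- \<delta>) / real m = real m powr (-1 - \<delta>)" by (simp add: powr_diff powr_minus field_simps)
      moreover have "?r ^ m \<le> 1" using r by (intro power_le_one) auto
      ultimately show ?thesis using C r
        by (simp add: abs_mult mult_left_le flip: times_divide_eq_right)
    qed simp
    have sC: "summable (\<lambda>m. C * real m powr (-1 - \<delta>))" using sp by (rule summable_mult)
    have sy: "summable (\<lambda>m. C * real m powr (- \<delta>) / real m * ?r ^ m)"
      using sC yb by (rule summable_comparison_test'[where N=0])
    have "\<bar>\<Sum>m. (x m - \<mu>) / real m * ?r ^ m\<bar> \<le> (\<Sum>m. C * real m powr (- \<delta>) / real m * ?r ^ m)"
    proof (rule log_series_domination[OF r _ sums_summable[OF D] sy])
      fix N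
      have "\<bar>\<Sum>m=1..N. x m - \<mu>\<bar> \<le> C * (\<Sum>m=1..N. real m powr (- \<delta>))"
        using x[of N] mult_left_mono[OF sum_powr_le_powr[of \<delta> N] C] assms by linarith
      then show "\<bar>\<Sum>m=1..N. x m - \<mu>\<bar> \<le> (\<Sum>m=1..N. C * real m powr (- \<delta>))" by (simp add: sum_distrib_left)
    qed
    also have "\<dots> \<le> (\<Sum>m. C * real m powr (-1 - \<delta>))"
      using order_trans[OF abs_ge_self yb[unfolded real_norm_def]] by (intro suminf_le sy sC)
    also have "\<dots> = C * (\<Sum>m. real m powr (-1 - \<delta>))" by (rule suminf_mult[OF sp])
    finally show "\<bar>(\<Sum>m. x m / real m * ?r ^ m) - \<mu> * ln (real n)\<bar> \<le> C * (\<Sum>m. real m powr (-1 - \<delta>))"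
      using sums_unique[OF D] by simp
  qed
qed

lemma log_average_le:
  fixes x :: "nat \<Rightarrow> real"
  assumes n: "n \<ge> 2" and x0: "\<And>m. x m \<ge> 0" and x: "\<And>N. (\<Sum>m=1..N. x m) \<le> C * real N"
    and sx: "summable (\<lambda>m. x m / real m * (1 - 1 / real n) ^ m)"
  shows "(\<Sum>m. x m / real m * (1 - 1 / real n) ^ m) \<le> C * ln (real n)"
proof -
  have r: "0 < 1 - 1 / real n" "1 - 1 / real n < 1" using n by auto
  have L: "(\<lambda>m. C / real m * (1 - 1 / real n) ^ m) sums (C * ln (real n))"
    using sums_mult[OF log_series[OF n], of C] by simp
  have "\<bar>\<Sum>m. x m / real m * (1 - 1 / real n) ^ m\<bar> \<le> (\<Sum>m. C / real m * (1 - 1 / real n) ^ m)"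
  proof (rule log_series_domination[OF r _ sx sums_summable[OF L]])
    fix N show "\<bar>\<Sum>m=1..N. x m\<bar> \<le> (\<Sum>m=1..N. C)" using x[of N] x0 by (simp add: sum_nonneg mult.commute)
  qed
  then show ?thesis using sums_unique[OF L] by simp
qed

section \<open>The cycle of a random point\<close>

text \<open>The weights have successive ratios 1 - x with x = (1 - \<theta>) / (k + 1). Bernoulli's
  inequality (1 - x)^p \<ge> 1 - p x compares the power of such a ratio with the ratio for
  \<theta>', since 1 - \<theta>' = p (1 - \<theta>); the condition on \<open>p\<close> says
  \<theta>' > 0.\<close>

lemma ewens_weight_ratio_powr:
  assumes th: "0 < \<theta>" "\<theta> < 1" and p: "p > 1" "p * (1 - \<theta>) < 1" and ik: "i \<le> k"
  defines "\<theta>' \<equiv> 1 - p * (1 - \<theta>)"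
  shows "(ewens_weight \<theta> i / ewens_weight \<theta> k) powr p \<le> ewens_weight \<theta>' i / ewens_weight \<theta>' k"
  using ik
proof (induction k rule: dec_induct)
  case base
  then show ?case using ewens_weight_pos[of \<theta> i] ewens_weight_pos[of \<theta>' i] th p by (simp add: \<theta>'_def)
next
  case (step k)
  let ?a = "ewens_weight \<theta>" and ?b = "ewens_weight \<theta>'"
  have th': "\<theta>' > 0" "\<theta>' < 1" using p th by (auto simp: \<theta>'_def)
  have ap: "?a k > 0" "?b k > 0" for k using ewens_weight_pos th th' by auto
  define x where "x = (1 - \<theta>) / real (Suc k)"
  have x: "0 \<le> x" "x < 1" using th by (auto simp: x_def field_simps)
  have "x * p = p * (1 - \<theta>) / real (Suc k)" by (simp add: x_def)
  also have "\<dots> < 1" using p by (simp add: divide_less_eq)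
  finally have xp: "x * p < 1" .
  have yi: "1 - p * x \<le> (1 - x) powr p"
  proof -
    \<comment> \<open>Young's inequality with second factor 1 is Bernoulli's inequality in
      disguise.\<close>
    have "(1 - x) * 1 \<le> (1 - x) powr p / p + 1 powr (p / (p - 1)) / (p / (p - 1))"
      by (rule Youngs_inequality) (use p x in \<open>auto simp: field_simps\<close>)
    then have "p * (1 - x) \<le> p * ((1 - x) powr p / p + (p - 1) / p)" using p by (intro mult_left_mono) auto
    also have "\<dots> = (1 - x) powr p + (p - 1)" using p by (simp add: distrib_left)
    finally show ?thesis by (simp add: algebra_simps)
  qed
  have a: "?a k / ?a (Suc k) = 1 / (1 - x)"
  proof -
    have "?a (Suc k) = (1 - x) * ?a k" using ewens_weight_Suc[of k \<theta>] by (simp add: x_def field_simps)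
    then show ?thesis using ap(1)[of k] by simp
  qed
  have b: "?b k / ?b (Suc k) = 1 / (1 - p * x)"
  proof -
    have "?b (Suc k) = (1 - p * x) * ?b k" using ewens_weight_Suc[of k \<theta>'] by (simp add: x_def \<theta>'_def field_simps)
    then show ?thesis using ap(2)[of k] by simp
  qed
  have "(?a i / ?a (Suc k)) powr p = ((?a i / ?a k) * (?a k / ?a (Suc k))) powr p" using ap(1)[of k] by simp
  also have "\<dots> = (?a i / ?a k) powr p * (?a k / ?a (Suc k)) powr p"
    using ap(1) by (intro powr_mult)
  also have "(?a k / ?a (Suc k)) powr p = 1 / (1 - x) powr p" unfolding a using x by (simp add: powr_divide)
  also have "(?a i / ?a k) powr p * (1 / (1 - x) powr p) \<le> (?b i / ?b k) * (1 / (1 - p * x))"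
    using step.IH yi xp x ap(2)[of i] ap(2)[of k] by (intro mult_mono frac_le) (auto simp: mult.commute intro: less_imp_le)
  also have "\<dots> = ?b i / ?b (Suc k)" unfolding b[symmetric] using ap(2)[of k] by simp
  finally show ?case .
qed

text \<open>
  For \<open>\<theta> < 1\<close> the weights are unbounded near \<open>j = k\<close>; Young's inequality with an exponent \<open>p\<close> such
  that \<open>p (1 - \<theta>) < 1\<close> trades this against a high moment of \<open>u\<close>.
\<close>

lemma last_cycle_bound:
  fixes u :: "nat \<Rightarrow> real"
  assumes th: "\<theta> > 0" and u: "\<And>k. \<exists>C. \<forall>N. (\<Sum>m=1..N. u m ^ (2 * k)) \<le> C * real N"
  obtains \<beta> where "\<And>k. k \<ge> 1 \<Longrightarrow> \<theta> * (\<Sum>j=1..k. ewens_weight \<theta> (k - j) * \<bar>u j\<bar>) \<le> real k * ewens_weight \<theta> k * \<beta>"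
proof (cases "\<theta> \<ge> 1")
  case True
  obtain C where C: "\<And>N. (\<Sum>m=1..N. u m ^ (2 * 1)) \<le> C * real N" using u[of 1] by auto
  \<comment> \<open>For \<theta> \<ge> 1 the weights increase, so their ratios are at most 1 and the
    second moment of \<open>u\<close> suffices.\<close>
  have inc: "ewens_weight \<theta> i \<le> ewens_weight \<theta> k" if "i \<le> k" for i k
    using that
  proof (induction k rule: dec_induct)
    case (step k)
    have "real (Suc k) * ewens_weight \<theta> k \<le> real (Suc k) * ewens_weight \<theta> (Suc k)"
      unfolding ewens_weight_Suc using True ewens_weight_pos[OF th, of k] by (intro mult_right_mono) auto
    then have "ewens_weight \<theta> k \<le> ewens_weight \<theta> (Suc k)" by (simp del: of_nat_Suc)
    then show ?case using step by linarith
  qed simp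
  show ?thesis
  proof (rule that[of "\<theta> * (1 + C)"])
    fix k :: nat assume "k \<ge> 1"
    have "(\<Sum>j=1..k. ewens_weight \<theta> (k - j) * \<bar>u j\<bar>) \<le> (\<Sum>j=1..k. ewens_weight \<theta> k * (1 + u j ^ (2 * 1)))"
    proof (intro sum_mono mult_mono inc)
      fix j show "\<bar>u j\<bar> \<le> 1 + u j ^ (2 * 1)" using zero_le_power2[of "\<bar>u j\<bar> - 1"] by (simp add: power2_diff)
    qed (use ewens_weight_pos[OF th] in \<open>auto intro: less_imp_le\<close>)
    also have "\<dots> = ewens_weight \<theta> k * (real k + (\<Sum>j=1..k. u j ^ (2 * 1)))"
      by (simp add: sum.distrib flip: sum_distrib_left)
    also have "\<dots> \<le> ewens_weight \<theta> k * (real k + C * real k)"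
      using C[of k] ewens_weight_pos[OF th, of k] by (intro mult_left_mono) auto
    finally have "\<theta> * (\<Sum>j=1..k. ewens_weight \<theta> (k - j) * \<bar>u j\<bar>) \<le> \<theta> * (ewens_weight \<theta> k * (real k + C * real k))"
      using th by (intro mult_left_mono) auto
    then show "\<theta> * (\<Sum>j=1..k. ewens_weight \<theta> (k - j) * \<bar>u j\<bar>) \<le> real k * ewens_weight \<theta> k * (\<theta> * (1 + C))"
      by (simp add: algebra_simps)
  qed
next
  case False
  then have th1: "\<theta> < 1" by simp
  \<comment> \<open>With p = 1 + 1 / q for an integer q, the conjugate exponent q + 1 is an integer
    too, and Young's inequality produces a power moment. The lower bound on q amounts to p (1 -
    \<theta>) < 1.\<close>
  obtain q :: nat where q: "real q > (1 - \<theta>) / \<theta>" using reals_Archimedean2 by blast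
  have q0: "real q > 0" using q th th1 by (meson divide_pos_pos diff_gt_0_iff_gt less_trans)
  define p where "p = 1 + 1 / real q"
  have p: "p > 1" using q0 by (simp add: p_def)
  have "(1 - \<theta>) / real q < \<theta>" using q q0 th by (simp add: field_simps)
  then have p': "p * (1 - \<theta>) < 1" by (simp add: p_def distrib_right)
  define \<theta>' where "\<theta>' = 1 - p * (1 - \<theta>)"
  have th': "\<theta>' > 0" using p' by (simp add: \<theta>'_def)
  let ?a = "ewens_weight \<theta>" and ?b = "ewens_weight \<theta>'"
  have ap: "?a k > 0" "?b k > 0" for k using ewens_weight_pos th th' by auto
  \<comment> \<open>The exponent is doubled because the hypothesis is about even moments; they
    dominate through y \<le> 1 + y^2.\<close>
  obtain C where C: "\<And>N. (\<Sum>m=1..N. u m ^ (2 * Suc q)) \<le> C * real N" using u[of "Suc q"] by auto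
  show ?thesis
  proof (rule that[of "\<theta> * (1 / \<theta>' + 1 + C)"])
    fix k :: nat assume k: "k \<ge> 1"
    have "(\<Sum>j=1..k. ?a (k - j) / ?a k * \<bar>u j\<bar>) \<le> (\<Sum>j=1..k. ?b (k - j) / ?b k + (1 + u j ^ (2 * Suc q)))"
    proof (rule sum_mono)
      fix j
      have div_le: "z / s \<le> z" if "z \<ge> 0" "s \<ge> 1" for z s :: real
        using that mult_left_mono[of 1 s z] by (simp add: divide_le_eq)
      define t where "t = ?a (k - j) / ?a k"
      have t: "t > 0" using ap by (simp add: t_def)
      have pe: "p = (real q + 1) / real q" using q0 by (simp add: p_def add_divide_distrib)
      have "1 / p = real q / (real q + 1)" unfolding pe by simp
      moreover have "real q / (real q + 1) + 1 / (real q + 1) = 1" using q0 by (simp flip: add_divide_distrib)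
      ultimately have pq: "1 / p + 1 / real (Suc q) = 1" by (simp add: add.commute)
      have "t * \<bar>u j\<bar> \<le> t powr p / p + \<bar>u j\<bar> powr real (Suc q) / real (Suc q)"
        by (rule Youngs_inequality[OF p _ pq]) (use q0 t in auto)
      also have "\<dots> \<le> t powr p + \<bar>u j\<bar> ^ Suc q"
      proof (rule add_mono)
        show "t powr p / p \<le> t powr p" using p by (intro div_le) auto
        have "\<bar>u j\<bar> powr real (Suc q) = \<bar>u j\<bar> ^ Suc q" by (rule powr_realpow') auto
        then show "\<bar>u j\<bar> powr real (Suc q) / real (Suc q) \<le> \<bar>u j\<bar> ^ Suc q"
          by (simp only:) (intro div_le, auto)
      qed
      also have "t powr p \<le> ?b (k - j) / ?b k"
        unfolding t_def \<theta>'_def by (rule ewens_weight_ratio_powr[OF th th1 p p']) simp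
      also have "\<bar>u j\<bar> ^ Suc q \<le> 1 + u j ^ (2 * Suc q)"
      proof -
        have "y \<le> 1 + y\<^sup>2" if "y \<ge> 0" for y :: real
          using zero_le_power2[of "y - 1"] that by (simp add: power2_diff)
        from this[of "\<bar>u j\<bar> ^ Suc q"] have "\<bar>u j\<bar> ^ Suc q \<le> 1 + (\<bar>u j\<bar> ^ Suc q)\<^sup>2" by simp
        also have "(\<bar>u j\<bar> ^ Suc q)\<^sup>2 = u j ^ (2 * Suc q)"
        proof -
          have "(\<bar>u j\<bar> ^ Suc q)\<^sup>2 = (\<bar>u j\<bar>\<^sup>2) ^ Suc q" by (simp only: power_mult[symmetric] mult.commute)
          then show ?thesis by (simp only: power2_abs power_mult)
        qed
        finally show ?thesis .
      qed
      finally show "?a (k - j) / ?a k * \<bar>u j\<bar> \<le> ?b (k - j) / ?b k + (1 + u j ^ (2 * Suc q))" by (simp add: t_def)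
    qed
    also have "\<dots> = (\<Sum>j=1..k. ?b (k - j)) / ?b k + (real k + (\<Sum>j=1..k. u j ^ (2 * Suc q)))"
      by (simp only: sum.distrib sum_divide_distrib) simp
    \<comment> \<open>Because \<theta>' > 0, the sum of the weights divided by the last one grows
      only linearly in k.\<close>
    also have "(\<Sum>j=1..k. ?b (k - j)) = real k * ?b k / \<theta>'"
    proof -
      have "(\<Sum>j=1..k. ?b (k - j)) = (\<Sum>i<k. ?b i)"
        using sum.nat_diff_reindex[of ?b k] sum.shift_bounds_Suc_ivl[of "\<lambda>j. ?b (k - j)" 0 k]
        by (simp add: atLeastLessThanSuc_atLeastAtMost lessThan_atLeast0)
      then show ?thesis using sum_ewens_weight[of \<theta>' k] th' by (simp add: field_simps)
    qed
    also have "real k * ?b k / \<theta>' / ?b k + (real k + (\<Sum>j=1..k. u j ^ (2 * Suc q))) \<le> real k / \<theta>' + (real k + C * real k)"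
      using C[of k] ap(2)[of k] by (intro add_mono) auto
    finally have "(\<Sum>j=1..k. ?a (k - j) / ?a k * \<bar>u j\<bar>) \<le> real k / \<theta>' + (real k + C * real k)" .
    then have "\<theta> * ?a k * (\<Sum>j=1..k. ?a (k - j) / ?a k * \<bar>u j\<bar>) \<le> \<theta> * ?a k * (real k / \<theta>' + (real k + C * real k))"
      using th ap(1)[of k] by (intro mult_left_mono) auto
    moreover have "\<theta> * ?a k * (\<Sum>j=1..k. ?a (k - j) / ?a k * \<bar>u j\<bar>) = \<theta> * (\<Sum>j=1..k. ?a (k - j) * \<bar>u j\<bar>)"
      using ap(1)[of k] by (simp add: sum_distrib_left)
    ultimately have "\<theta> * (\<Sum>j=1..k. ?a (k - j) * \<bar>u j\<bar>) \<le> \<theta> * ?a k * (real k / \<theta>' + (real k + C * real k))"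
      by (simp only:)
    also have "\<dots> = real k * ?a k * (\<theta> * (1 / \<theta>' + 1 + C))" by (simp add: algebra_simps)
    finally show "\<theta> * (\<Sum>j=1..k. ?a (k - j) * \<bar>u j\<bar>) \<le> real k * ?a k * (\<theta> * (1 / \<theta>' + 1 + C))" .
  qed
qed

section \<open>Normal approximation with rate\<close>

lemma ln_ge_1: "n \<ge> 3 \<Longrightarrow> ln (real n) \<ge> 1"
  using exp_le by (subst ln_ge_iff) (auto intro: order_trans[of _ 3])

text \<open>Put s = sqrt (ln n). The test function in the variable of the statistic is Lipschitz
  with constant 1 / s, so the passage to the mixture costs B / s. In the mixture the Stein equation
  leaves three bounded errors, due to third moments, mean and variance, again multiplied by 1 / s.
  The constant \<open>K\<close> depends on the weights and on \<theta> but not on the test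
  function.\<close>

lemma lin_stat_clt:
  fixes \<theta> \<mu> V C \<delta> :: real and u :: "nat \<Rightarrow> real"
  assumes th: "\<theta> > 0" and V: "V \<ge> 0" and delta: "0 < \<delta>" "\<delta> < 1"
    and u0: "\<And>m. m \<ge> 1 \<Longrightarrow> \<bar>u m\<bar> \<le> C * real m"
    and u1: "\<And>N. \<bar>\<Sum>m=1..N. u m - \<mu>\<bar> \<le> C * real N powr (1 - \<delta>)"
    and u2: "\<And>N. \<bar>\<Sum>m=1..N. (u m)\<^sup>2 - V\<bar> \<le> C * real N powr (1 - \<delta>)"
    and u3: "\<And>k. \<exists>C. \<forall>N. (\<Sum>m=1..N. u m ^ (2 * k)) \<le> C * real N"
  obtains K where "\<And>n g g'. n \<ge> 3 \<Longrightarrow> (\<And>x. (g has_real_derivative g' x) (at x)) \<Longrightarrow> (\<And>x. \<bar>g' x\<bar> \<le> 1) \<Longrightarrow>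
    \<bar>lin_stat \<theta> u n (\<lambda>x. g (x / sqrt (ln (real n)) - \<theta> * sqrt (ln (real n)) * \<mu>)) / ewens_weight \<theta> n -
      (\<integral>x. std_normal_density x * g (sqrt (\<theta> * V) * x) \<partial>lborel)\<bar> \<le> K / sqrt (ln (real n))"
proof -
  obtain \<beta> where beta: "\<And>k. k \<ge> 1 \<Longrightarrow> \<theta> * (\<Sum>j=1..k. ewens_weight \<theta> (k - j) * \<bar>u j\<bar>) \<le> real k * ewens_weight \<theta> k * \<beta>"
    by (rule last_cycle_bound[OF th u3]) blast
  obtain K1 where K1: "\<And>n. n \<ge> 2 \<Longrightarrow> summable (\<lambda>m. u m / real m * (1 - 1 / real n) ^ m) \<Longrightarrow>
    \<bar>(\<Sum>m. u m / real m * (1 - 1 / real n) ^ m) - \<mu> * ln (real n)\<bar> \<le> K1"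
    by (rule log_average_bounded[OF delta u1]) blast
  obtain K2 where K2: "\<And>n. n \<ge> 2 \<Longrightarrow> summable (\<lambda>m. (u m)\<^sup>2 / real m * (1 - 1 / real n) ^ m) \<Longrightarrow>
    \<bar>(\<Sum>m. (u m)\<^sup>2 / real m * (1 - 1 / real n) ^ m) - V * ln (real n)\<bar> \<le> K2"
    by (rule log_average_bounded[OF delta u2]) blast
  obtain C4 where C4: "\<And>N. (\<Sum>m=1..N. u m ^ (2 * 2)) \<le> C4 * real N" using u3[of 2] by auto
  have cube: "(\<Sum>m=1..N. \<bar>u m\<bar> ^ 3) \<le> (1 + C4) * real N" for N
  proof -
    have "\<bar>y\<bar> ^ 3 \<le> 1 + y ^ (2 * 2)" for y :: real
    proof (cases "\<bar>y\<bar> \<le> 1")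
      case True
      then have "\<bar>y\<bar> ^ 3 \<le> 1" by (intro power_le_one) auto
      moreover have "0 \<le> y ^ (2 * 2)" unfolding power_mult by simp
      ultimately show ?thesis by linarith
    next
      case False
      then have "\<bar>y\<bar> ^ 3 \<le> \<bar>y\<bar> ^ (2 * 2)" by (intro power_increasing) auto
      also have "\<dots> = y ^ (2 * 2)" by (rule power_even_abs) simp
      finally show ?thesis by simp
    qed
    then have "(\<Sum>m=1..N. \<bar>u m\<bar> ^ 3) \<le> (\<Sum>m=1..N. 1 + u m ^ (2 * 2))" by (rule sum_mono)
    also have "\<dots> \<le> (1 + C4) * real N" using C4[of N] by (simp add: sum.distrib distrib_right)
    finally show ?thesis .
  qed
  define \<sigma> where "\<sigma> = sqrt (\<theta> * V)"
  define B where "B = \<beta> * (2 + \<theta>\<^sup>2 + exp 1)"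
  define K where "K = B + (if V = 0 then 1 + (\<theta> * K1)\<^sup>2 + \<theta> * K2
     else 8 * (1 + C4) / V + 8 * (\<theta> * K1) + 8 * (\<theta> * K2) / \<sigma>)"
  show ?thesis
  proof (rule that[of K])
    fix n :: nat and g g' :: "real \<Rightarrow> real"
    assume n: "n \<ge> 3" and g: "\<And>x. (g has_real_derivative g' x) (at x)" and g1: "\<And>x. \<bar>g' x\<bar> \<le> 1"
    have n2: "n \<ge> 2" using n by simp
    define L where "L = ln (real n)"
    define s where "s = sqrt L"
    define \<tau> where "\<tau> = \<theta> * \<mu> * L"
    define r where "r = 1 - 1 / real n"
    have r: "0 < r" "r < 1" using n by (auto simp: r_def)
    have L: "L \<ge> 1" unfolding L_def by (rule ln_ge_1[OF n])
    have s: "s \<ge> 1" "s > 0" "s\<^sup>2 = L" "s * s = L" using L by (auto simp: s_def)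
    have lip: "\<bar>g x - g y\<bar> \<le> \<bar>x - y\<bar>" for x y
      using field_differentiable_bound[of UNIV g g' 1 x y] g g1 by auto
    define G where "G x = g (x / s - \<theta> * s * \<mu>)" for x
    have Ge: "G x = g ((x - \<tau>) / s)" for x
    proof -
      have "\<tau> = \<theta> * s * \<mu> * s" unfolding \<tau>_def s(4)[symmetric] by (simp only: mult_ac)
      then have "\<tau> / s = \<theta> * s * \<mu>" using s(2) by simp
      then show ?thesis by (simp add: G_def diff_divide_distrib)
    qed
    define m1 where "m1 = (\<Sum>m. \<theta> * u m / real m * r ^ m)"
    define m2 where "m2 = (\<Sum>m. \<theta> * (u m)\<^sup>2 / real m * r ^ m)"
    define m3 where "m3 = (\<Sum>m. \<theta> * \<bar>u m\<bar> ^ 3 / real m * r ^ m)"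
    define Z where "Z = mix_total \<theta> r"
    have Z: "Z > 0" unfolding Z_def by (rule mix_total_pos[OF th r])
    have sm: "summable (\<lambda>m. u m ^ i / real m * r ^ m)" "summable (\<lambda>m. \<bar>u m\<bar> ^ i / real m * r ^ m)"
      if "1 \<le> i" "i \<le> 3" for i
    proof -
      have *: "summable (\<lambda>m. \<bar>u m ^ i / real m * r ^ m\<bar>)" using summable_log_moment[OF r u0 that] by simp
      then show "summable (\<lambda>m. u m ^ i / real m * r ^ m)" by (rule summable_rabs_cancel)
      show "summable (\<lambda>m. \<bar>u m\<bar> ^ i / real m * r ^ m)" using * r by (simp add: abs_mult power_abs)
    qed
    have m1: "\<bar>m1 - \<tau>\<bar> \<le> \<theta> * K1"
    proof -
      have "m1 = \<theta> * (\<Sum>m. u m / real m * r ^ m)"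
        unfolding m1_def using suminf_mult[OF sm(1)[of 1], of \<theta>] by (simp add: mult.assoc)
      moreover have "\<bar>(\<Sum>m. u m / real m * r ^ m) - \<mu> * L\<bar> \<le> K1"
        using K1[OF n2] sm(1)[of 1] by (simp add: r_def L_def)
      moreover have "\<theta> * X - \<theta> * \<mu> * L = \<theta> * (X - \<mu> * L)" for X by (simp add: algebra_simps)
      ultimately show ?thesis using th by (simp add: \<tau>_def abs_mult)
    qed
    have m2: "\<bar>m2 - \<theta> * V * L\<bar> \<le> \<theta> * K2"
    proof -
      have "m2 = \<theta> * (\<Sum>m. (u m)\<^sup>2 / real m * r ^ m)"
        unfolding m2_def using suminf_mult[OF sm(1)[of 2], of \<theta>] by (simp add: mult.assoc)
      moreover have "\<bar>(\<Sum>m. (u m)\<^sup>2 / real m * r ^ m) - V * L\<bar> \<le> K2"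
        using K2[OF n2] sm(1)[of 2] by (simp add: r_def L_def)
      moreover have "\<theta> * X - \<theta> * V * L = \<theta> * (X - V * L)" for X by (simp add: algebra_simps)
      ultimately show ?thesis using th by (simp add: abs_mult)
    qed
    have m3: "m3 \<le> \<theta> * ((1 + C4) * L)"
    proof -
      have "m3 = \<theta> * (\<Sum>m. \<bar>u m\<bar> ^ 3 / real m * r ^ m)"
        unfolding m3_def using suminf_mult[OF sm(2)[of 3], of \<theta>] by (simp add: mult.assoc)
      also have "\<dots> \<le> \<theta> * ((1 + C4) * L)"
        unfolding L_def r_def using th sm(2)[of 3] cube
        by (intro mult_left_mono log_average_le n2) (auto simp: r_def)
      finally show ?thesis .
    qed
    have close: "\<bar>lin_stat \<theta> u n G / ewens_weight \<theta> n - mix_stat \<theta> u r G / Z\<bar> \<le> B / s"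
    proof -
      \<comment> \<open>Multiplication by \<open>s\<close> makes \<open>G\<close> 1-Lipschitz; by
        linearity the error is divided by \<open>s\<close> afterwards.\<close>
      have "\<bar>s * G x - s * G y\<bar> \<le> \<bar>x - y\<bar>" for x y
      proof -
        have "\<bar>s * G x - s * G y\<bar> = s * \<bar>G x - G y\<bar>" using s by (simp add: abs_mult flip: right_diff_distrib)
        also have "\<dots> \<le> s * \<bar>(x - \<tau>) / s - (y - \<tau>) / s\<bar>" unfolding Ge using s by (intro mult_left_mono lip) auto
        also have "\<dots> = \<bar>x - y\<bar>" using s by (simp flip: diff_divide_distrib)
        finally show ?thesis .
      qed
      from lin_stat_mix_stat_close[where \<beta>=\<beta> and C=C and n=n, OF th u0 beta this n2]
      have "\<bar>lin_stat \<theta> u n (\<lambda>x. s * G x) / ewens_weight \<theta> n - mix_stat \<theta> u r (\<lambda>x. s * G x) / Z\<bar> \<le> B"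
        by (simp add: B_def r_def Z_def)
      also have "mix_stat \<theta> u r (\<lambda>x. s * G x) = s * mix_stat \<theta> u r G"
      proof (rule mix_stat_cmult[OF th r u0, of _ "\<bar>G 0\<bar> + 1"])
        fix x
        have "\<bar>G x - G 0\<bar> \<le> \<bar>(x - \<tau>) / s - (0 - \<tau>) / s\<bar>" unfolding Ge by (rule lip)
        also have "\<dots> = \<bar>x\<bar> / s" using s by (simp add: diff_divide_distrib)
        also have "\<dots> \<le> \<bar>x\<bar> / 1" using s by (intro divide_left_mono) auto
        finally have "\<bar>G x\<bar> \<le> \<bar>G 0\<bar> + \<bar>x\<bar>" by simp
        moreover note abs_le_one_plus_square[of x]
        moreover have "0 \<le> \<bar>G 0\<bar> * x\<^sup>2" by simp
        ultimately show "\<bar>G x\<bar> \<le> (\<bar>G 0\<bar> + 1) * (1 + x\<^sup>2)" unfolding distrib_left distrib_right by linarith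
      qed
      finally have "\<bar>s * (lin_stat \<theta> u n G / ewens_weight \<theta> n - mix_stat \<theta> u r G / Z)\<bar> \<le> B"
        by (simp add: lin_stat_cmult right_diff_distrib)
      then show ?thesis using s by (simp add: abs_mult pos_le_divide_eq mult.commute)
    qed
    have main: "\<bar>mix_stat \<theta> u r G / Z - (\<integral>x. std_normal_density x * g (\<sigma> * x) \<partial>lborel)\<bar> \<le> (K - B) / s"
    proof (cases "V = 0")
      case True
      \<comment> \<open>Without variance the limit is the constant 0. The second moment about \<tau>
        is bounded, because \<open>m1 - \<tau>\<close> and \<open>m2\<close> are, and this gives the
        rate directly.\<close>
      have bd: "\<bar>G x - g 0\<bar> \<le> 1 / s * (1 + (x - \<tau>)\<^sup>2)" for x
      proof -
        have "\<bar>G x - g 0\<bar> \<le> \<bar>(x - \<tau>) / s - 0\<bar>" unfolding Ge by (rule lip)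
        also have "\<dots> = 1 / s * \<bar>x - \<tau>\<bar>" using s by simp
        also have "\<dots> \<le> 1 / s * (1 + (x - \<tau>)\<^sup>2)"
          using s by (intro mult_left_mono abs_le_one_plus_square) auto
        finally show ?thesis .
      qed
      have sq: "(x - \<tau>)\<^sup>2 \<le> (2 + 2 * \<tau>\<^sup>2) * (1 + x\<^sup>2)" for x
      proof -
        have "(x - \<tau>)\<^sup>2 \<le> 2 * x\<^sup>2 + 2 * \<tau>\<^sup>2" using zero_le_power2[of "x + \<tau>"] by (simp add: power2_sum power2_diff)
        moreover have "0 \<le> \<tau>\<^sup>2 * x\<^sup>2" by simp
        moreover have "(2 + 2 * \<tau>\<^sup>2) * (1 + x\<^sup>2) = 2 + 2 * x\<^sup>2 + 2 * \<tau>\<^sup>2 + 2 * (\<tau>\<^sup>2 * x\<^sup>2)"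
          by (simp add: algebra_simps)
        ultimately show ?thesis by linarith
      qed
      have bd2: "1 / s * (1 + (x - \<tau>)\<^sup>2) \<le> (3 + 2 * \<tau>\<^sup>2) * (1 + x\<^sup>2)" for x
      proof -
        have "1 / s * (1 + (x - \<tau>)\<^sup>2) \<le> 1 * (1 + (x - \<tau>)\<^sup>2)" using s by (intro mult_right_mono) auto
        also have "\<dots> \<le> 1 * (1 + x\<^sup>2) + (2 + 2 * \<tau>\<^sup>2) * (1 + x\<^sup>2)"
          unfolding mult_1 using sq[of x] zero_le_power2[of x] by linarith
        finally show ?thesis by (simp add: algebra_simps)
      qed
      have "\<bar>mix_stat \<theta> u r (\<lambda>x. G x - g 0)\<bar> \<le> mix_stat \<theta> u r (\<lambda>x. 1 / s * (1 + (x - \<tau>)\<^sup>2))"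
        by (rule mix_stat_abs_le[OF th r u0 bd bd2])
      also have "\<dots> = 1 / s * mix_stat \<theta> u r (\<lambda>x. 1 + (x - \<tau>)\<^sup>2)"
      proof (rule mix_stat_cmult[OF th r u0, of _ "3 + 2 * \<tau>\<^sup>2"])
        show "\<bar>1 + (x - \<tau>)\<^sup>2\<bar> \<le> (3 + 2 * \<tau>\<^sup>2) * (1 + x\<^sup>2)" for x
        proof -
          have "(3 + 2 * \<tau>\<^sup>2) * (1 + x\<^sup>2) = 1 + x\<^sup>2 + (2 + 2 * \<tau>\<^sup>2) * (1 + x\<^sup>2)" by (simp add: algebra_simps)
          then show ?thesis using sq[of x] zero_le_power2[of x] zero_le_power2[of "x - \<tau>"] by linarith
        qed
      qed
      also have "mix_stat \<theta> u r (\<lambda>x. 1 + (x - \<tau>)\<^sup>2) = mix_stat \<theta> u r (\<lambda>x. 1) + mix_stat \<theta> u r (\<lambda>x. (x - \<tau>)\<^sup>2)"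
        by (rule mix_stat_add[OF th r u0, of _ 1 _ "2 + 2 * \<tau>\<^sup>2"]) (use sq in auto)
      also have "\<dots> = (1 + ((m1 - \<tau>)\<^sup>2 + m2)) * Z"
        using mix_stat_second_moment[OF th r u0, of \<tau>] mix_stat_const[OF th r, of u 1]
        by (simp add: m1_def m2_def Z_def distrib_right)
      also have "1 / s * \<dots> \<le> 1 / s * ((1 + ((\<theta> * K1)\<^sup>2 + \<theta> * K2)) * Z)"
      proof (intro mult_left_mono mult_right_mono add_mono order_refl)
        show "(m1 - \<tau>)\<^sup>2 \<le> (\<theta> * K1)\<^sup>2" using power_mono[OF m1, of 2] by simp
        show "m2 \<le> \<theta> * K2" using m2 True by simp
      qed (use Z s in auto)
      also have "mix_stat \<theta> u r (\<lambda>x. G x - g 0) = mix_stat \<theta> u r G - g 0 * Z"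
      proof -
        have "mix_stat \<theta> u r (\<lambda>x. (G x - g 0) + g 0) = mix_stat \<theta> u r (\<lambda>x. G x - g 0) + mix_stat \<theta> u r (\<lambda>_. g 0)"
          by (rule mix_stat_add[OF th r u0, of _ "3 + 2 * \<tau>\<^sup>2" _ "\<bar>g 0\<bar>"])
             (use order_trans[OF bd bd2] in \<open>auto simp: distrib_left\<close>)
        then show ?thesis using mix_stat_const[OF th r, of u "g 0"] by (simp add: Z_def)
      qed
      also have "1 + ((\<theta> * K1)\<^sup>2 + \<theta> * K2) = K - B" using True by (simp add: K_def)
      finally have "\<bar>mix_stat \<theta> u r G - g 0 * Z\<bar> \<le> (K - B) / s * Z" by simp
      moreover have "mix_stat \<theta> u r G - g 0 * Z = (mix_stat \<theta> u r G / Z - g 0) * Z" using Z by (simp add: field_simps)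
      ultimately have "\<bar>mix_stat \<theta> u r G / Z - g 0\<bar> * Z \<le> (K - B) / s * Z" using Z by (simp only: abs_mult abs_of_pos)
      then have "\<bar>mix_stat \<theta> u r G / Z - g 0\<bar> \<le> (K - B) / s" by (rule mult_right_le_imp_le[OF _ Z])
      then show ?thesis using True by (simp add: \<sigma>_def)
    next
      case False
      then have Vp: "V > 0" and sp: "\<sigma> > 0" and s2: "\<sigma>\<^sup>2 = \<theta> * V" using V th by (auto simp: \<sigma>_def)
      define t where "t = \<sigma> * s"
      have t: "t > 0" "t \<ge> \<sigma>" "t\<^sup>2 = \<theta> * V * L" "\<sigma> / t = 1 / s"
        using sp s s2 by (auto simp: t_def power_mult_distrib)
      define c0 where "c0 = (\<integral>x. std_normal_density x * (g (\<sigma> * x) / \<sigma>) \<partial>lborel)"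
      \<comment> \<open>Dividing by \<sigma> keeps the derivative of the rescaled test function at
        most 1, so the bounds of \<open>stein_solution\<close> hold with their absolute
        constants.\<close>
      have dh: "((\<lambda>z. g (\<sigma> * z) / \<sigma>) has_real_derivative g' (\<sigma> * x)) (at x)" for x
        using DERIV_cdivide[OF DERIV_chain2[where f=g and g="\<lambda>z. \<sigma> * z" and x=x, OF g DERIV_cmult_Id], of \<sigma>] sp by simp
      obtain f f' where f: "\<And>x. f' x - x * f x = g (\<sigma> * x) / \<sigma> - c0" "\<And>x. \<bar>f x\<bar> \<le> 8" "\<And>x. \<bar>f' x\<bar> \<le> 8"
        "\<And>x y. \<bar>f (x + y) - f x - y * f' x\<bar> \<le> 8 * y\<^sup>2"
        unfolding c0_def by (rule stein_solution[OF dh g1]) blast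
      define h where "h x = f ((x - \<tau>) / t)" for x
      define h' where "h' x = f' ((x - \<tau>) / t) / t" for x
      \<comment> \<open>Stein's equation at (x - \<tau>) / t, times \<sigma>. Up to sign, the
        bracket is the expression in \<open>mix_stat_stein\<close> with \<open>m1\<close> replaced
        by \<tau> and \<open>m2\<close> by t^2.\<close>
      have Gh: "G x = \<sigma> * c0 + \<sigma> / t * (t\<^sup>2 * h' x + ((- 1) * (x * h x) + \<tau> * h x))" for x
      proof -
        have "\<sigma> * ((x - \<tau>) / t) = (x - \<tau>) / s" using sp s by (simp add: t_def)
        then have "G x = \<sigma> * (g (\<sigma> * ((x - \<tau>) / t)) / \<sigma> - c0) + \<sigma> * c0"
          using sp by (simp add: Ge field_simps)
        also have "\<dots> = \<sigma> * (f' ((x - \<tau>) / t) - (x - \<tau>) / t * f ((x - \<tau>) / t)) + \<sigma> * c0" unfolding f(1) ..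
        also have "\<dots> = \<sigma> * c0 + \<sigma> / t * (t\<^sup>2 * h' x + ((- 1) * (x * h x) + \<tau> * h x))"
          unfolding h_def h'_def using t by (simp add: field_simps power2_eq_square)
        finally show ?thesis .
      qed
      \<comment> \<open>The bound 8 (y / t)^2 for \<open>f\<close>, written in the form M / 2 *
        y^2.\<close>
      have taylor: "\<bar>h (x + y) - h x - y * h' x\<bar> \<le> (16 / t\<^sup>2) / 2 * y\<^sup>2" for x y
        using f(4)[of "(x - \<tau>) / t" "y / t"] by (simp add: h_def h'_def power_divide add_divide_distrib diff_divide_distrib algebra_simps)
      define D where "D = 8 + 8 / t"
      have D0: "D \<ge> 8" "D \<ge> 8 / t" using t by (auto simp: D_def)
      have one: "1 \<le> 1 + x\<^sup>2" for x :: real by simp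
      have b1: "\<bar>x * h x\<bar> \<le> D * (1 + x\<^sup>2)" for x
      proof -
        have "\<bar>x * h x\<bar> \<le> (1 + x\<^sup>2) * 8" unfolding abs_mult using f(2)[of "(x - \<tau>) / t"]
          by (intro mult_mono abs_le_one_plus_square) (auto simp: h_def)
        also have "\<dots> = 8 * (1 + x\<^sup>2)" by (rule mult.commute)
        also have "\<dots> \<le> D * (1 + x\<^sup>2)" using D0 by (intro mult_right_mono) auto
        finally show ?thesis .
      qed
      have b2: "\<bar>h x\<bar> \<le> D * (1 + x\<^sup>2)" for x
      proof -
        have "\<bar>h x\<bar> \<le> D * 1" using f(2)[of "(x - \<tau>) / t"] D0 by (simp add: h_def)
        also have "\<dots> \<le> D * (1 + x\<^sup>2)" using D0 one by (intro mult_left_mono) auto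
        finally show ?thesis .
      qed
      have h'8: "\<bar>h' x\<bar> \<le> 8 / t" for x using f(3)[of "(x - \<tau>) / t"] t by (simp add: h'_def divide_right_mono)
      have b3: "\<bar>h' x\<bar> \<le> D * (1 + x\<^sup>2)" for x
      proof -
        have "\<bar>h' x\<bar> \<le> D * 1" using h'8[of x] D0 by linarith
        also have "\<dots> \<le> D * (1 + x\<^sup>2)" using D0 one by (intro mult_left_mono) auto
        finally show ?thesis .
      qed
      let ?X = "mix_stat \<theta> u r"
      have stein: "\<bar>?X (\<lambda>x. x * h x) - m1 * ?X h - m2 * ?X h'\<bar> \<le> (16 / t\<^sup>2) / 2 * m3 * Z"
        unfolding m1_def m2_def m3_def Z_def by (rule mix_stat_stein[OF th r u0 taylor b1 b2 b3])
      have scale: "\<bar>a * y\<bar> \<le> \<bar>a\<bar> * D * (1 + x\<^sup>2)" if "\<bar>y\<bar> \<le> D * (1 + x\<^sup>2)" for a x y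
        using mult_left_mono[OF that, of "\<bar>a\<bar>"] by (simp add: abs_mult mult.assoc)
      have "?X (\<lambda>x. (- 1) * (x * h x) + \<tau> * h x) = ?X (\<lambda>x. (- 1) * (x * h x)) + ?X (\<lambda>x. \<tau> * h x)"
        by (rule mix_stat_add[OF th r u0 scale[OF b1] scale[OF b2]])
      also have "\<dots> = - ?X (\<lambda>x. x * h x) + \<tau> * ?X h"
        using mix_stat_cmult[OF th r u0 b1, of "-1"] mix_stat_cmult[OF th r u0 b2, of \<tau>] by simp
      finally have X1: "?X (\<lambda>x. (- 1) * (x * h x) + \<tau> * h x) = - ?X (\<lambda>x. x * h x) + \<tau> * ?X h" .
      have bb: "\<bar>(- 1) * (x * h x) + \<tau> * h x\<bar> \<le> (D + \<bar>\<tau>\<bar> * D) * (1 + x\<^sup>2)" for x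
        using scale[OF b1[of x], of "-1"] scale[OF b2[of x], of \<tau>] by (simp add: distrib_right)
      have "?X (\<lambda>x. t\<^sup>2 * h' x + ((- 1) * (x * h x) + \<tau> * h x)) = ?X (\<lambda>x. t\<^sup>2 * h' x) + ?X (\<lambda>x. (- 1) * (x * h x) + \<tau> * h x)"
        by (rule mix_stat_add[OF th r u0 scale[OF b3] bb])
      then have X2: "?X (\<lambda>x. t\<^sup>2 * h' x + ((- 1) * (x * h x) + \<tau> * h x)) = t\<^sup>2 * ?X h' - ?X (\<lambda>x. x * h x) + \<tau> * ?X h"
        using X1 mix_stat_cmult[OF th r u0 b3, of "t\<^sup>2"] by simp
      have bc: "\<bar>t\<^sup>2 * h' x + ((- 1) * (x * h x) + \<tau> * h x)\<bar> \<le> (\<bar>t\<^sup>2\<bar> * D + (D + \<bar>\<tau>\<bar> * D)) * (1 + x\<^sup>2)" for x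
        using scale[OF b3[of x], of "t\<^sup>2"] bb[of x] unfolding distrib_right[of "\<bar>t\<^sup>2\<bar> * D"] by linarith
      have "?X G = ?X (\<lambda>_. \<sigma> * c0) + ?X (\<lambda>x. \<sigma> / t * (t\<^sup>2 * h' x + ((- 1) * (x * h x) + \<tau> * h x)))"
        unfolding Gh[abs_def]
      proof (rule mix_stat_add[OF th r u0])
        show "\<bar>\<sigma> * c0\<bar> \<le> \<bar>\<sigma> * c0\<bar> * (1 + x\<^sup>2)" for x :: real by (simp add: distrib_left)
        show "\<bar>\<sigma> / t * (t\<^sup>2 * h' x + ((- 1) * (x * h x) + \<tau> * h x))\<bar> \<le> (\<bar>\<sigma> / t\<bar> * (\<bar>t\<^sup>2\<bar> * D + (D + \<bar>\<tau>\<bar> * D))) * (1 + x\<^sup>2)" for x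
          using mult_left_mono[OF bc[of x], of "\<bar>\<sigma> / t\<bar>"] by (simp only: abs_mult mult.assoc abs_ge_zero)
      qed
      also have "?X (\<lambda>x. \<sigma> / t * (t\<^sup>2 * h' x + ((- 1) * (x * h x) + \<tau> * h x))) = \<sigma> / t * (t\<^sup>2 * ?X h' - ?X (\<lambda>x. x * h x) + \<tau> * ?X h)"
        unfolding X2[symmetric] by (rule mix_stat_cmult[OF th r u0 bc])
      finally have XG: "?X G - \<sigma> * c0 * Z = 1 / s * (t\<^sup>2 * ?X h' - ?X (\<lambda>x. x * h x) + \<tau> * ?X h)"
        using mix_stat_const[OF th r, of u "\<sigma> * c0"] by (simp add: Z_def t(4))
      have Xh: "\<bar>?X h\<bar> \<le> 8 * Z"
      proof -
        have "\<bar>?X h\<bar> \<le> ?X (\<lambda>_. 8)"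
          by (rule mix_stat_abs_le[OF th r u0, of _ _ 8]) (use f(2) in \<open>auto simp: h_def\<close>)
        then show ?thesis using mix_stat_const[OF th r, of u 8] by (simp add: Z_def)
      qed
      have Xh': "\<bar>?X h'\<bar> \<le> 8 / t * Z"
      proof -
        have "\<bar>?X h'\<bar> \<le> ?X (\<lambda>_. 8 / t)"
          by (rule mix_stat_abs_le[OF th r u0, of _ _ "8 / t"]) (use h'8 t in \<open>auto simp: distrib_left\<close>)
        then show ?thesis using mix_stat_const[OF th r, of u "8 / t"] by (simp add: Z_def)
      qed
      \<comment> \<open>Taylor remainder, error of the mean and error of the variance. All are
        bounded: \<open>m3\<close> is at most a multiple of t^2, \<open>m1 - \<tau>\<close> and
        \<open>m2 - t^2\<close> are bounded, and \<open>h'\<close> carries a further factor 1 /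
        t.\<close>
      have "\<bar>t\<^sup>2 * ?X h' - ?X (\<lambda>x. x * h x) + \<tau> * ?X h\<bar> \<le>
        \<bar>?X (\<lambda>x. x * h x) - m1 * ?X h - m2 * ?X h'\<bar> + \<bar>m1 - \<tau>\<bar> * \<bar>?X h\<bar> + \<bar>m2 - t\<^sup>2\<bar> * \<bar>?X h'\<bar>"
      proof -
        have tri: "\<bar>a\<bar> \<le> \<bar>p\<bar> + \<bar>q\<bar> + \<bar>w\<bar>" if "a = - p - q - w" for a p q w :: real using that by linarith
        have "t\<^sup>2 * ?X h' - ?X (\<lambda>x. x * h x) + \<tau> * ?X h = - (?X (\<lambda>x. x * h x) - m1 * ?X h - m2 * ?X h')
          - (m1 - \<tau>) * ?X h - (m2 - t\<^sup>2) * ?X h'" by (simp add: algebra_simps)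
        from tri[OF this] show ?thesis by (simp only: abs_mult)
      qed
      also have "\<dots> \<le> (16 / t\<^sup>2) / 2 * (\<theta> * ((1 + C4) * L)) * Z + \<theta> * K1 * (8 * Z) + \<theta> * K2 * (8 / t * Z)"
      proof (intro add_mono mult_mono)
        show "\<bar>?X (\<lambda>x. x * h x) - m1 * ?X h - m2 * ?X h'\<bar> \<le> (16 / t\<^sup>2) / 2 * (\<theta> * ((1 + C4) * L)) * Z"
          by (rule order_trans[OF stein]) (use m3 Z in \<open>intro mult_right_mono mult_left_mono, auto\<close>)
        show "\<bar>m2 - t\<^sup>2\<bar> \<le> \<theta> * K2" using m2 t(3) by simp
        show "0 \<le> \<theta> * K1" "0 \<le> \<theta> * K2" using order_trans[OF abs_ge_zero m1] order_trans[OF abs_ge_zero m2] by auto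
      qed (use m1 Xh Xh' in auto)
      also have "\<dots> = (8 * (1 + C4) / V + 8 * (\<theta> * K1) + 8 * (\<theta> * K2) / t) * Z"
        unfolding t(3) using th Vp L by (simp add: field_simps)
      also have "\<dots> \<le> (8 * (1 + C4) / V + 8 * (\<theta> * K1) + 8 * (\<theta> * K2) / \<sigma>) * Z"
      proof (rule mult_right_mono[OF add_left_mono])
        show "8 * (\<theta> * K2) / t \<le> 8 * (\<theta> * K2) / \<sigma>"
          using t(2) sp order_trans[OF abs_ge_zero m2] by (intro divide_left_mono) auto
      qed (use Z in auto)
      also have "\<dots> = (K - B) * Z" using False by (simp add: K_def)
      finally have "1 / s * \<bar>t\<^sup>2 * ?X h' - ?X (\<lambda>x. x * h x) + \<tau> * ?X h\<bar> \<le> 1 / s * ((K - B) * Z)"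
        using s by (intro mult_left_mono) auto
      then have "\<bar>?X G - \<sigma> * c0 * Z\<bar> \<le> (K - B) / s * Z" unfolding XG abs_mult using s by simp
      moreover have "?X G - \<sigma> * c0 * Z = (?X G / Z - \<sigma> * c0) * Z" using Z by (simp add: field_simps)
      ultimately have "\<bar>?X G / Z - \<sigma> * c0\<bar> * Z \<le> (K - B) / s * Z" using Z by (simp only: abs_mult abs_of_pos)
      then have "\<bar>?X G / Z - \<sigma> * c0\<bar> \<le> (K - B) / s" by (rule mult_right_le_imp_le[OF _ Z])
      moreover have "\<sigma> * c0 = (\<integral>x. std_normal_density x * g (\<sigma> * x) \<partial>lborel)"
        using sp by (simp add: c0_def)
      ultimately show ?thesis by simp
    qed
    have "\<bar>lin_stat \<theta> u n G / ewens_weight \<theta> n - (\<integral>x. std_normal_density x * g (\<sigma> * x) \<partial>lborel)\<bar> \<le> B / s + (K - B) / s"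
      using close main by linarith
    also have "\<dots> = K / s" by (simp flip: add_divide_distrib)
    finally show "\<bar>lin_stat \<theta> u n (\<lambda>x. g (x / sqrt (ln (real n)) - \<theta> * sqrt (ln (real n)) * \<mu>)) / ewens_weight \<theta> n -
      (\<integral>x. std_normal_density x * g (sqrt (\<theta> * V) * x) \<partial>lborel)\<bar> \<le> K / sqrt (ln (real n))"
      by (simp add: G_def[abs_def] s_def L_def \<sigma>_def)
  qed
qed

section \<open>Equidistribution on the circle\<close>

definition circle_lipschitz :: "real \<Rightarrow> (complex \<Rightarrow> real) \<Rightarrow> bool" where
  "circle_lipschitz \<Lambda> G \<longleftrightarrow> (\<forall>z\<in>sphere 0 1. \<forall>w\<in>sphere 0 1. \<bar>G z - G w\<bar> \<le> \<Lambda> * cmod (z - w))"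

abbreviation circle_integral :: "(complex \<Rightarrow> 'a) \<Rightarrow> 'a::{banach, second_countable_topology}" where
  "circle_integral G \<equiv> (LINT s:{0..1}|lborel. G (cis (2 * pi * s)))"

section \<open>Roots of unity and rational approximation\<close>

lemma cis_diff_le: "cmod (cis a - cis b) \<le> \<bar>a - b\<bar>"
proof -
  have "cis a - cis b = cis b * (exp (\<i> * of_real (a - b)) - 1)"
  proof -
    have "cis b * exp (\<i> * of_real (a - b)) = cis a" unfolding cis_conv_exp[symmetric] cis_mult by simp
    then show ?thesis by (simp only: right_diff_distrib mult_1_right)
  qed
  then have "cmod (cis a - cis b) = 2 * \<bar>sin ((a - b) / 2)\<bar>" by (simp only: norm_mult norm_cis dist_exp_i_1)
  then show ?thesis using abs_sin_x_le_abs_x[of "(a - b) / 2"] by simp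
qed

lemma circle_lipschitz_continuous:
  assumes "circle_lipschitz \<Lambda> G" "\<Lambda> \<ge> 0" and w: "w \<in> sphere 0 1"
  shows "continuous_on UNIV (\<lambda>s. G (cis (2 * pi * s) * w))"
proof (rule lipschitz_on_continuous_on)
  show "(\<Lambda> * (2 * pi))-lipschitz_on UNIV (\<lambda>s. G (cis (2 * pi * s) * w))"
  proof (rule lipschitz_onI)
    fix a b :: real
    have "\<bar>G (cis (2 * pi * a) * w) - G (cis (2 * pi * b) * w)\<bar> \<le> \<Lambda> * cmod (cis (2 * pi * a) * w - cis (2 * pi * b) * w)"
      using assms unfolding circle_lipschitz_def by (auto simp: norm_mult)
    also have "\<dots> = \<Lambda> * cmod (cis (2 * pi * a) - cis (2 * pi * b))"
      using w by (simp add: norm_mult flip: left_diff_distrib)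
    also have "\<dots> \<le> \<Lambda> * \<bar>2 * pi * a - 2 * pi * b\<bar>" using assms by (intro mult_left_mono cis_diff_le)
    also have "\<dots> = \<Lambda> * (2 * pi) * \<bar>a - b\<bar>" by (simp add: abs_mult flip: right_diff_distrib)
    finally show "dist (G (cis (2 * pi * a) * w)) (G (cis (2 * pi * b) * w)) \<le> \<Lambda> * (2 * pi) * dist a b"
      by (simp add: dist_real_def)
  qed (use assms in simp)
qed

lemma integral_shift_periodic:
  fixes F :: "real \<Rightarrow> real"
  assumes cont: "continuous_on UNIV F" and per: "\<And>s. F (s + 1) = F s" and c: "0 \<le> c" "c \<le> 1"
  shows "integral {0..1} (\<lambda>s. F (s + c)) = integral {0..1} F"
proof -
  have I: "F integrable_on {a..b}" for a b by (intro integrable_continuous_real continuous_on_subset[OF cont]) auto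
  have "integral {0..1} (\<lambda>s. F (s + c)) = integral {c..1 + c} F"
    using integral_shift_Icc_real[of 0 1 F c] by (simp add: o_def add.commute)
  also have "\<dots> = integral {c..1} F + integral {1..1 + c} F"
    using c by (intro Henstock_Kurzweil_Integration.integral_combine[symmetric] I) auto
  also have "integral {1..1 + c} F = integral {0..c} (\<lambda>s. F (s + 1))"
    using integral_shift_Icc_real[of 0 c F 1] by (simp add: o_def add.commute)
  also have "\<dots> = integral {0..c} F" by (simp add: per)
  also have "integral {c..1} F + integral {0..c} F = integral {0..1} F"
    using Henstock_Kurzweil_Integration.integral_combine[of 0 c 1 F] c I by simp
  finally show ?thesis .
qed

lemma cis_plus_period: "cis (2 * pi * (s + 1)) = cis (2 * pi * s)"
  by (simp add: distrib_left flip: cis_mult)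

text \<open>As a function of \<open>w\<close> the sum is invariant under rotation by q-th roots of
  unity. Up to such a rotation any two points of the circle are within 2 pi / q of each other, so
  the sum of q terms varies by at most 2 pi \<Lambda>; its mean over the circle is q times the
  integral.\<close>

lemma sum_roots_unity_integral:
  fixes G :: "complex \<Rightarrow> real"
  assumes G: "circle_lipschitz \<Lambda> G" and L: "\<Lambda> \<ge> 0" and q: "q > 0" and w: "w \<in> sphere 0 1"
  shows "\<bar>(\<Sum>\<zeta>\<in>{z. z ^ q = 1}. G (w * \<zeta>)) - real q * integral {0..1} (\<lambda>s. G (cis (2 * pi * s)))\<bar> \<le> 2 * pi * \<Lambda>"
proof -
  let ?R = "{z::complex. z ^ q = 1}"
  have bij: "bij_betw (\<lambda>k. cis (2 * pi * real k / real q)) {..<q} ?R"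
    using q by (rule Complex.bij_betw_roots_unity)
  have fin: "finite ?R" using bij bij_betw_finite by blast
  have card: "card ?R = q" using q by (rule Complex.card_roots_unity_eq)
  have Rn: "cmod z = 1" if "z \<in> ?R" for z using that q power_eq_1_iff[of z q] by auto
  have lip: "\<bar>G a - G b\<bar> \<le> \<Lambda> * cmod (a - b)" if "cmod a = 1" "cmod b = 1" for a b
    using G that by (simp add: circle_lipschitz_def)
  define \<Psi> where "\<Psi> v = (\<Sum>\<zeta>\<in>?R. G (v * \<zeta>))" for v
  have rot: "\<Psi> (v * \<xi>) = \<Psi> v" if x: "\<xi> \<in> ?R" for v \<xi>
  proof -
    have x0: "\<xi> \<noteq> 0" using x q by (auto simp: power_0_left)
    have "bij_betw (\<lambda>\<zeta>. \<xi> * \<zeta>) ?R ?R"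
      by (rule bij_betw_byWitness[where f'="\<lambda>\<zeta>. \<zeta> / \<xi>"]) (use x x0 in \<open>auto simp: power_mult_distrib power_divide\<close>)
    from sum.reindex_bij_betw[OF this, of "\<lambda>\<zeta>. G (v * \<zeta>)"] show ?thesis by (simp add: \<Psi>_def mult.assoc)
  qed
  obtain a where a: "w = cis (2 * pi * a)"
  proof -
    have "w \<noteq> 0" using w by auto
    then have "w = cis (2 * pi * (Arg w / (2 * pi)))" using cis_Arg[of w] w by (simp add: sgn_eq)
    then show ?thesis using that by blast
  qed
  have near: "\<bar>\<Psi> w - \<Psi> (cis (2 * pi * s))\<bar> \<le> 2 * pi * \<Lambda>" for s
  proof -
    \<comment> \<open>Rotating by \<open>k\<close> steps of size 1 / q brings the angle
      \<open>a\<close> to within 1 / q of \<open>s\<close>.\<close>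
    define k where "k = \<lfloor>(s - a) * real q\<rfloor>"
    define \<xi> where "\<xi> = cis (2 * pi * (of_int k / real q))"
    have "\<xi> ^ q = cis (2 * pi * of_int k)" using q by (simp add: \<xi>_def Complex.DeMoivre)
    also have "\<dots> = 1" by (rule cis_multiple_2pi) simp
    finally have x: "\<xi> \<in> ?R" by simp
    have kb: "of_int k \<le> (s - a) * real q" "(s - a) * real q \<le> of_int k + 1" unfolding k_def by linarith+
    have "\<bar>(a + of_int k / real q) - s\<bar> * real q = \<bar>of_int k - (s - a) * real q\<bar>"
    proof -
      have "((a + of_int k / real q) - s) * real q = of_int k - (s - a) * real q" using q by (simp add: algebra_simps)
      then show ?thesis by (metis abs_mult abs_of_nat)
    qed
    also have "\<dots> \<le> 1" using kb by simp
    finally have "\<bar>(a + of_int k / real q) - s\<bar> \<le> 1 / real q" using q by (simp add: pos_le_divide_eq)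
    then have d: "\<bar>2 * pi * (a + of_int k / real q) - 2 * pi * s\<bar> \<le> 2 * pi / real q"
      using mult_left_mono[of _ "1 / real q" "2 * pi"] by (simp add: abs_mult flip: right_diff_distrib)
    have wx: "w * \<xi> = cis (2 * pi * (a + of_int k / real q))" by (simp add: a \<xi>_def cis_mult distrib_left)
    have "\<bar>\<Psi> (w * \<xi>) - \<Psi> (cis (2 * pi * s))\<bar> \<le> (\<Sum>\<zeta>\<in>?R. \<bar>G (w * \<xi> * \<zeta>) - G (cis (2 * pi * s) * \<zeta>)\<bar>)"
      unfolding \<Psi>_def sum_subtractf[symmetric] by (rule sum_abs)
    also have "\<dots> \<le> (\<Sum>\<zeta>\<in>?R. \<Lambda> * (2 * pi / real q))"
    proof (rule sum_mono)
      fix \<zeta> assume z: "\<zeta> \<in> ?R"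
      have "\<bar>G (w * \<xi> * \<zeta>) - G (cis (2 * pi * s) * \<zeta>)\<bar> \<le> \<Lambda> * cmod (w * \<xi> * \<zeta> - cis (2 * pi * s) * \<zeta>)"
        using Rn[OF z] Rn[OF x] w by (intro lip) (auto simp: norm_mult)
      also have "cmod (w * \<xi> * \<zeta> - cis (2 * pi * s) * \<zeta>) = cmod (w * \<xi> - cis (2 * pi * s))"
        using Rn[OF z] by (simp add: norm_mult flip: left_diff_distrib)
      also have "\<dots> \<le> 2 * pi / real q" unfolding wx by (rule order_trans[OF cis_diff_le d])
      finally show "\<bar>G (w * \<xi> * \<zeta>) - G (cis (2 * pi * s) * \<zeta>)\<bar> \<le> \<Lambda> * (2 * pi / real q)"
        using L by (meson mult_left_mono order_trans)
    qed
    also have "\<dots> = 2 * pi * \<Lambda>" using card q by simp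
    finally show ?thesis by (simp only: rot[OF x])
  qed
  have contz: "continuous_on UNIV (\<lambda>s. G (cis (2 * pi * s) * \<zeta>))" if "\<zeta> \<in> ?R" for \<zeta>
    using circle_lipschitz_continuous[OF G L] Rn[OF that] by simp
  have cont\<Psi>: "continuous_on UNIV (\<lambda>s. \<Psi> (cis (2 * pi * s)))"
    unfolding \<Psi>_def by (intro continuous_on_sum contz)
  have "integral {0..1} (\<lambda>s. \<Psi> (cis (2 * pi * s))) = (\<Sum>\<zeta>\<in>?R. integral {0..1} (\<lambda>s. G (cis (2 * pi * s) * \<zeta>)))"
    unfolding \<Psi>_def using fin
    by (intro integral_sum integrable_continuous_real continuous_on_subset[OF contz]) auto
  also have "\<dots> = (\<Sum>\<zeta>\<in>?R. integral {0..1} (\<lambda>s. G (cis (2 * pi * s))))"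
  proof (rule sum.cong[OF refl])
    fix \<zeta> assume z: "\<zeta> \<in> ?R"
    then obtain k where k: "k < q" "\<zeta> = cis (2 * pi * real k / real q)"
      using bij by (auto simp: bij_betw_def)
    have e: "cis (2 * pi * s) * \<zeta> = cis (2 * pi * (s + real k / real q))" for s by (simp add: k cis_mult distrib_left)
    have "continuous_on UNIV (\<lambda>s. G (cis (2 * pi * s)))" using circle_lipschitz_continuous[OF G L, of 1] by simp
    then show "integral {0..1} (\<lambda>s. G (cis (2 * pi * s) * \<zeta>)) = integral {0..1} (\<lambda>s. G (cis (2 * pi * s)))"
      unfolding e using k by (intro integral_shift_periodic) (auto simp: cis_plus_period)
  qed
  also have "\<dots> = real q * integral {0..1} (\<lambda>s. G (cis (2 * pi * s)))" using card by simp
  finally have I: "integral {0..1} (\<lambda>s. \<Psi> (cis (2 * pi * s))) = real q * integral {0..1} (\<lambda>s. G (cis (2 * pi * s)))" .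
  have "norm (integral {0..1} (\<lambda>s. \<Psi> w - \<Psi> (cis (2 * pi * s)))) \<le> 2 * pi * \<Lambda> * (1 - 0)"
    using near by (intro integral_bound continuous_intros continuous_on_subset[OF cont\<Psi>]) auto
  moreover have "integral {0..1} (\<lambda>s. \<Psi> w - \<Psi> (cis (2 * pi * s))) = \<Psi> w - real q * integral {0..1} (\<lambda>s. G (cis (2 * pi * s)))"
    unfolding I[symmetric]
    by (subst integral_diff) (auto intro!: integrable_continuous_real continuous_on_subset[OF cont\<Psi>])
  ultimately show ?thesis by (simp add: \<Psi>_def)
qed

text \<open>Coprimality makes multiplication by \<open>h\<close> injective modulo \<open>k\<close>;
  as there are just \<open>k\<close> roots of unity, surjectivity follows by counting.\<close>

lemma roots_unity_coprime_reindex: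
  fixes F :: "complex \<Rightarrow> real" and h k :: int
  assumes cop: "coprime h k" and k: "k > 0"
  shows "(\<Sum>j<nat k. F (cis (2 * pi * (real j * of_int h / of_int k)))) = (\<Sum>\<zeta>\<in>{z. z ^ nat k = 1}. F \<zeta>)"
proof (rule sum.reindex_bij_betw)
  let ?f = "\<lambda>j. cis (2 * pi * (real j * of_int h / of_int k))" and ?R = "{z::complex. z ^ nat k = 1}"
  have inj: "inj_on ?f {..<nat k}"
  proof (rule inj_onI)
    fix i j assume ij: "i \<in> {..<nat k}" "j \<in> {..<nat k}" and eq: "?f i = ?f j"
    have "cis (2 * pi * (real i * of_int h / of_int k) - 2 * pi * (real j * of_int h / of_int k)) = 1"
      using eq by (simp flip: cis_divide)
    then obtain n where "2 * pi * (real i * of_int h / of_int k) - 2 * pi * (real j * of_int h / of_int k) = of_int n * (2 * pi)"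
      unfolding cis_eq_1_iff by blast
    then have "2 * pi * ((real i - real j) * of_int h / of_int k) = 2 * pi * of_int n" by (simp add: algebra_simps diff_divide_distrib)
    from this[unfolded mult_cancel_left] have "(real i - real j) * of_int h / of_int k = of_int n" by simp
    then have "(real i - real j) * of_int h = of_int n * of_int k" using k by (simp add: field_simps)
    then have "of_int ((int i - int j) * h) = (of_int (n * k) :: real)" by simp
    then have "(int i - int j) * h = n * k" by (simp only: of_int_eq_iff)
    then have "k dvd (int i - int j) * h" by simp
    then have "k dvd int i - int j" using cop by (simp add: coprime_commute coprime_dvd_mult_left_iff)
    moreover have "\<bar>int i - int j\<bar> < k" using ij by (auto simp: zless_nat_eq_int_zless)
    ultimately have "int i - int j = 0" using dvd_imp_le_int[of "int i - int j" k] k by linarith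
    then show "i = j" by simp
  qed
  have sub: "?f ` {..<nat k} \<subseteq> ?R"
  proof
    fix z assume "z \<in> ?f ` {..<nat k}"
    then obtain j where z: "z = ?f j" by blast
    have "z ^ nat k = cis (real (nat k) * (2 * pi * (real j * of_int h / of_int k)))" unfolding z by (rule Complex.DeMoivre)
    also have "real (nat k) * (2 * pi * (real j * of_int h / of_int k)) = 2 * pi * of_int (int j * h)" using k by simp
    also have "cis \<dots> = 1" by (rule cis_multiple_2pi) simp
    finally show "z \<in> ?R" by simp
  qed
  have "card ?R = nat k" using k by (intro Complex.card_roots_unity_eq) simp
  moreover have "finite ?R" using k finite_roots_unity[of "nat k"] by (simp add: Suc_le_eq)
  ultimately have "?f ` {..<nat k} = ?R" using sub card_image[OF inj] by (intro card_subset_eq) auto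
  then show "bij_betw ?f {..<nat k} ?R" using inj by (simp add: bij_betw_def)
qed

text \<open>
  Along a block of length \<open>k\<close> the points \<open>v x\<^sup>j\<close> stay close to \<open>v\<close> times the \<open>k\<close>-th roots of unity,
  because \<open>j \<bar>t - h / k\<bar> \<le> 1 / k\<close>.
\<close>

lemma block_equidistribution:
  fixes G :: "complex \<Rightarrow> real" and h k :: int
  assumes G: "circle_lipschitz \<Lambda> G" and L: "\<Lambda> \<ge> 0" and cop: "coprime h k" and k: "k > 0"
    and approx: "\<bar>of_int k * t - of_int h\<bar> \<le> 1 / of_int k" and v: "v \<in> sphere 0 1"
  shows "\<bar>(\<Sum>j<nat k. G (v * cis (2 * pi * t) ^ j)) - of_int k * integral {0..1} (\<lambda>s. G (cis (2 * pi * s)))\<bar> \<le> 4 * pi * \<Lambda>"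
proof -
  have "\<bar>(\<Sum>j<nat k. G (v * cis (2 * pi * t) ^ j)) - (\<Sum>j<nat k. G (v * cis (2 * pi * (real j * of_int h / of_int k))))\<bar>
      \<le> (\<Sum>j<nat k. \<bar>G (v * cis (2 * pi * t) ^ j) - G (v * cis (2 * pi * (real j * of_int h / of_int k)))\<bar>)"
    unfolding sum_subtractf[symmetric] by (rule sum_abs)
  also have "\<dots> \<le> (\<Sum>j<nat k. \<Lambda> * (2 * pi / of_int k))"
  proof (rule sum_mono)
    fix j assume j: "j \<in> {..<nat k}"
    have "\<bar>G (v * cis (2 * pi * t) ^ j) - G (v * cis (2 * pi * (real j * of_int h / of_int k)))\<bar> \<le>
      \<Lambda> * cmod (v * cis (2 * pi * t) ^ j - v * cis (2 * pi * (real j * of_int h / of_int k)))"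
      using G v by (simp add: circle_lipschitz_def norm_mult norm_power)
    also have "cmod (v * cis (2 * pi * t) ^ j - v * cis (2 * pi * (real j * of_int h / of_int k))) =
      cmod (cis (real j * (2 * pi * t)) - cis (2 * pi * (real j * of_int h / of_int k)))"
      using v by (simp add: Complex.DeMoivre norm_mult flip: right_diff_distrib)
    also have "\<dots> \<le> \<bar>real j * (2 * pi * t) - 2 * pi * (real j * of_int h / of_int k)\<bar>" by (rule cis_diff_le)
    also have "real j * (2 * pi * t) - 2 * pi * (real j * of_int h / of_int k) = 2 * pi * (real j / of_int k) * (of_int k * t - of_int h)"
      using k by (simp add: field_simps)
    also have "\<bar>\<dots>\<bar> = 2 * pi * (real j / of_int k) * \<bar>of_int k * t - of_int h\<bar>" using k by (simp add: abs_mult)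
    also have "\<dots> \<le> 2 * pi * 1 * (1 / of_int k)"
      using j k approx by (intro mult_mono) (auto simp: divide_le_eq zless_nat_eq_int_zless)
    finally show "\<bar>G (v * cis (2 * pi * t) ^ j) - G (v * cis (2 * pi * (real j * of_int h / of_int k)))\<bar> \<le> \<Lambda> * (2 * pi / of_int k)"
      using L by (simp add: mult_left_mono)
  qed
  also have "\<dots> = 2 * pi * \<Lambda>" using k by simp
  finally have A: "\<bar>(\<Sum>j<nat k. G (v * cis (2 * pi * t) ^ j)) - (\<Sum>j<nat k. G (v * cis (2 * pi * (real j * of_int h / of_int k))))\<bar> \<le> 2 * pi * \<Lambda>" .
  have "(\<Sum>j<nat k. G (v * cis (2 * pi * (real j * of_int h / of_int k)))) = (\<Sum>\<zeta>\<in>{z. z ^ nat k = 1}. G (v * \<zeta>))"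
    by (rule roots_unity_coprime_reindex[OF cop k])
  moreover have "\<bar>(\<Sum>\<zeta>\<in>{z. z ^ nat k = 1}. G (v * \<zeta>)) - of_int k * integral {0..1} (\<lambda>s. G (cis (2 * pi * s)))\<bar> \<le> 2 * pi * \<Lambda>"
    using sum_roots_unity_integral[OF G L _ v, of "nat k"] k by simp
  ultimately show ?thesis using A by linarith
qed

text \<open>The complete blocks of length \<open>k\<close> cost 4 pi \<Lambda> each, wherever they
  start; the last incomplete block is estimated trivially by 2 \<Lambda> per term.\<close>

lemma partial_sum_equidistribution:
  fixes G :: "complex \<Rightarrow> real" and h k :: int
  assumes G: "circle_lipschitz \<Lambda> G" and bd: "\<And>z. z \<in> sphere 0 1 \<Longrightarrow> \<bar>G z\<bar> \<le> \<Lambda>" and cop: "coprime h k" and k: "k > 0"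
    and approx: "\<bar>of_int k * t - of_int h\<bar> \<le> 1 / of_int k"
  shows "\<bar>(\<Sum>m=1..N. G (cis (2 * pi * t) ^ m)) - real N * integral {0..1} (\<lambda>s. G (cis (2 * pi * s)))\<bar>
    \<le> 4 * pi * \<Lambda> * (real N / of_int k) + 2 * \<Lambda> * of_int k"
proof -
  let ?x = "cis (2 * pi * t)"
  define I where "I = integral {0..1} (\<lambda>s. G (cis (2 * pi * s)))"
  define q where "q = nat k"
  have q: "q > 0" "real q = of_int k" using k by (auto simp: q_def)
  have L: "\<Lambda> \<ge> 0" using bd[of 1] by simp
  have cont: "continuous_on UNIV (\<lambda>s. G (cis (2 * pi * s)))" using circle_lipschitz_continuous[OF G L, of 1] by simp
  have Ib: "\<bar>I\<bar> \<le> \<Lambda>"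
    using integral_bound[of 0 1 "\<lambda>s. G (cis (2 * pi * s))" \<Lambda>] bd continuous_on_subset[OF cont] by (simp add: I_def)
  define D where "D n = (\<Sum>m<n. G (?x ^ Suc m) - I)" for n
  have add: "D (n + n') - D n = (\<Sum>j<n'. G (?x ^ Suc n * ?x ^ j) - I)" for n n'
    by (induction n') (simp_all add: D_def power_add mult_ac)
  have blocks: "\<bar>D (M * q)\<bar> \<le> 4 * pi * \<Lambda> * real M" for M
  proof (induction M)
    case (Suc M)
    have "D (M * q + q) - D (M * q) = (\<Sum>j<q. G (?x ^ Suc (M * q) * ?x ^ j)) - of_int k * I"
      unfolding add using q by (simp add: sum_subtractf)
    also have "\<bar>\<dots>\<bar> \<le> 4 * pi * \<Lambda>"
      unfolding q_def I_def by (rule block_equidistribution[OF G L cop k approx]) (simp add: norm_power norm_mult)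
    finally have "\<bar>D (M * q + q) - D (M * q)\<bar> \<le> 4 * pi * \<Lambda>" .
    then show ?case using Suc by (simp add: add.commute algebra_simps)
  qed (simp add: D_def)
  define M where "M = N div q"
  define R where "R = N mod q"
  have N: "N = M * q + R" "R < q" using q by (simp_all add: M_def R_def)
  have "\<bar>D N - D (M * q)\<bar> \<le> (\<Sum>j<R. \<bar>G (?x ^ Suc (M * q) * ?x ^ j) - I\<bar>)" unfolding N(1) add by (rule sum_abs)
  also have "\<dots> \<le> (\<Sum>j<R. 2 * \<Lambda>)"
  proof (rule sum_mono)
    fix j
    have "\<bar>G (?x ^ Suc (M * q) * ?x ^ j)\<bar> \<le> \<Lambda>" by (rule bd) (simp add: norm_power norm_mult)
    then show "\<bar>G (?x ^ Suc (M * q) * ?x ^ j) - I\<bar> \<le> 2 * \<Lambda>" using Ib by linarith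
  qed
  also have "\<dots> \<le> 2 * \<Lambda> * of_int k" using N(2) L q(2)[symmetric] by (simp add: mult_mono mult.commute)
  finally have "\<bar>D N\<bar> \<le> 4 * pi * \<Lambda> * real M + 2 * \<Lambda> * of_int k" using blocks[of M] by linarith
  also have "real M \<le> real N / of_int k" unfolding M_def q(2)[symmetric] by (rule of_nat_div_le_of_nat)
  also have "D N = (\<Sum>m=1..N. G (?x ^ m)) - real N * I"
    using sum.shift_bounds_Suc_ivl[of "\<lambda>m. G (?x ^ m)" 0 N]
    by (simp add: D_def sum_subtractf atLeastLessThanSuc_atLeastAtMost lessThan_atLeast0)
  finally show ?thesis using L by (simp add: I_def mult_left_mono)
qed

lemma unit_norm_frac_le: "unit_norm (frac y) \<le> \<bar>y - of_int h\<bar>"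
proof (cases "h \<le> \<lfloor>y\<rfloor>")
  case True
  then have "of_int h \<le> (of_int \<lfloor>y\<rfloor> :: real)" by simp
  then show ?thesis unfolding unit_norm_def frac_def by linarith
next
  case False
  then have "of_int \<lfloor>y\<rfloor> + 1 \<le> (of_int h :: real)" by (metis of_int_add of_int_1 of_int_le_iff not_le zless_imp_add1_zle)
  then show ?thesis unfolding unit_norm_def frac_def by linarith
qed

text \<open>Dirichlet's theorem with Q about sqrt N supplies a denominator k \<le> Q, and finite
  type excludes small ones, since K / k^\<gamma> < 1 / Q. So \<open>k\<close> lies between two
  powers of N, and both error terms N / k and k save a power. The bound is linear in \<Lambda> with
  \<delta> and C independent of G, because \<Lambda> will later grow with N.\<close>

lemma lipschitz_equidistribution:
  fixes t K \<gamma> :: real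
  assumes K: "K > 0" and gam: "\<gamma> > 0"
    and dio: "\<And>m::int. m \<noteq> 0 \<Longrightarrow> unit_norm (frac (of_int m * t)) > K / \<bar>of_int m\<bar> powr \<gamma>"
  obtains \<delta> C where "0 < \<delta>" "\<delta> < 1" "C \<ge> 0"
    "\<And>G \<Lambda> N. circle_lipschitz \<Lambda> G \<Longrightarrow> (\<And>z. z \<in> sphere 0 1 \<Longrightarrow> \<bar>G z\<bar> \<le> \<Lambda>) \<Longrightarrow>
      \<bar>(\<Sum>m=1..N. G (cis (2 * pi * t) ^ m)) - real N * circle_integral G\<bar> \<le> C * \<Lambda> * real N powr (1 - \<delta>)"
proof -
  \<comment> \<open>The term N / k has exponent 1 - 1 / (2 \<gamma>), the term k has exponent 1 /
    2.\<close>
  define \<delta> where "\<delta> = min (1 / (2 * \<gamma>)) (1 / 2)"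
  have d: "0 < \<delta>" "\<delta> < 1" "\<delta> \<le> 1 / (2 * \<gamma>)" "\<delta> \<le> 1 / 2" using gam by (auto simp: \<delta>_def)
  define C where "C = 4 * pi * inverse (K powr (1 / \<gamma>)) + 4"
  show ?thesis
  proof (rule that[of \<delta> C])
    show "C \<ge> 0" by (simp add: C_def)
    fix G \<Lambda> N
    assume G: "circle_lipschitz \<Lambda> G" and bd: "\<And>z. z \<in> sphere 0 1 \<Longrightarrow> \<bar>G z\<bar> \<le> \<Lambda>"
    have L: "\<Lambda> \<ge> 0" using bd[of 1] by simp
    have cont: "continuous_on UNIV (\<lambda>s. G (cis (2 * pi * s)))" using circle_lipschitz_continuous[OF G L, of 1] by simp
    have ci: "circle_integral G = integral {0..1} (\<lambda>s. G (cis (2 * pi * s)))"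
      by (intro set_borel_integral_eq_integral borel_integrable_atLeastAtMost' continuous_on_subset[OF cont]) auto
    show "\<bar>(\<Sum>m=1..N. G (cis (2 * pi * t) ^ m)) - real N * circle_integral G\<bar> \<le> C * \<Lambda> * real N powr (1 - \<delta>)"
    proof (cases "N = 0")
      case False
      then have N: "real N \<ge> 1" by simp
      define Q where "Q = nat \<lceil>sqrt (real N)\<rceil>"
      have s1: "sqrt (real N) \<ge> 1" using N by simp
      have Q: "real Q \<ge> sqrt (real N)" "real Q \<le> 2 * sqrt (real N)" "Q > 0"
        using s1 unfolding Q_def by linarith+
      obtain h k where hk: "coprime h k" "0 < k" "k \<le> int Q" "\<bar>of_int k * t - of_int h\<bar> < 1 / real Q"
        using Dirichlet_approx_coprime[of Q t] Q by auto
      have kr: "0 < (of_int k :: real)" "of_int k \<le> real Q" using hk by (auto simp: of_int_le_iff[symmetric] simp del: of_int_le_iff)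
      have approx: "\<bar>of_int k * t - of_int h\<bar> \<le> 1 / of_int k"
        using hk(4) kr Q by (intro order_trans[OF less_imp_le[OF hk(4)]] divide_left_mono) auto
      have "k \<noteq> 0" using hk by simp
      from dio[OF this] have "K / \<bar>of_int k\<bar> powr \<gamma> < 1 / real Q"
        using unit_norm_frac_le[of "of_int k * t" h] hk(4) by linarith
      then have "K / of_int k powr \<gamma> < 1 / real Q" using kr by simp
      then have "K * real Q \<le> of_int k powr \<gamma>" using kr Q by (simp add: field_simps)
      then have "K * sqrt (real N) \<le> of_int k powr \<gamma>" using Q(1) K by (meson mult_left_mono less_imp_le order_trans)
      then have "(K * sqrt (real N)) powr (1 / \<gamma>) \<le> (of_int k powr \<gamma>) powr (1 / \<gamma>)" using K gam by (intro powr_mono2) auto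
      also have "\<dots> = of_int k" using kr gam by (simp add: powr_powr)
      also have "(K * sqrt (real N)) powr (1 / \<gamma>) = K powr (1 / \<gamma>) * real N powr (1 / (2 * \<gamma>))"
      proof -
        have "sqrt (real N) = real N powr (1 / 2)" by (simp add: powr_half_sqrt)
        then show ?thesis using K by (simp add: powr_mult powr_powr)
      qed
      finally have kl: "K powr (1 / \<gamma>) * real N powr (1 / (2 * \<gamma>)) \<le> of_int k" .
      have "real N / of_int k \<le> real N / (K powr (1 / \<gamma>) * real N powr (1 / (2 * \<gamma>)))"
        using kl K N kr by (intro divide_left_mono) auto
      also have "\<dots> = inverse (K powr (1 / \<gamma>)) * real N powr (1 - 1 / (2 * \<gamma>))"
      proof -
        have "real N powr (1 - e) = real N * inverse (real N powr e)" for e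
          using N by (simp add: powr_diff divide_inverse)
        then show ?thesis by (simp only: divide_inverse inverse_mult_distrib mult_ac)
      qed
      also have "\<dots> \<le> inverse (K powr (1 / \<gamma>)) * real N powr (1 - \<delta>)"
        using N d by (intro mult_left_mono powr_mono) auto
      finally have e1: "real N / of_int k \<le> inverse (K powr (1 / \<gamma>)) * real N powr (1 - \<delta>)" .
      have "of_int k \<le> 2 * real N powr (1 / 2)" using kr(2) Q(2) by (simp add: powr_half_sqrt)
      also have "\<dots> \<le> 2 * real N powr (1 - \<delta>)" using N d by (intro mult_left_mono powr_mono) auto
      finally have e2: "of_int k \<le> 2 * real N powr (1 - \<delta>)" .
      have "\<bar>(\<Sum>m=1..N. G (cis (2 * pi * t) ^ m)) - real N * circle_integral G\<bar> \<le> 4 * pi * \<Lambda> * (real N / of_int k) + 2 * \<Lambda> * of_int k"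
        unfolding ci by (rule partial_sum_equidistribution[OF G bd hk(1,2) approx])
      also have "\<dots> \<le> 4 * pi * \<Lambda> * (inverse (K powr (1 / \<gamma>)) * real N powr (1 - \<delta>)) + 2 * \<Lambda> * (2 * real N powr (1 - \<delta>))"
        using e1 e2 L by (intro add_mono mult_left_mono) auto
      also have "\<dots> = C * \<Lambda> * real N powr (1 - \<delta>)" by (simp add: C_def algebra_simps)
      finally show ?thesis .
    qed simp
  qed (use d in auto)
qed

section \<open>Integrability near finitely many points of the circle\<close>

text \<open>A weak form of Jordan's inequality: up to pi / 6 the difference increases, and beyond it
  the sine is at least 1 / 2 while y / 4 stays below 1 / 2.\<close>

lemma sin_ge_quarter:
  assumes "0 \<le> y" "y \<le> pi / 2"
  shows "y / 4 \<le> sin y"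
proof (cases "y \<le> pi / 6")
  case True
  have "(\<lambda>y. sin y - y / 4) 0 \<le> (\<lambda>y. sin y - y / 4) y"
  proof (rule DERIV_nonneg_imp_nondecreasing[OF assms(1)])
    fix x assume x: "0 \<le> x" "x \<le> y"
    have "cos (pi / 3) \<le> cos x" using x True by (intro cos_monotone_0_pi_le) auto
    then have "0 \<le> cos x - 1 / 4" by (simp add: cos_60)
    moreover have "((\<lambda>y. sin y - y / 4) has_real_derivative cos x - 1 / 4) (at x)"
      by (auto intro!: derivative_eq_intros)
    ultimately show "\<exists>d. ((\<lambda>y. sin y - y / 4) has_real_derivative d) (at x) \<and> 0 \<le> d" by blast
  qed
  then show ?thesis by simp
next
  case False
  have "sin (pi / 6) \<le> sin y" using False assms by (intro sin_monotone_2pi_le) auto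
  moreover have "y / 4 \<le> 1 / 2" using assms pi_less_4 by simp
  ultimately show ?thesis by (simp add: sin_30)
qed

lemma circle_dist_ge:
  assumes "0 \<le> s" "s \<le> 1"
  shows "min s (1 - s) \<le> cmod (cis (2 * pi * s) - 1)"
proof -
  have e: "cmod (cis (2 * pi * s) - 1) = 2 * \<bar>sin (pi * s)\<bar>"
    using dist_exp_i_1[of "2 * pi * s"] by (simp add: cis_conv_exp)
  have half: "y \<le> 2 * sin (pi * y)" if "0 \<le> y" "y \<le> 1 / 2" for y
  proof -
    have "2 * y \<le> pi * y" using that pi_ge_two by (intro mult_right_mono) auto
    moreover have "pi * y / 4 \<le> sin (pi * y)" using that by (intro sin_ge_quarter) auto
    ultimately show ?thesis by linarith
  qed
  have s0: "sin (pi * s) \<ge> 0" using assms by (intro sin_ge_zero) (auto simp: mult_left_le)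
  show ?thesis
  proof (cases "s \<le> 1 / 2")
    case True
    then show ?thesis using half[of s] assms e s0 by simp
  next
    case False
    have "sin (pi * (1 - s)) = sin (pi * s)" by (simp add: right_diff_distrib)
    then show ?thesis using half[of "1 - s"] False assms e s0 by simp
  qed
qed

lemma cis_frac: "cis (2 * pi * s) = cis (2 * pi * frac s)"
proof -
  have "cis (2 * pi * s) = cis (2 * pi * frac s) * cis (2 * pi * of_int \<lfloor>s\<rfloor>)"
    by (simp add: cis_mult frac_def algebra_simps)
  also have "cis (2 * pi * of_int \<lfloor>s\<rfloor>) = 1" by (rule cis_multiple_2pi) simp
  finally show ?thesis by simp
qed

lemma unit_norm_le_dist: "unit_norm (frac s) \<le> cmod (cis (2 * pi * s) - 1)"
  unfolding cis_frac[of s] unit_norm_def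
  by (rule circle_dist_ge) (auto intro: less_imp_le frac_lt_1)

text \<open>The range of \<open>c\<close> includes the representatives a - 1 and a + 1 of an angle a
  in [0, 1].\<close>

lemma inverse_sqrt_integrable:
  "set_integrable lborel {0..1} (\<lambda>s. \<bar>s - c\<bar> powr (- 1 / 2))" if c: "- 1 \<le> c" "c \<le> 2" for c :: real
proof -
  let ?f = "\<lambda>x::real. \<bar>x\<bar> powr (- 1 / 2)"
  have P: "?f integrable_on {0..3}"
  proof (rule integrable_spike[OF _ negligible_empty])
    show "(\<lambda>x::real. x powr (- 1 / 2)) integrable_on {0..3}"
      using has_integral_powr_from_0[of "- 1 / 2" 3] by (auto simp: integrable_on_def)
  qed auto
  have N: "?f integrable_on {-3..0}"
    using Henstock_Kurzweil_Integration.integrable_reflect_real[where f="?f" and a=0 and b=3] P by simp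
  have "?f integrable_on {-3..3}" using Henstock_Kurzweil_Integration.integrable_combine[OF _ _ N P] by simp
  then have "?f integrable_on {- c..1 - c}" by (rule integrable_on_subinterval) (use c in auto)
  then have "(\<lambda>s. ?f (s - c)) integrable_on {0..1}"
    using integrable_on_shift_Icc_real[of "\<lambda>s. ?f s" "- c" 0 1] by (simp add: o_def add.commute)
  then have "(\<lambda>s. \<bar>s - c\<bar> powr (- 1 / 2)) absolutely_integrable_on {0..1}"
    by (intro nonnegative_absolutely_integrable_1) auto
  then have "set_integrable lebesgue {0..1} (\<lambda>s. \<bar>s - c\<bar> powr (- 1 / 2))" .
  then show ?thesis
    unfolding set_integrable_def by (subst (asm) integrable_completion) auto
qed

text \<open>In the parameter \<open>s\<close> the circle wraps around at 0 and 1, so a point of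
  \<open>S\<close> with angle a acts through a - 1, a and a + 1. The distance from \<open>s\<close>
  to one of these is at most the chord, hence three integrable singularities per point
  dominate.\<close>

lemma infdist_powr_integrable:
  assumes S: "finite S" "S \<noteq> {}" "S \<subseteq> sphere 0 1"
  shows "set_integrable lborel {0..1} (\<lambda>s. infdist (cis (2 * pi * s)) S powr (- 1 / 2))"
proof -
  have ex: "\<exists>a. 0 \<le> a \<and> a \<le> 1 \<and> z = cis (2 * pi * a)" if "z \<in> S" for z
  proof -
    have z: "cmod z = 1" "z \<noteq> 0" using that S by auto
    then have "z = cis (2 * pi * (Arg z / (2 * pi)))" using cis_Arg[of z] by (simp add: sgn_eq)
    then have "z = cis (2 * pi * frac (Arg z / (2 * pi)))" by (metis cis_frac)
    then show ?thesis using frac_lt_1 frac_ge_0 by (metis less_imp_le)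
  qed
  then obtain a where a: "\<And>z. z \<in> S \<Longrightarrow> 0 \<le> a z \<and> a z \<le> 1 \<and> z = cis (2 * pi * a z)" by metis
  let ?p = "- 1 / 2 :: real"
  let ?g = "\<lambda>s. \<Sum>z\<in>S. \<bar>s - a z\<bar> powr ?p + (\<bar>s - (a z + 1)\<bar> powr ?p + \<bar>s - (a z - 1)\<bar> powr ?p)"
  have gi: "set_integrable lborel {0..1} ?g"
  proof -
    have "set_integrable lborel {0..1} (\<lambda>s. \<bar>s - a z\<bar> powr ?p + (\<bar>s - (a z + 1)\<bar> powr ?p + \<bar>s - (a z - 1)\<bar> powr ?p))" if "z \<in> S" for z
      using a[OF that] by (intro set_integral_add inverse_sqrt_integrable) auto
    then show ?thesis unfolding set_integrable_def scaleR_sum_right by (intro Bochner_Integration.integrable_sum)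
  qed
  have bound: "infdist (cis (2 * pi * s)) S powr ?p \<le> ?g s" if s: "s \<in> {0..1}" for s
  proof -
    obtain z where z: "z \<in> S" "infdist (cis (2 * pi * s)) S = dist (cis (2 * pi * s)) z"
      using infdist_attains_inf[of S "cis (2 * pi * s)"] S by (auto intro: finite_imp_closed)
    let ?u = "s - a z"
    have nn: "0 \<le> \<bar>s - a z\<bar> powr ?p + (\<bar>s - (a z + 1)\<bar> powr ?p + \<bar>s - (a z - 1)\<bar> powr ?p)" for z by simp
    have le1: "infdist (cis (2 * pi * s)) S powr ?p \<le> \<bar>?u\<bar> powr ?p + (\<bar>s - (a z + 1)\<bar> powr ?p + \<bar>s - (a z - 1)\<bar> powr ?p)"
    proof (cases "dist (cis (2 * pi * s)) z = 0")
      \<comment> \<open>At a point of \<open>S\<close> itself the left hand side is 0, since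
        \<open>0 powr p = 0\<close>.\<close>
      case True
      then show ?thesis using nn[of z] z by simp
    next
      case False
      have "dist (cis (2 * pi * s)) z = cmod (cis (2 * pi * ?u) - 1)"
      proof -
        have "cis (2 * pi * s) - z = z * (cis (2 * pi * ?u) - 1)"
          using a[OF z(1)] by (simp add: right_diff_distrib cis_mult) (metis add_diff_cancel_left' cis_mult diff_add_cancel mult.commute right_diff_distrib')?
        then show ?thesis using z S by (auto simp: dist_norm norm_mult)
      qed
      then have D: "unit_norm (frac ?u) \<le> dist (cis (2 * pi * s)) z" using unit_norm_le_dist[of ?u] by simp
      have u1: "\<bar>?u\<bar> \<le> 1" using s a[OF z(1)] by auto
      have "\<exists>y\<in>{\<bar>?u\<bar>, \<bar>s - (a z + 1)\<bar>, \<bar>s - (a z - 1)\<bar>}. y \<le> unit_norm (frac ?u)"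
      proof -
        have "(0 \<le> ?u \<and> ?u < 1 \<and> frac ?u = ?u) \<or> (-1 \<le> ?u \<and> ?u < 0 \<and> frac ?u = ?u + 1) \<or> (?u = 1 \<and> frac ?u = 0)"
        proof -
          consider "0 \<le> ?u" "?u < 1" | "?u = 1" | "-1 \<le> ?u" "?u < 0" using u1 by linarith
          then show ?thesis
          proof cases
            case 1 then show ?thesis by (simp add: frac_eq)
          next
            case 2 then show ?thesis by simp
          next
            case 3
            then have "\<lfloor>?u\<rfloor> = -1" by linarith
            then show ?thesis using 3 by (simp add: frac_def)
          qed
        qed
        then show ?thesis unfolding unit_norm_def by (elim disjE) (auto simp: min_def abs_if)
      qed
      then obtain y where y: "y \<in> {\<bar>?u\<bar>, \<bar>s - (a z + 1)\<bar>, \<bar>s - (a z - 1)\<bar>}" "y \<le> dist (cis (2 * pi * s)) z" using D by force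
      show ?thesis
      proof (cases "y = 0")
        case True
        have c: "cis (2 * pi * (a z + of_int n)) = z" for n
          using a[OF z(1)] cis_multiple_2pi[of "of_int n"] by (simp add: distrib_left flip: cis_mult)
        have "s = a z \<or> s = a z + 1 \<or> s = a z - 1" using y(1) True by auto
        then have "cis (2 * pi * s) = z" using c[of 0] c[of 1] c[of "-1"] by auto
        then show ?thesis using False by simp
      next
        case False
        then have "y > 0" using y by auto
        then have "dist (cis (2 * pi * s)) z powr ?p \<le> y powr ?p" using y by (intro powr_mono2') auto
        also have "y powr ?p \<le> \<bar>?u\<bar> powr ?p + (\<bar>s - (a z + 1)\<bar> powr ?p + \<bar>s - (a z - 1)\<bar> powr ?p)"
        proof -
          have "0 \<le> \<bar>v\<bar> powr ?p" for v :: real by simp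
          note p3 = this[of ?u] this[of "s - (a z + 1)"] this[of "s - (a z - 1)"]
          consider "y = \<bar>?u\<bar>" | "y = \<bar>s - (a z + 1)\<bar>" | "y = \<bar>s - (a z - 1)\<bar>" using y(1) by blast
          then show ?thesis
          proof cases
            case 1 show ?thesis unfolding 1 using p3 by linarith
          next
            case 2 show ?thesis unfolding 2 using p3 by linarith
          next
            case 3 show ?thesis unfolding 3 using p3 by linarith
          qed
        qed
        finally show ?thesis unfolding z(2) .
      qed
    qed
    also have "\<dots> \<le> ?g s" using z(1) S nn by (intro member_le_sum) auto
    finally show ?thesis .
  qed
  show ?thesis
  proof (rule set_integrable_bound[OF gi])
    have "continuous_on UNIV (\<lambda>s. infdist (cis (2 * pi * s)) S)" by (intro continuous_intros)
    then have "(\<lambda>s. infdist (cis (2 * pi * s)) S) \<in> borel_measurable borel" by (rule borel_measurable_continuous_onI)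
    then show "set_borel_measurable lborel {0..1} (\<lambda>s. infdist (cis (2 * pi * s)) S powr ?p)"
      unfolding set_borel_measurable_def by simp
    show "AE s in lborel. s \<in> {0..1} \<longrightarrow> norm (infdist (cis (2 * pi * s)) S powr ?p) \<le> norm (?g s)"
      using bound by (intro AE_I2 impI) (auto intro: order_trans[OF _ abs_ge_self])
  qed
qed

section \<open>Equidistribution for functions with mild singularities\<close>

text \<open>The model is a logarithm: smaller than every negative power of the distance to
  \<open>S\<close>, with a Lipschitz constant polynomial in the inverse distance. Quantifying over
  all \<epsilon> makes the class closed under products, hence under powers. As
  \<open>infdist z {} = 0\<close>, the sets in use are nonempty.\<close>

definition mild_singularities :: "complex set \<Rightarrow> (complex \<Rightarrow> real) \<Rightarrow> bool" where
  "mild_singularities S U \<longleftrightarrow>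
    (\<forall>\<epsilon>>0. \<exists>C. \<forall>z\<in>sphere 0 1 - S. \<bar>U z\<bar> \<le> C * infdist z S powr (- \<epsilon>)) \<and>
    (\<exists>\<kappa>\<ge>0. \<exists>C. \<forall>\<eta>>0. \<eta> < 1 \<longrightarrow> (\<forall>z\<in>sphere 0 1. \<forall>w\<in>sphere 0 1. infdist z S \<ge> \<eta> \<longrightarrow> infdist w S \<ge> \<eta> \<longrightarrow>
       \<bar>U z - U w\<bar> \<le> C * \<eta> powr (- \<kappa>) * cmod (z - w)))"

lemma infdist_circle_le_2:
  fixes z :: complex
  assumes "S \<noteq> {}" "S \<subseteq> sphere 0 1" "z \<in> sphere 0 1"
  shows "infdist z S \<le> 2"
proof -
  obtain w where w: "w \<in> S" using assms by blast
  have "infdist z S \<le> dist z w" by (rule infdist_le[OF w])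
  also have "\<dots> \<le> cmod z + cmod w" unfolding dist_norm by (rule norm_triangle_ineq4)
  finally show ?thesis using w assms by auto
qed

lemma infdist_finite_pos:
  fixes S :: "complex set"
  assumes "finite S" "S \<noteq> {}" "z \<notin> S"
  shows "infdist z S > 0"
  using assms in_closed_iff_infdist_zero[of S z] infdist_nonneg[of z S] finite_imp_closed[of S] by (auto simp: less_le)

text \<open>Half of \<epsilon> goes to each factor. In the Lipschitz part the size of one factor is
  estimated with \<epsilon> = 1, so the exponent k + j + 1 serves for both terms of the product
  rule.\<close>

lemma mild_singularities_mult:
  assumes S: "finite S" "S \<noteq> {}" and U: "mild_singularities S U" and V: "mild_singularities S V"
  shows "mild_singularities S (\<lambda>z. U z * V z)"
  unfolding mild_singularities_def
proof (intro conjI allI impI)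
  fix \<epsilon> :: real assume e: "\<epsilon> > 0"
  obtain C where C: "\<And>z. z \<in> sphere 0 1 - S \<Longrightarrow> \<bar>U z\<bar> \<le> C * infdist z S powr (- (\<epsilon> / 2))"
    using U e unfolding mild_singularities_def by (metis half_gt_zero)
  obtain D where D: "\<And>z. z \<in> sphere 0 1 - S \<Longrightarrow> \<bar>V z\<bar> \<le> D * infdist z S powr (- (\<epsilon> / 2))"
    using V e unfolding mild_singularities_def by (metis half_gt_zero)
  have "\<bar>U z * V z\<bar> \<le> (C * D) * infdist z S powr (- \<epsilon>)" if z: "z \<in> sphere 0 1 - S" for z
  proof -
    have "\<bar>U z * V z\<bar> \<le> (C * infdist z S powr (- (\<epsilon> / 2))) * (D * infdist z S powr (- (\<epsilon> / 2)))"
      unfolding abs_mult using C[OF z] D[OF z] by (intro mult_mono) (auto intro: order_trans[OF abs_ge_zero C[OF z]])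
    also have "\<dots> = (C * D) * (infdist z S powr (- (\<epsilon> / 2)) * infdist z S powr (- (\<epsilon> / 2)))" by (simp only: mult_ac)
    also have "infdist z S powr (- (\<epsilon> / 2)) * infdist z S powr (- (\<epsilon> / 2)) = infdist z S powr (- \<epsilon>)" by (simp flip: powr_add)
    finally show ?thesis .
  qed
  then show "\<exists>C. \<forall>z\<in>sphere 0 1 - S. \<bar>U z * V z\<bar> \<le> C * infdist z S powr (- \<epsilon>)" by blast
next
  obtain C0 where C0: "\<And>z. z \<in> sphere 0 1 - S \<Longrightarrow> \<bar>U z\<bar> \<le> C0 * infdist z S powr (- 1)"
    using U unfolding mild_singularities_def by (metis zero_less_one)
  obtain D0 where D0: "\<And>z. z \<in> sphere 0 1 - S \<Longrightarrow> \<bar>V z\<bar> \<le> D0 * infdist z S powr (- 1)"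
    using V unfolding mild_singularities_def by (metis zero_less_one)
  define C where "C = \<bar>C0\<bar>"
  define D where "D = \<bar>D0\<bar>"
  obtain k L where k: "k \<ge> 0" and L: "\<And>\<eta> z w. 0 < \<eta> \<Longrightarrow> \<eta> < 1 \<Longrightarrow> z \<in> sphere 0 1 \<Longrightarrow> w \<in> sphere 0 1 \<Longrightarrow>
      infdist z S \<ge> \<eta> \<Longrightarrow> infdist w S \<ge> \<eta> \<Longrightarrow> \<bar>U z - U w\<bar> \<le> L * \<eta> powr (- k) * cmod (z - w)"
    using U unfolding mild_singularities_def by metis
  obtain j M where j: "j \<ge> 0" and M: "\<And>\<eta> z w. 0 < \<eta> \<Longrightarrow> \<eta> < 1 \<Longrightarrow> z \<in> sphere 0 1 \<Longrightarrow> w \<in> sphere 0 1 \<Longrightarrow>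
      infdist z S \<ge> \<eta> \<Longrightarrow> infdist w S \<ge> \<eta> \<Longrightarrow> \<bar>V z - V w\<bar> \<le> M * \<eta> powr (- j) * cmod (z - w)"
    using V unfolding mild_singularities_def by metis
  have "\<bar>U z * V z - U w * V w\<bar> \<le> (C * \<bar>M\<bar> + D * \<bar>L\<bar>) * \<eta> powr (- (k + j + 1)) * cmod (z - w)"
    if \<eta>: "0 < \<eta>" "\<eta> < 1" and zw: "z \<in> sphere 0 1" "w \<in> sphere 0 1" "infdist z S \<ge> \<eta>" "infdist w S \<ge> \<eta>" for \<eta> z w
  proof -
    have notS: "y \<notin> S" if "infdist y S \<ge> \<eta>" for y using that \<eta> by auto
    have inv: "infdist y S powr (- 1) \<le> \<eta> powr (- 1)" if "infdist y S \<ge> \<eta>" for y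
      using that \<eta> by (intro powr_mono2') auto
    have Ub: "\<bar>U z\<bar> \<le> C * \<eta> powr (- 1)"
    proof -
      have "\<bar>U z\<bar> \<le> C0 * infdist z S powr (- 1)" using C0 zw notS by auto
      also have "\<dots> \<le> C * infdist z S powr (- 1)" unfolding C_def by (intro mult_right_mono) auto
      also have "\<dots> \<le> C * \<eta> powr (- 1)" using inv[OF zw(3)] by (intro mult_left_mono) (auto simp: C_def)
      finally show ?thesis .
    qed
    have Vb: "\<bar>V w\<bar> \<le> D * \<eta> powr (- 1)"
    proof -
      have "\<bar>V w\<bar> \<le> D0 * infdist w S powr (- 1)" using D0 zw notS by auto
      also have "\<dots> \<le> D * infdist w S powr (- 1)" unfolding D_def by (intro mult_right_mono) auto
      also have "\<dots> \<le> D * \<eta> powr (- 1)" using inv[OF zw(4)] by (intro mult_left_mono) (auto simp: D_def)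
      finally show ?thesis .
    qed
    have up: "X * \<eta> powr (- i) * cmod (z - w) \<le> \<bar>X\<bar> * \<eta> powr (- (k + j)) * cmod (z - w)" if "i \<le> k + j" for X i
      using that \<eta> by (intro mult_right_mono mult_mono powr_mono') auto
    have "\<bar>U z * V z - U w * V w\<bar> \<le> \<bar>U z\<bar> * \<bar>V z - V w\<bar> + \<bar>V w\<bar> * \<bar>U z - U w\<bar>"
    proof -
      have "U z * V z - U w * V w = U z * (V z - V w) + V w * (U z - U w)" by (simp add: algebra_simps)
      then show ?thesis by (simp only: abs_mult[symmetric] abs_triangle_ineq)
    qed
    also have "\<dots> \<le> (C * \<eta> powr (- 1)) * (\<bar>M\<bar> * \<eta> powr (- (k + j)) * cmod (z - w)) + (D * \<eta> powr (- 1)) * (\<bar>L\<bar> * \<eta> powr (- (k + j)) * cmod (z - w))"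
    proof (intro add_mono mult_mono)
      show "\<bar>V z - V w\<bar> \<le> \<bar>M\<bar> * \<eta> powr (- (k + j)) * cmod (z - w)"
        using order_trans[OF M[OF \<eta> zw] up[of j M]] k by simp
      show "\<bar>U z - U w\<bar> \<le> \<bar>L\<bar> * \<eta> powr (- (k + j)) * cmod (z - w)"
        using order_trans[OF L[OF \<eta> zw] up[of k L]] j by simp
    qed (use Ub Vb in \<open>auto simp: C_def D_def\<close>)
    also have "\<dots> = (C * \<bar>M\<bar> + D * \<bar>L\<bar>) * (\<eta> powr (- 1) * \<eta> powr (- (k + j))) * cmod (z - w)"
    proof -
      have "(C * p) * (m * q * v) + (D * p) * (l * q * v) = (C * m + D * l) * (p * q) * v" for p q m l v :: real
        by (simp add: algebra_simps)
      then show ?thesis .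
    qed
    also have "\<eta> powr (- 1) * \<eta> powr (- (k + j)) = \<eta> powr (- (k + j + 1))" by (subst powr_add[symmetric]) (simp add: algebra_simps)
    finally show ?thesis .
  qed
  moreover have "k + j + 1 \<ge> 0" using k j by simp
  ultimately show "\<exists>\<kappa>\<ge>0. \<exists>C. \<forall>\<eta>>0. \<eta> < 1 \<longrightarrow> (\<forall>z\<in>sphere 0 1. \<forall>w\<in>sphere 0 1. infdist z S \<ge> \<eta> \<longrightarrow> infdist w S \<ge> \<eta> \<longrightarrow>
       \<bar>U z * V z - U w * V w\<bar> \<le> C * \<eta> powr (- \<kappa>) * cmod (z - w))" by blast
qed

lemma mild_singularities_power:
  assumes "finite S" "S \<noteq> {}" "mild_singularities S U"
  shows "mild_singularities S (\<lambda>z. U z ^ Suc n)"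
proof (induction n)
  case (Suc n)
  from mild_singularities_mult[OF assms Suc] show ?case by simp
qed (use assms in simp)

lemma finite_circle_preimage:
  assumes "finite S"
  shows "AE s in lborel. s \<in> {0..1} \<longrightarrow> cis (2 * pi * s) \<notin> S"
proof -
  have inj: "inj_on (\<lambda>s. cis (2 * pi * s)) {0..<1}"
  proof (rule inj_onI)
    fix a b :: real assume ab: "a \<in> {0..<1}" "b \<in> {0..<1}" "cis (2 * pi * a) = cis (2 * pi * b)"
    have "cis (2 * pi * a - 2 * pi * b) = 1" using ab by (simp flip: cis_divide)
    then obtain n where n: "2 * pi * a - 2 * pi * b = of_int n * (2 * pi)" unfolding cis_eq_1_iff by blast
    then have "2 * pi * (a - b) = 2 * pi * of_int n" by (simp add: algebra_simps)
    from this[unfolded mult_cancel_left] have "a - b = of_int n" by simp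
    moreover have "- 1 < a - b" "a - b < 1" using ab by auto
    ultimately have "- 1 < (of_int n :: real)" "(of_int n :: real) < 1" by auto
    then have "n = 0" by linarith
    then show "a = b" using \<open>a - b = of_int n\<close> by simp
  qed
  have "finite ((\<lambda>s. cis (2 * pi * s)) -` S \<inter> {0..<1})" by (rule finite_vimage_IntI[OF assms inj])
  then have "finite (insert 1 ((\<lambda>s. cis (2 * pi * s)) -` S \<inter> {0..<1}))" by simp
  then have "AE s in lborel. s \<notin> insert 1 ((\<lambda>s. cis (2 * pi * s)) -` S \<inter> {0..<1})"
    by (intro AE_not_in finite_imp_null_set_lborel)
  then show ?thesis by eventually_elim auto
qed

text \<open>A linear ramp between \<eta> and 2 \<eta> instead of an indicator function, so that
  equidistribution of Lipschitz functions applies to it and to its complement.\<close>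

definition cutoff :: "complex set \<Rightarrow> real \<Rightarrow> complex \<Rightarrow> real" where
  "cutoff S \<eta> z = max 0 (min 1 (infdist z S / \<eta> - 1))"

lemma cutoff_bounds: "0 \<le> cutoff S \<eta> z" "cutoff S \<eta> z \<le> 1"
  by (auto simp: cutoff_def)

lemma cutoff_zero: "\<eta> > 0 \<Longrightarrow> infdist z S \<le> \<eta> \<Longrightarrow> cutoff S \<eta> z = 0"
  by (simp add: cutoff_def divide_le_eq)

lemma cutoff_one: "\<eta> > 0 \<Longrightarrow> 2 * \<eta> \<le> infdist z S \<Longrightarrow> cutoff S \<eta> z = 1"
  by (simp add: cutoff_def le_divide_eq min_def)

lemma cutoff_lipschitz:
  assumes "\<eta> > 0"
  shows "\<bar>cutoff S \<eta> z - cutoff S \<eta> w\<bar> \<le> 1 / \<eta> * cmod (z - w)"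
proof -
  have "\<bar>cutoff S \<eta> z - cutoff S \<eta> w\<bar> \<le> \<bar>infdist z S / \<eta> - infdist w S / \<eta>\<bar>"
    unfolding cutoff_def by (auto simp: max_def min_def abs_if)
  also have "\<dots> = \<bar>infdist z S - infdist w S\<bar> / \<eta>" using assms by (simp flip: diff_divide_distrib)
  also have "\<dots> \<le> dist z w / \<eta>" using assms by (intro divide_right_mono infdist_triangle_abs) auto
  finally show ?thesis by (simp add: dist_norm)
qed

lemma circle_lipschitz_integrable:
  assumes "circle_lipschitz \<Lambda> G" "\<Lambda> \<ge> 0"
  shows "set_integrable lborel {0..1} (\<lambda>s. G (cis (2 * pi * s)))"
  using circle_lipschitz_continuous[OF assms, of 1]
  by (intro borel_integrable_atLeastAtMost') (auto intro: continuous_on_subset)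

text \<open>
  The cutoff removes \<open>{z. infdist z S < \<eta>}\<close> with \<open>\<eta>\<close> a small negative power of \<open>N\<close>, which keeps the
  Lipschitz constant below the saving of \<open>lipschitz_equidistribution\<close>. The number of points \<open>x\<^sup>m\<close> that are
  cut off is estimated by equidistribution of \<open>1 - cutoff S \<eta>\<close> itself.
\<close>

lemma singular_equidistribution:
  fixes t K \<gamma> :: real and U :: "complex \<Rightarrow> real"
  defines "x \<equiv> cis (2 * pi * t)"
  assumes K: "K > 0" and gam: "\<gamma> > 0"
    and dio: "\<And>m::int. m \<noteq> 0 \<Longrightarrow> unit_norm (frac (of_int m * t)) > K / \<bar>of_int m\<bar> powr \<gamma>"
    and S: "finite S" "S \<noteq> {}" "S \<subseteq> sphere 0 1" and U: "mild_singularities S U"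
    and meas: "(\<lambda>s. U (cis (2 * pi * s))) \<in> borel_measurable borel"
    and growth: "\<And>\<epsilon>. \<epsilon> > 0 \<Longrightarrow> \<exists>C. \<forall>m\<ge>1. \<bar>U (x ^ m)\<bar> \<le> C * real m powr \<epsilon>"
  shows "set_integrable lborel {0..1} (\<lambda>s. U (cis (2 * pi * s)))"
    "\<exists>\<delta> C. 0 < \<delta> \<and> \<delta> < 1 \<and> (\<forall>N. \<bar>(\<Sum>m=1..N. U (x ^ m)) - real N * circle_integral U\<bar> \<le> C * real N powr (1 - \<delta>))"
proof -
  let ?d = "\<lambda>z. infdist z S"
  let ?e = "\<lambda>s. cis (2 * pi * s)"
  note dint = infdist_powr_integrable[OF S]
  define J where "J = (LINT s:{0..1}|lborel. ?d (?e s) powr (- 1 / 2))"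
  have J: "J \<ge> 0" unfolding J_def set_lebesgue_integral_def by (rule Bochner_Integration.integral_nonneg) simp
  have sing: "\<exists>C\<ge>0. \<forall>z\<in>sphere 0 1 - S. \<bar>U z\<bar> \<le> C * ?d z powr (- \<epsilon>)" if e: "\<epsilon> > 0" for \<epsilon>
  proof -
    obtain C where C: "\<forall>z\<in>sphere 0 1 - S. \<bar>U z\<bar> \<le> C * ?d z powr (- \<epsilon>)"
      using conjunct1[OF U[unfolded mild_singularities_def]] e by blast
    have "\<bar>U z\<bar> \<le> \<bar>C\<bar> * ?d z powr (- \<epsilon>)" if "z \<in> sphere 0 1 - S" for z
      using C that by (intro order_trans[OF bspec[OF C that]] mult_right_mono) auto
    then show ?thesis by (intro exI[of _ "\<bar>C\<bar>"]) auto
  qed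
  \<comment> \<open>The exponent 1 / 2 gives integrability; the exponent 1 / 4 below leaves room for
    a factor \<eta>^(1/4) next to the integrable power -1 / 2 of the distance.\<close>
  obtain C1 where C1: "C1 \<ge> 0" "\<And>z. z \<in> sphere 0 1 - S \<Longrightarrow> \<bar>U z\<bar> \<le> C1 * ?d z powr (- (1 / 2))"
    using sing[of "1 / 2"] by auto
  obtain C3 where C3: "C3 \<ge> 0" "\<And>z. z \<in> sphere 0 1 - S \<Longrightarrow> \<bar>U z\<bar> \<le> C3 * ?d z powr (- (1 / 4))"
    using sing[of "1 / 4"] by auto
  obtain \<kappa> CL where k: "\<kappa> \<ge> 0" and L: "\<And>\<eta> z w. 0 < \<eta> \<Longrightarrow> \<eta> < 1 \<Longrightarrow> z \<in> sphere 0 1 \<Longrightarrow> w \<in> sphere 0 1 \<Longrightarrow>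
      ?d z \<ge> \<eta> \<Longrightarrow> ?d w \<ge> \<eta> \<Longrightarrow> \<bar>U z - U w\<bar> \<le> CL * \<eta> powr (- \<kappa>) * cmod (z - w)"
    using U unfolding mild_singularities_def by metis
  show int: "set_integrable lborel {0..1} (\<lambda>s. U (?e s))"
  proof (rule set_integrable_bound[OF set_integrable_mult_right[OF dint, of C1]])
    show "set_borel_measurable lborel {0..1} (\<lambda>s. U (?e s))"
      unfolding set_borel_measurable_def using meas by simp
    show "AE s in lborel. s \<in> {0..1} \<longrightarrow> norm (U (?e s)) \<le> norm (C1 * ?d (?e s) powr (- 1 / 2))"
      using finite_circle_preimage[OF S(1)]
    proof eventually_elim
      case (elim s)
      then show ?case using C1(2)[of "?e s"] C1(1) by (auto simp: abs_mult)
    qed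
  qed
  obtain \<delta>0 C0 where d0: "0 < \<delta>0" "\<delta>0 < 1" "C0 \<ge> 0" and lipeq: "\<And>G \<Lambda> N. circle_lipschitz \<Lambda> G \<Longrightarrow>
     (\<And>z. z \<in> sphere 0 1 \<Longrightarrow> \<bar>G z\<bar> \<le> \<Lambda>) \<Longrightarrow> \<bar>(\<Sum>m=1..N. G (x ^ m)) - real N * circle_integral G\<bar> \<le> C0 * \<Lambda> * real N powr (1 - \<delta>0)"
    unfolding x_def by (rule lipschitz_equidistribution[OF K gam dio]) blast+
  \<comment> \<open>The truncated function has a Lipschitz constant of order \<eta>^(-(\<kappa> +
    2)). For \<eta> of order N^(-a) this is N^(\<delta>0 / 2), half of the available saving.\<close>
  define a where "a = \<delta>0 / (2 * (\<kappa> + 2))"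
  have a: "0 < a" "a \<le> \<delta>0 / 4" "a * (\<kappa> + 2) = \<delta>0 / 2"
    using d0 k by (auto simp: a_def divide_simps)
  obtain C2 where C2: "\<And>m. m \<ge> 1 \<Longrightarrow> \<bar>U (x ^ m)\<bar> \<le> C2 * real m powr (a / 4)"
    using growth[of "a / 4"] a by auto
  have C2p: "C2 \<ge> 0" using C2[of 1] by simp
  define B1 where "B1 = C0 * ((\<bar>CL\<bar> + C1) * 4 powr (\<kappa> + 2))"
  define B2 where "B2 = C2 * (J + 4 * C0)"
  define B3 where "B3 = C3 * J"
  have main: "\<bar>(\<Sum>m=1..N. U (x ^ m)) - real N * circle_integral U\<bar> \<le> (B1 + B2 + B3) * real N powr (1 - a / 4)" if "N \<noteq> 0" for N
  proof -
    let ?N = "real N"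
    have N: "?N \<ge> 1" using that by simp
    \<comment> \<open>The factor 1 / 4 ensures \<eta> < 1 even for N = 1.\<close>
    define \<eta> where "\<eta> = ?N powr (- a) / 4"
    have eta: "\<eta> > 0" "\<eta> < 1" "4 * \<eta> = ?N powr (- a)"
      using N powr_mono[of "- a" 0 ?N] a by (auto simp: \<eta>_def)
    have split1: "?N powr (1 - e) = ?N * ?N powr (- e)" for e using N powr_add[of ?N 1 "- e"] by simp
    let ?\<chi> = "cutoff S \<eta>"
    define G where "G z = U z * ?\<chi> z" for z
    define \<psi> where "\<psi> z = 1 - ?\<chi> z" for z
    define \<Lambda> where "\<Lambda> = (\<bar>CL\<bar> + C1) * \<eta> powr (- (\<kappa> + 2))"
    have pw: "\<eta> powr (- i) \<le> \<eta> powr (- (\<kappa> + 2))" if "i \<le> \<kappa> + 2" for i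
      using that eta by (intro powr_mono') auto
    have Ub: "\<bar>U z\<bar> \<le> C1 * \<eta> powr (- (1 / 2))" if "z \<in> sphere 0 1" "?d z \<ge> \<eta>" for z
    proof -
      have "z \<notin> S" using that eta by auto
      then have "\<bar>U z\<bar> \<le> C1 * ?d z powr (- (1 / 2))" using C1 that by auto
      also have "\<dots> \<le> C1 * \<eta> powr (- (1 / 2))" using C1 that eta by (intro mult_left_mono powr_mono2') auto
      finally show ?thesis .
    qed
    have L0: "\<Lambda> \<ge> 0" unfolding \<Lambda>_def using C1 by (intro mult_nonneg_nonneg) auto
    have Gb: "\<bar>G z\<bar> \<le> \<Lambda>" if z: "z \<in> sphere 0 1" for z
    proof (cases "?d z \<ge> \<eta>")
      case True
      have "\<bar>G z\<bar> \<le> (C1 * \<eta> powr (- (1 / 2))) * 1"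
        unfolding G_def abs_mult using Ub[OF z True] cutoff_bounds[of S \<eta> z] C1 by (intro mult_mono) auto
      also have "\<dots> \<le> \<Lambda>" unfolding \<Lambda>_def using pw[of "1 / 2"] k C1 by (simp add: mult_mono)
      finally show ?thesis .
    next
      case False
      then show ?thesis using cutoff_zero[of \<eta> z S] eta C1 by (simp add: G_def \<Lambda>_def)
    qed
    have half: "\<bar>U w\<bar> * \<bar>?\<chi> z - ?\<chi> w\<bar> \<le> C1 * \<eta> powr (- (\<kappa> + 2)) * cmod (z - w)"
      if "w \<in> sphere 0 1" "?d w \<ge> \<eta>" for z w
    proof -
      have "\<bar>U w\<bar> * \<bar>?\<chi> z - ?\<chi> w\<bar> \<le> (C1 * \<eta> powr (- (1 / 2))) * (1 / \<eta> * cmod (z - w))"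
        using Ub[OF that] cutoff_lipschitz[OF eta(1), of S z w] C1 by (intro mult_mono) auto
      also have "\<dots> = C1 * (\<eta> powr (- (1 / 2)) * \<eta> powr (- 1)) * cmod (z - w)"
        using eta by (simp add: powr_minus_divide[of \<eta> 1])
      also have "\<eta> powr (- (1 / 2)) * \<eta> powr (- 1) = \<eta> powr (- (3 / 2))" by (subst powr_add[symmetric]) simp
      also have "C1 * \<eta> powr (- (3 / 2)) * cmod (z - w) \<le> C1 * \<eta> powr (- (\<kappa> + 2)) * cmod (z - w)"
        using pw[of "3 / 2"] k C1 by (intro mult_right_mono mult_left_mono) auto
      finally show ?thesis .
    qed
    \<comment> \<open>If one of the two points is closer than \<eta> to \<open>S\<close>, the cutoff
      vanishes there, so \<open>U\<close> is evaluated only at the other point and no control near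
      \<open>S\<close> enters.\<close>
    have Glip: "circle_lipschitz \<Lambda> G"
      unfolding circle_lipschitz_def
    proof (intro ballI)
      fix z w :: complex assume zw: "z \<in> sphere 0 1" "w \<in> sphere 0 1"
      have C1L: "C1 * \<eta> powr (- (\<kappa> + 2)) * cmod (z - w) \<le> \<Lambda> * cmod (z - w)"
        unfolding \<Lambda>_def by (intro mult_right_mono) auto
      show "\<bar>G z - G w\<bar> \<le> \<Lambda> * cmod (z - w)"
      proof (cases "?d w \<ge> \<eta>")
        case w: True
        show ?thesis
        proof (cases "?d z \<ge> \<eta>")
          case True
          have "G z - G w = (U z - U w) * ?\<chi> z + U w * (?\<chi> z - ?\<chi> w)" by (simp add: G_def algebra_simps)
          then have "\<bar>G z - G w\<bar> \<le> \<bar>U z - U w\<bar> * \<bar>?\<chi> z\<bar> + \<bar>U w\<bar> * \<bar>?\<chi> z - ?\<chi> w\<bar>"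
            by (simp only: abs_mult[symmetric] abs_triangle_ineq)
          also have "\<dots> \<le> (\<bar>CL\<bar> * \<eta> powr (- (\<kappa> + 2)) * cmod (z - w)) * 1 + C1 * \<eta> powr (- (\<kappa> + 2)) * cmod (z - w)"
          proof (rule add_mono[OF mult_mono half[OF zw(2) w]])
            have "\<bar>U z - U w\<bar> \<le> CL * \<eta> powr (- \<kappa>) * cmod (z - w)" by (rule L[OF eta(1,2) zw True w])
            also have "\<dots> \<le> \<bar>CL\<bar> * \<eta> powr (- (\<kappa> + 2)) * cmod (z - w)"
              using pw[of \<kappa>] by (intro mult_right_mono mult_mono) auto
            finally show "\<bar>U z - U w\<bar> \<le> \<bar>CL\<bar> * \<eta> powr (- (\<kappa> + 2)) * cmod (z - w)" .
          qed (use cutoff_bounds[of S \<eta> z] in auto)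
          also have "\<dots> = \<Lambda> * cmod (z - w)" by (simp add: \<Lambda>_def algebra_simps)
          finally show ?thesis .
        next
          case False
          then have z0: "?\<chi> z = 0" using eta by (intro cutoff_zero) auto
          then have "\<bar>G z - G w\<bar> = \<bar>U w\<bar> * \<bar>?\<chi> z - ?\<chi> w\<bar>" by (simp add: G_def abs_mult)
          then show ?thesis using half[OF zw(2) w, of z] C1L by linarith
        qed
      next
        case False
        then have w0: "?\<chi> w = 0" using eta by (intro cutoff_zero) auto
        show ?thesis
        proof (cases "?d z \<ge> \<eta>")
          case True
          have "\<bar>G z - G w\<bar> = \<bar>U z\<bar> * \<bar>?\<chi> w - ?\<chi> z\<bar>" using w0 by (simp add: G_def abs_mult)
          then show ?thesis using half[OF zw(1) True, of w] C1L by (simp add: norm_minus_commute)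
        next
          case False
          then have "?\<chi> z = 0" using eta by (intro cutoff_zero) auto
          moreover have "0 \<le> \<Lambda> * cmod (z - w)" using L0 by (intro mult_nonneg_nonneg) auto
          ultimately show ?thesis using w0 by (simp add: G_def)
        qed
      qed
    qed
    have e1: "\<bar>(\<Sum>m=1..N. G (x ^ m)) - ?N * circle_integral G\<bar> \<le> B1 * ?N powr (1 - a / 4)"
    proof -
      have "\<eta> powr (- (\<kappa> + 2)) = 4 powr (\<kappa> + 2) * ?N powr (\<delta>0 / 2)"
      proof -
        have "\<eta> powr (- (\<kappa> + 2)) = (?N powr (- a)) powr (- (\<kappa> + 2)) / 4 powr (- (\<kappa> + 2))"
          unfolding \<eta>_def by (rule powr_divide)
        also have "(?N powr (- a)) powr (- (\<kappa> + 2)) = ?N powr (\<delta>0 / 2)"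
          by (simp only: powr_powr minus_mult_minus a(3))
        also have "?N powr (\<delta>0 / 2) / 4 powr (- (\<kappa> + 2)) = 4 powr (\<kappa> + 2) * ?N powr (\<delta>0 / 2)"
          unfolding powr_minus divide_inverse inverse_inverse_eq by (rule mult.commute)
        finally show ?thesis .
      qed
      then have "C0 * \<Lambda> * ?N powr (1 - \<delta>0) = B1 * (?N powr (\<delta>0 / 2) * ?N powr (1 - \<delta>0))"
        by (simp only: \<Lambda>_def B1_def mult_ac)
      also have "?N powr (\<delta>0 / 2) * ?N powr (1 - \<delta>0) = ?N powr (1 - \<delta>0 / 2)" by (simp flip: powr_add)
      also have "B1 * ?N powr (1 - \<delta>0 / 2) \<le> B1 * ?N powr (1 - a / 4)"
        using N a d0 C1 by (intro mult_left_mono powr_mono) (auto simp: B1_def)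
      finally show ?thesis using lipeq[OF Glip Gb, of N] by linarith
    qed
    have psi: "0 \<le> \<psi> z" "\<psi> z \<le> 1" for z using cutoff_bounds[of S \<eta> z] by (auto simp: \<psi>_def)
    have psi0: "\<psi> z = 0" if "2 * \<eta> \<le> ?d z" for z using cutoff_one[OF eta(1) that] by (simp add: \<psi>_def)
    have psilip: "circle_lipschitz (1 / \<eta>) \<psi>"
      unfolding circle_lipschitz_def using cutoff_lipschitz[OF eta(1), of S] by (auto simp: \<psi>_def abs_minus_commute)
    have psiint: "set_integrable lborel {0..1} (\<lambda>s. \<psi> (?e s))"
      using circle_lipschitz_integrable[OF psilip] eta by simp
    \<comment> \<open>On the support of \<psi> the distance d is below 2 \<eta>. In d^(-b) = d^(1/2
      - b) d^(-1/2) the first factor is then small and the second integrable.\<close>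
    have near: "\<psi> z * ?d z powr (- b) \<le> (2 * \<eta>) powr (1 / 2 - b) * ?d z powr (- 1 / 2)" if "z \<notin> S" "b \<le> 1 / 2" for z b
    proof (cases "2 * \<eta> \<le> ?d z")
      case True
      then show ?thesis using psi0[OF True] by simp
    next
      case False
      have dp: "?d z > 0" using infdist_finite_pos[OF S(1,2) that(1)] .
      have "\<psi> z * ?d z powr (- b) \<le> 1 * ?d z powr (- b)" using psi by (intro mult_right_mono) auto
      also have "1 * ?d z powr (- b) = ?d z powr (1 / 2 - b) * ?d z powr (- 1 / 2)"
        using dp by (simp flip: powr_add)
      also have "\<dots> \<le> (2 * \<eta>) powr (1 / 2 - b) * ?d z powr (- 1 / 2)"
        using False dp that by (intro mult_right_mono powr_mono2) auto
      finally show ?thesis .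
    qed
    have two: "(2 * \<eta>) powr c \<le> ?N powr (- a * c)" if "c \<ge> 0" for c
    proof -
      have "(2 * \<eta>) powr c \<le> (4 * \<eta>) powr c" using eta(1) that by (intro powr_mono2) auto
      also have "\<dots> = ?N powr (- a * c)" unfolding eta(3) powr_powr ..
      finally show ?thesis .
    qed
    have psiI: "circle_integral \<psi> \<le> ?N powr (- a / 2) * J"
    proof -
      have "circle_integral \<psi> \<le> (LINT s:{0..1}|lborel. (2 * \<eta>) powr (1 / 2) * ?d (?e s) powr (- 1 / 2))"
      proof (rule set_integral_mono_AE[OF psiint set_integrable_mult_right[OF dint]])
        show "AE s \<in> {0..1} in lborel. \<psi> (?e s) \<le> (2 * \<eta>) powr (1 / 2) * ?d (?e s) powr (- 1 / 2)"
          using finite_circle_preimage[OF S(1)]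
        proof eventually_elim
          case (elim s)
          then show ?case using near[of "?e s" 0] infdist_finite_pos[OF S(1,2), of "?e s"] by auto
        qed
      qed
      also have "\<dots> = (2 * \<eta>) powr (1 / 2) * J" by (simp add: J_def)
      also have "\<dots> \<le> ?N powr (- a / 2) * J" using two[of "1 / 2"] J by (intro mult_right_mono) auto
      finally show ?thesis .
    qed
    \<comment> \<open>The Lipschitz constant 1 / \<eta> = 4 N^a is affordable because a \<le>
      \<delta>0 / 4; the main term is N times the integral of \<psi>.\<close>
    have cnt: "(\<Sum>m=1..N. \<psi> (x ^ m)) \<le> (J + 4 * C0) * ?N powr (1 - a / 2)"
    proof -
      have "1 \<le> 1 / \<eta>" using eta by simp
      then have "\<bar>\<psi> z\<bar> \<le> 1 / \<eta>" for z using psi[of z] by linarith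
      from lipeq[OF psilip this, of N]
      have "(\<Sum>m=1..N. \<psi> (x ^ m)) \<le> ?N * circle_integral \<psi> + C0 * (1 / \<eta>) * ?N powr (1 - \<delta>0)" by linarith
      also have "?N * circle_integral \<psi> \<le> ?N * (?N powr (- a / 2) * J)" using psiI by (intro mult_left_mono) auto
      also have "?N * (?N powr (- a / 2) * J) = J * ?N powr (1 - a / 2)"
        using split1[of "a / 2"] by simp
      also have "C0 * (1 / \<eta>) * ?N powr (1 - \<delta>0) = 4 * C0 * (?N powr a * ?N powr (1 - \<delta>0))"
      proof -
        have "?N powr (- a) * ?N powr a = 1" unfolding powr_add[symmetric] using N by simp
        moreover have "4 * ?N powr a * \<eta> = ?N powr (- a) * ?N powr a" by (simp add: \<eta>_def)
        ultimately have "4 * ?N powr a * \<eta> = 1" by (simp only:)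
        then have "1 / \<eta> = 4 * ?N powr a" using eta(1) by (metis eq_divide_eq less_irrefl)
        then show ?thesis by (simp only: mult_ac)
      qed
      also have "?N powr a * ?N powr (1 - \<delta>0) = ?N powr (a + (1 - \<delta>0))" by (rule powr_add[symmetric])
      also have "4 * C0 * ?N powr (a + (1 - \<delta>0)) \<le> 4 * C0 * ?N powr (1 - a / 2)"
        using N a d0 by (intro mult_left_mono powr_mono) auto
      finally show ?thesis by (simp add: distrib_right)
    qed
    \<comment> \<open>Values of size N^(a / 4) at about N^(1 - a / 2) removed points: the growth
      exponent was chosen so that a saving of a / 4 is left.\<close>
    have e2: "\<bar>(\<Sum>m=1..N. U (x ^ m)) - (\<Sum>m=1..N. G (x ^ m))\<bar> \<le> B2 * ?N powr (1 - a / 4)"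
    proof -
      have "\<bar>(\<Sum>m=1..N. U (x ^ m)) - (\<Sum>m=1..N. G (x ^ m))\<bar> \<le> (\<Sum>m=1..N. \<bar>U (x ^ m) - G (x ^ m)\<bar>)"
        unfolding sum_subtractf[symmetric] by (rule sum_abs)
      also have "\<dots> \<le> (\<Sum>m=1..N. (C2 * ?N powr (a / 4)) * \<psi> (x ^ m))"
      proof (rule sum_mono)
        fix m assume m: "m \<in> {1..N}"
        have "\<bar>U (x ^ m)\<bar> \<le> C2 * real m powr (a / 4)" using C2 m by simp
        also have "\<dots> \<le> C2 * ?N powr (a / 4)" using m a C2p by (intro mult_left_mono powr_mono2) auto
        finally have ub: "\<bar>U (x ^ m)\<bar> \<le> C2 * ?N powr (a / 4)" .
        have "U (x ^ m) - G (x ^ m) = U (x ^ m) * \<psi> (x ^ m)" by (simp add: G_def \<psi>_def algebra_simps)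
        then have "\<bar>U (x ^ m) - G (x ^ m)\<bar> = \<bar>U (x ^ m)\<bar> * \<psi> (x ^ m)" using psi by (simp add: abs_mult)
        also have "\<dots> \<le> (C2 * ?N powr (a / 4)) * \<psi> (x ^ m)" using ub psi by (intro mult_right_mono) auto
        finally show "\<bar>U (x ^ m) - G (x ^ m)\<bar> \<le> (C2 * ?N powr (a / 4)) * \<psi> (x ^ m)" .
      qed
      also have "\<dots> = (C2 * ?N powr (a / 4)) * (\<Sum>m=1..N. \<psi> (x ^ m))" by (simp only: sum_distrib_left)
      also have "\<dots> \<le> (C2 * ?N powr (a / 4)) * ((J + 4 * C0) * ?N powr (1 - a / 2))"
        using cnt C2p by (intro mult_left_mono) auto
      also have "\<dots> = B2 * (?N powr (a / 4) * ?N powr (1 - a / 2))" by (simp only: B2_def mult_ac)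
      also have "?N powr (a / 4) * ?N powr (1 - a / 2) = ?N powr (1 - a / 4)" by (simp flip: powr_add)
      finally show ?thesis .
    qed
    have Gint: "set_integrable lborel {0..1} (\<lambda>s. G (?e s))" by (rule circle_lipschitz_integrable[OF Glip L0])
    have e3: "?N * \<bar>circle_integral U - circle_integral G\<bar> \<le> B3 * ?N powr (1 - a / 4)"
    proof -
      have dI: "set_integrable lborel {0..1} (\<lambda>s. U (?e s) - G (?e s))" by (intro set_integral_diff int Gint)
      have "\<bar>circle_integral U - circle_integral G\<bar> = \<bar>LINT s:{0..1}|lborel. U (?e s) - G (?e s)\<bar>"
        using set_integral_diff(2)[OF int Gint] by simp
      also have "\<dots> \<le> (LINT s:{0..1}|lborel. \<bar>U (?e s) - G (?e s)\<bar>)"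
        using set_integral_norm_bound[OF dI] by simp
      also have "\<dots> \<le> (LINT s:{0..1}|lborel. (C3 * (2 * \<eta>) powr (1 / 4)) * ?d (?e s) powr (- 1 / 2))"
      proof (rule set_integral_mono_AE[OF set_integrable_abs[OF dI] set_integrable_mult_right[OF dint]])
        show "AE s \<in> {0..1} in lborel. \<bar>U (?e s) - G (?e s)\<bar> \<le> (C3 * (2 * \<eta>) powr (1 / 4)) * ?d (?e s) powr (- 1 / 2)"
          using finite_circle_preimage[OF S(1)]
        proof eventually_elim
          case (elim s)
          show ?case
          proof
            assume "s \<in> {0..1}"
            then have zs: "?e s \<notin> S" using elim by blast
            have "\<bar>U (?e s) - G (?e s)\<bar> = \<bar>U (?e s)\<bar> * \<psi> (?e s)"
            proof -
              have "U (?e s) - G (?e s) = U (?e s) * \<psi> (?e s)" by (simp add: G_def \<psi>_def algebra_simps)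
              then show ?thesis using psi by (simp add: abs_mult)
            qed
            also have "\<dots> \<le> (C3 * ?d (?e s) powr (- (1 / 4))) * \<psi> (?e s)"
              using C3(2)[of "?e s"] zs psi by (intro mult_right_mono) auto
            also have "\<dots> = C3 * (\<psi> (?e s) * ?d (?e s) powr (- (1 / 4)))" by simp
            also have "\<dots> \<le> C3 * ((2 * \<eta>) powr (1 / 4) * ?d (?e s) powr (- 1 / 2))"
              using near[OF zs, of "1 / 4"] C3(1) by (intro mult_left_mono) auto
            finally show "\<bar>U (?e s) - G (?e s)\<bar> \<le> (C3 * (2 * \<eta>) powr (1 / 4)) * ?d (?e s) powr (- 1 / 2)" by (simp only: mult.assoc)
          qed
        qed
      qed
      also have "\<dots> = (C3 * (2 * \<eta>) powr (1 / 4)) * J" by (simp add: J_def)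
      also have "\<dots> \<le> (C3 * ?N powr (- a / 4)) * J"
        using two[of "1 / 4"] C3 J by (intro mult_right_mono mult_left_mono) auto
      finally have "?N * \<bar>circle_integral U - circle_integral G\<bar> \<le> ?N * ((C3 * ?N powr (- a / 4)) * J)"
        by (rule mult_left_mono) simp
      also have "\<dots> = B3 * ?N powr (1 - a / 4)"
        using split1[of "a / 4"] by (simp add: B3_def)
      finally show ?thesis .
    qed
    have "\<bar>(\<Sum>m=1..N. U (x ^ m)) - ?N * circle_integral U\<bar> \<le>
      \<bar>(\<Sum>m=1..N. U (x ^ m)) - (\<Sum>m=1..N. G (x ^ m))\<bar> + \<bar>(\<Sum>m=1..N. G (x ^ m)) - ?N * circle_integral G\<bar>
       + \<bar>?N * circle_integral G - ?N * circle_integral U\<bar>" by linarith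
    also have "\<bar>?N * circle_integral G - ?N * circle_integral U\<bar> = ?N * \<bar>circle_integral U - circle_integral G\<bar>"
    proof -
      have "?N * circle_integral G - ?N * circle_integral U = - (?N * (circle_integral U - circle_integral G))"
        by (simp add: algebra_simps)
      then show ?thesis by (simp only: abs_minus abs_mult abs_of_nat)
    qed
    finally show ?thesis using e1 e2 e3 by (simp add: distrib_right)
  qed
  show "\<exists>\<delta> C. 0 < \<delta> \<and> \<delta> < 1 \<and> (\<forall>N. \<bar>(\<Sum>m=1..N. U (x ^ m)) - real N * circle_integral U\<bar> \<le> C * real N powr (1 - \<delta>))"
  proof (rule exI[of _ "a / 4"], rule exI[of _ "B1 + B2 + B3"], intro conjI allI)
    show "0 < a / 4" "a / 4 < 1" using a d0 by auto
    fix N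
    show "\<bar>(\<Sum>m=1..N. U (x ^ m)) - real N * circle_integral U\<bar> \<le> (B1 + B2 + B3) * real N powr (1 - a / 4)"
      using main[of N] by (cases "N = 0") auto
  qed
qed

section \<open>Analytic functions on the circle\<close>

lemma real_power_series_extend:
  fixes c :: "nat \<Rightarrow> complex" and \<phi> :: "real \<Rightarrow> complex"
  assumes s: "\<And>h. \<bar>h\<bar> < r \<Longrightarrow> (\<lambda>k. c k * of_real (h ^ k)) sums \<phi> h" and z: "cmod z < r"
  shows "summable (\<lambda>k. c k * z ^ k)"
proof -
  define h where "h = (cmod z + r) / 2"
  have h: "cmod z < h" "h < r" "0 < h" using z norm_ge_zero[of z] by (auto simp: h_def simp del: norm_ge_zero)
  have "summable (\<lambda>k. c k * complex_of_real h ^ k)"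
    using s[of h] h by (auto simp: sums_iff)
  then show ?thesis by (rule powser_inside) (use h in simp)
qed

text \<open>Both parts use the holomorphic extension given by the same power series. The order of
  vanishing is the index of its first nonzero coefficient; the Lipschitz constant bounds its
  derivative on a smaller closed disc.\<close>

lemma real_analytic_local:
  fixes c :: "nat \<Rightarrow> complex" and \<phi> :: "real \<Rightarrow> complex"
  assumes r: "r > 0" and s: "\<And>h. \<bar>h\<bar> < r \<Longrightarrow> (\<lambda>k. c k * of_real (h ^ k)) sums \<phi> h"
  shows "(\<exists>d>0. \<forall>h. \<bar>h\<bar> < d \<longrightarrow> \<phi> h = 0) \<or>
      (\<exists>k a d. a > 0 \<and> d > 0 \<and> (\<forall>h. \<bar>h\<bar> < d \<longrightarrow> cmod (\<phi> h) \<ge> a * \<bar>h\<bar> ^ k))"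
    "\<exists>d>0. \<exists>B\<ge>0. \<forall>h h'. \<bar>h\<bar> < d \<longrightarrow> \<bar>h'\<bar> < d \<longrightarrow> cmod (\<phi> h - \<phi> h') \<le> B * \<bar>h - h'\<bar>"
proof -
  note summ = real_power_series_extend[of r c \<phi>, OF s]
  define g where "g z = (\<Sum>k. c k * z ^ k)" for z
  have gs: "(\<lambda>k. c k * (w - 0) ^ k) sums g w" if "w \<in> ball 0 r" for w
    using summ[of w] that by (simp add: g_def summable_sums)
  have g\<phi>: "g (of_real h) = \<phi> h" if "\<bar>h\<bar> < r" for h
    using s[OF that] by (simp add: g_def sums_iff)
  show "(\<exists>d>0. \<forall>h. \<bar>h\<bar> < d \<longrightarrow> \<phi> h = 0) \<or>
      (\<exists>k a d. a > 0 \<and> d > 0 \<and> (\<forall>h. \<bar>h\<bar> < d \<longrightarrow> cmod (\<phi> h) \<ge> a * \<bar>h\<bar> ^ k))"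
  proof (cases "\<forall>k. c k = 0")
    case True
    then have "\<phi> h = 0" if "\<bar>h\<bar> < r" for h using s[OF that] by (simp add: sums_iff)
    then show ?thesis using r by blast
  next
    case False
    define k where "k = (LEAST k. c k \<noteq> 0)"
    have ck: "c k \<noteq> 0" using False unfolding k_def by (metis (mono_tags, lifting) LeastI_ex)
    have cl: "c j = 0" if "j < k" for j using not_less_Least[of j "\<lambda>k. c k \<noteq> 0"] that by (auto simp: k_def)
    define \<psi> where "\<psi> z = (\<Sum>j. c (j + k) * z ^ j)" for z
    have shift: "g z = z ^ k * \<psi> z" if z: "cmod z < r" "z \<noteq> 0" for z
    proof -
      have sz: "summable (\<lambda>j. c j * z ^ j)" using summ z by simp
      have "summable (\<lambda>j. c (j + k) * z ^ (j + k))" using summable_iff_shift[of "\<lambda>j. c j * z ^ j" k] sz by simp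
      then have "summable (\<lambda>j. z ^ k * (c (j + k) * z ^ j))" by (simp add: power_add mult_ac)
      then have s1: "summable (\<lambda>j. c (j + k) * z ^ j)" by (rule summable_mult_D) (use z in simp)
      have "g z = (\<Sum>j. c (j + k) * z ^ (j + k)) + (\<Sum>j<k. c j * z ^ j)"
        unfolding g_def by (rule suminf_split_initial_segment[OF sz])
      also have "(\<Sum>j<k. c j * z ^ j) = 0" using cl by simp
      also have "(\<Sum>j. c (j + k) * z ^ (j + k)) = (\<Sum>j. (c (j + k) * z ^ j) * z ^ k)" by (simp add: power_add mult.assoc)
      also have "\<dots> = \<psi> z * z ^ k" unfolding \<psi>_def by (rule suminf_mult2[symmetric, OF s1])
      finally show ?thesis by simp
    qed
    have "(\<psi> \<longlongrightarrow> c (0 + k)) (at 0)"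
    proof (rule powser_limit_0_strong[OF r])
      fix z :: complex assume z: "z \<noteq> 0" "cmod z < r"
      have sz: "summable (\<lambda>j. c j * z ^ j)" using summ z by simp
      have "summable (\<lambda>j. c (j + k) * z ^ (j + k))" using summable_iff_shift[of "\<lambda>j. c j * z ^ j" k] sz by simp
      then have "summable (\<lambda>j. z ^ k * (c (j + k) * z ^ j))" by (simp add: power_add mult_ac)
      then have "summable (\<lambda>j. c (j + k) * z ^ j)" by (rule summable_mult_D) (use z in simp)
      then show "(\<lambda>j. c (j + k) * z ^ j) sums \<psi> z" unfolding \<psi>_def by (rule summable_sums)
    qed
    then have "((\<lambda>z. cmod (\<psi> z)) \<longlongrightarrow> cmod (c k)) (at 0)" by (simp add: tendsto_norm)
    then have "eventually (\<lambda>z. cmod (\<psi> z) > cmod (c k) / 2) (at 0)" by (rule order_tendstoD) (use ck in simp)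
    then obtain d where d: "d > 0" "\<And>z. z \<noteq> 0 \<Longrightarrow> dist z 0 < d \<Longrightarrow> cmod (\<psi> z) > cmod (c k) / 2"
      unfolding eventually_at by auto
    define a where "a = cmod (c k) / 2"
    have "cmod (\<phi> h) \<ge> a * \<bar>h\<bar> ^ k" if h: "\<bar>h\<bar> < min d r" for h
    proof (cases "h = 0")
      case True
      \<comment> \<open>At \<open>h = 0\<close> the lower bound is \<open>a\<close> for
        \<open>k = 0\<close>, as \<open>0 ^ 0 = 1\<close>, and 0 otherwise.\<close>
      show ?thesis
      proof (cases "k = 0")
        case True
        have "\<phi> 0 = g 0" using g\<phi>[of 0] r by simp
        then show ?thesis using \<open>h = 0\<close> True by (simp add: a_def g_def powser_zero)
      qed (use True in \<open>simp add: power_0_left\<close>)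
    next
      case False
      have "\<phi> h = of_real h ^ k * \<psi> (of_real h)" using shift[of "of_real h"] g\<phi>[of h] h False by simp
      then have "cmod (\<phi> h) = \<bar>h\<bar> ^ k * cmod (\<psi> (of_real h))" by (simp add: norm_mult norm_power)
      moreover have "a \<le> cmod (\<psi> (of_real h))" using d(2)[of "of_real h"] h False by (simp add: a_def)
      ultimately show ?thesis using mult_left_mono[of a "cmod (\<psi> (of_real h))" "\<bar>h\<bar> ^ k"] by (simp add: mult.commute)
    qed
    moreover have "a > 0" "min d r > 0" using ck d r by (auto simp: a_def)
    ultimately show ?thesis by blast
  qed
  have hol: "g holomorphic_on ball 0 r" by (rule power_series_holomorphic[OF gs])
  have sub: "cball 0 (r / 2) \<subseteq> ball (0::complex) r" using r by auto
  have "continuous_on (cball 0 (r / 2)) (deriv g)"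
    using holomorphic_on_imp_continuous_on[OF holomorphic_deriv[OF hol open_ball]] sub by (rule continuous_on_subset)
  then have "compact (deriv g ` cball 0 (r / 2))" by (intro compact_continuous_image compact_cball)
  then have "bounded (deriv g ` cball 0 (r / 2))" by (rule compact_imp_bounded)
  then obtain B where B: "B > 0" "\<And>z. z \<in> cball 0 (r / 2) \<Longrightarrow> cmod (deriv g z) \<le> B"
    unfolding bounded_pos by auto
  have "cmod (\<phi> h - \<phi> h') \<le> B * \<bar>h - h'\<bar>" if h: "\<bar>h\<bar> < r / 2" "\<bar>h'\<bar> < r / 2" for h h'
  proof -
    have "cmod (g (of_real h) - g (of_real h')) \<le> B * cmod (of_real h - of_real h')"
    proof (rule field_differentiable_bound[of "cball 0 (r / 2)" g "deriv g"])
      fix z :: complex assume "z \<in> cball 0 (r / 2)"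
      then have "z \<in> ball 0 r" using sub by blast
      then show "(g has_field_derivative deriv g z) (at z within cball 0 (r / 2))"
        using holomorphic_derivI[OF hol open_ball] has_field_derivative_at_within by blast
    qed (use B h in auto)
    moreover have "cmod (complex_of_real h - complex_of_real h') = \<bar>h - h'\<bar>" by (metis norm_of_real of_real_diff)
    ultimately show ?thesis using g\<phi> h r by simp
  qed
  then show "\<exists>d>0. \<exists>B\<ge>0. \<forall>h h'. \<bar>h\<bar> < d \<longrightarrow> \<bar>h'\<bar> < d \<longrightarrow> cmod (\<phi> h - \<phi> h') \<le> B * \<bar>h - h'\<bar>"
    using r B by (intro exI[of _ "r / 2"] conjI exI[of _ B]) auto
qed

lemma circle_param:
  assumes "z \<in> sphere 0 1"
  shows "\<exists>t. z = cis t \<and> \<bar>t - t0\<bar> \<le> pi"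
proof -
  let ?a = "Arg (z / cis t0)"
  have n: "cmod (z / cis t0) = 1" using assms by (simp add: norm_divide)
  then have "z / cis t0 \<noteq> 0" by auto
  then have "cis ?a = z / cis t0" using cis_Arg[of "z / cis t0"] n by (simp add: sgn_eq)
  then have "z = cis (t0 + ?a)" by (simp flip: cis_mult)
  moreover have "\<bar>(t0 + ?a) - t0\<bar> \<le> pi" using Arg_bounded[of "z / cis t0"] by auto
  ultimately show ?thesis by blast
qed

text \<open>\<open>circle_dist_ge\<close> bounds the chord below by the arc measured in full turns,
  whence the factor 2 pi. The hypothesis ensures that the arc is the shorter one.\<close>

lemma arc_le_chord:
  assumes "\<bar>t - t'\<bar> \<le> pi"
  shows "\<bar>t - t'\<bar> \<le> 2 * pi * cmod (cis t - cis t')"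
proof -
  have main: "t - t' \<le> 2 * pi * cmod (cis t - cis t')" if "0 \<le> t - t'" "t - t' \<le> pi" for t t'
  proof -
    define s where "s = (t - t') / (2 * pi)"
    have s: "0 \<le> s" "s \<le> 1 / 2" "2 * pi * s = t - t'" using that by (auto simp: s_def field_simps)
    have "s \<le> cmod (cis (2 * pi * s) - 1)" using circle_dist_ge[of s] s by auto
    also have "\<dots> = cmod (cis t - cis t')"
    proof -
      have "cis t - cis t' = cis t' * (cis (t - t') - 1)" by (simp add: right_diff_distrib cis_mult)
      then show ?thesis by (simp add: norm_mult s(3))
    qed
    finally have "2 * pi * s \<le> 2 * pi * cmod (cis t - cis t')" by (intro mult_left_mono) auto
    then show ?thesis using s by simp
  qed
  show ?thesis
  proof (cases "t' \<le> t")
    case True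
    then show ?thesis using main[of t t'] assms by simp
  next
    case False
    then show ?thesis using main[of t' t] assms by (simp add: norm_minus_commute)
  qed
qed

lemma real_analytic_lipschitz:
  assumes f: "real_analytic_on_circle f"
  obtains B where "B \<ge> 0" "\<And>z w. z \<in> sphere 0 1 \<Longrightarrow> w \<in> sphere 0 1 \<Longrightarrow> cmod (f z - f w) \<le> B * cmod (z - w)"
proof -
  have loc: "\<exists>u>0. \<exists>L. L-lipschitz_on (cball z0 u \<inter> sphere 0 1) f" if z0: "z0 \<in> sphere 0 1" for z0
  proof -
    obtain t0 where t0: "z0 = cis t0" using circle_param[OF z0] by blast
    obtain r c where r: "r > 0" and s: "\<And>t. \<bar>t - t0\<bar> < r \<Longrightarrow> (\<lambda>k. c k * of_real ((t - t0) ^ k)) sums f (cis t)"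
      using f unfolding real_analytic_on_circle_def by blast
    have s': "(\<lambda>k. c k * of_real (h ^ k)) sums f (cis (t0 + h))" if "\<bar>h\<bar> < r" for h using s[of "t0 + h"] that by simp
    obtain d B where d: "d > 0" "B \<ge> 0" and B: "\<And>h h'. \<bar>h\<bar> < d \<Longrightarrow> \<bar>h'\<bar> < d \<Longrightarrow> cmod (f (cis (t0 + h)) - f (cis (t0 + h'))) \<le> B * \<bar>h - h'\<bar>"
      using real_analytic_local(2)[of r c "\<lambda>h. f (cis (t0 + h))", OF r s'] by blast
    \<comment> \<open>So small that both parameters stay within \<open>d\<close> of
      \<open>t0\<close>, where the local bound holds, and within pi of each other, where arcs and
      chords are comparable.\<close>
    define u where "u = min d pi / (8 * pi)"
    have u: "u > 0" "2 * pi * u < d" "2 * pi * u \<le> pi / 2" using d by (auto simp: u_def field_simps min_def)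
    have "(B * (2 * pi))-lipschitz_on (cball z0 u \<inter> sphere 0 1) f"
    proof (rule lipschitz_onI)
      fix z w assume zw: "z \<in> cball z0 u \<inter> sphere 0 1" "w \<in> cball z0 u \<inter> sphere 0 1"
      obtain t where t: "z = cis t" "\<bar>t - t0\<bar> \<le> pi" using circle_param[of z t0] zw by blast
      obtain t' where t': "w = cis t'" "\<bar>t' - t0\<bar> \<le> pi" using circle_param[of w t0] zw by blast
      have a: "\<bar>t - t0\<bar> \<le> 2 * pi * u"
      proof -
        have "cmod (cis t - cis t0) \<le> u" using zw t0 t by (simp add: dist_norm norm_minus_commute)
        from order_trans[OF arc_le_chord[OF t(2)] mult_left_mono[OF this]] show ?thesis by simp
      qed
      have b: "\<bar>t' - t0\<bar> \<le> 2 * pi * u"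
      proof -
        have "cmod (cis t' - cis t0) \<le> u" using zw t0 t' by (simp add: dist_norm norm_minus_commute)
        from order_trans[OF arc_le_chord[OF t'(2)] mult_left_mono[OF this]] show ?thesis by simp
      qed
      have "\<bar>t - t'\<bar> \<le> pi" using a b u by linarith
      from arc_le_chord[OF this] have c: "\<bar>t - t'\<bar> \<le> 2 * pi * cmod (z - w)" by (simp add: t t')
      have "cmod (f z - f w) \<le> B * \<bar>t - t'\<bar>" using B[of "t - t0" "t' - t0"] a b u by (simp add: t t')
      also have "\<dots> \<le> B * (2 * pi * cmod (z - w))" using c d by (intro mult_left_mono) auto
      finally show "dist (f z) (f w) \<le> B * (2 * pi) * dist z w" by (simp add: dist_norm mult.assoc)
    qed (use d in simp)
    then show ?thesis using u by blast
  qed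
  \<comment> \<open>A one-point parameter set specialises the compactness result for families of
    functions to \<open>f\<close>.\<close>
  have "local_lipschitz {0::real} (sphere 0 1) (\<lambda>_. f)"
    unfolding local_lipschitz_def using loc by blast
  then obtain L where L: "\<And>t. t \<in> {0::real} \<Longrightarrow> L-lipschitz_on (sphere 0 1) f"
    by (rule local_lipschitz_compact_implies_lipschitz[of _ _ "\<lambda>_. f"]) auto
  show ?thesis
  proof (rule that[of L])
    show "L \<ge> 0" using L[of 0] by (auto simp: lipschitz_on_def)
    show "cmod (f z - f w) \<le> L * cmod (z - w)" if "z \<in> sphere 0 1" "w \<in> sphere 0 1" for z w
      using lipschitz_onD[OF L[of 0] that] by (simp add: dist_norm)
  qed
qed

text \<open>
  The parameters near which \<open>f\<close> vanishes identically form an open and closed set of the connected line.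
\<close>

lemma real_analytic_zero_or_order:
  assumes f: "real_analytic_on_circle f"
  shows "(\<forall>z\<in>sphere 0 1. f z = 0) \<or>
    (\<forall>t0. \<exists>k a d. a > 0 \<and> d > 0 \<and> (\<forall>h. \<bar>h\<bar> < d \<longrightarrow> cmod (f (cis (t0 + h))) \<ge> a * \<bar>h\<bar> ^ k))"
proof -
  define A where "A = {t0. \<exists>d>0. \<forall>h. \<bar>h\<bar> < d \<longrightarrow> f (cis (t0 + h)) = 0}"
  have alt: "t0 \<in> A \<or> (\<exists>k a d. a > 0 \<and> d > 0 \<and> (\<forall>h. \<bar>h\<bar> < d \<longrightarrow> cmod (f (cis (t0 + h))) \<ge> a * \<bar>h\<bar> ^ k))" for t0
  proof -
    obtain r c where r: "r > 0" and s: "\<And>t. \<bar>t - t0\<bar> < r \<Longrightarrow> (\<lambda>k. c k * of_real ((t - t0) ^ k)) sums f (cis t)"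
      using f unfolding real_analytic_on_circle_def by blast
    have s': "(\<lambda>k. c k * of_real (h ^ k)) sums f (cis (t0 + h))" if "\<bar>h\<bar> < r" for h using s[of "t0 + h"] that by simp
    show ?thesis using real_analytic_local(1)[of r c "\<lambda>h. f (cis (t0 + h))", OF r s'] unfolding A_def by blast
  qed
  have "open A"
    unfolding open_dist
  proof
    fix t0 assume "t0 \<in> A"
    then obtain d where d: "d > 0" "\<And>h. \<bar>h\<bar> < d \<Longrightarrow> f (cis (t0 + h)) = 0" unfolding A_def by blast
    have "t1 \<in> A" if "dist t1 t0 < d / 2" for t1
    proof -
      have "f (cis (t1 + h)) = 0" if "\<bar>h\<bar> < d / 2" for h
      proof -
        have "\<bar>t1 - t0 + h\<bar> \<le> \<bar>t1 - t0\<bar> + \<bar>h\<bar>" by (rule abs_triangle_ineq)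
        also have "\<dots> < d" using that \<open>dist t1 t0 < d / 2\<close> by (simp add: dist_real_def)
        finally show ?thesis using d(2)[of "t1 - t0 + h"] by simp
      qed
      then show ?thesis unfolding A_def using d by (auto intro!: exI[of _ "d / 2"])
    qed
    then show "\<exists>e>0. \<forall>y. dist y t0 < e \<longrightarrow> y \<in> A" using d by (intro exI[of _ "d / 2"]) auto
  qed
  moreover have "open (- A)"
    unfolding open_dist
  proof
    fix t0 assume t0: "t0 \<in> - A"
    then obtain k a d where d: "a > 0" "d > 0" "\<And>h. \<bar>h\<bar> < d \<Longrightarrow> cmod (f (cis (t0 + h))) \<ge> a * \<bar>h\<bar> ^ k"
      using alt[of t0] by auto
    have "t1 \<in> - A" if "dist t1 t0 < d" for t1
    proof (cases "t1 = t0")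
      case False
      have "a * \<bar>t1 - t0\<bar> ^ k > 0" using False d by simp
      then have nz: "f (cis t1) \<noteq> 0" using d(3)[of "t1 - t0"] that by (auto simp: dist_real_def)
      show ?thesis
      proof
        assume "t1 \<in> A"
        then obtain e where "e > 0" "\<And>h. \<bar>h\<bar> < e \<Longrightarrow> f (cis (t1 + h)) = 0" unfolding A_def by blast
        from this(2)[of 0] this(1) nz show False by simp
      qed
    qed (use t0 in simp)
    then show "\<exists>e>0. \<forall>y. dist y t0 < e \<longrightarrow> y \<in> - A" using d by blast
  qed
  ultimately have "A = {} \<or> A = UNIV" using clopen[of A] closed_def by blast
  then show ?thesis
  proof
    assume "A = {}"
    then show ?thesis using alt by blast
  next
    assume AU: "A = UNIV"
    have "f z = 0" if z: "z \<in> sphere 0 1" for z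
    proof -
      obtain t where t: "z = cis t" using circle_param[OF z] by blast
      have "t \<in> A" using AU by simp
      then obtain e where "e > 0" "\<And>h. \<bar>h\<bar> < e \<Longrightarrow> f (cis (t + h)) = 0" unfolding A_def by blast
      from this(2)[of 0] this(1) show ?thesis by (simp add: t)
    qed
    then show ?thesis by blast
  qed
qed

text \<open>Near each point of the circle |f| is bounded below either by a constant or by a power of
  the distance to a zero. A finite subcover leaves one exponent, the largest order involved; halving
  makes the distance at most 1, so that a larger exponent only weakens the bound.\<close>

lemma real_analytic_lower_bound:
  assumes f: "real_analytic_on_circle f" and nz: "\<not> (\<forall>z\<in>sphere 0 1. f z = 0)"
  obtains Z K a where "finite Z" "1 \<in> Z" "Z \<subseteq> sphere 0 1" "\<And>z. z \<in> Z \<Longrightarrow> z \<noteq> 1 \<Longrightarrow> f z = 0" "a > 0"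
    "\<And>z. z \<in> sphere 0 1 \<Longrightarrow> cmod (f z) \<ge> a * (infdist z Z / 2) ^ K"
proof -
  obtain B where B: "B \<ge> 0" "\<And>z w. z \<in> sphere 0 1 \<Longrightarrow> w \<in> sphere 0 1 \<Longrightarrow> cmod (f z - f w) \<le> B * cmod (z - w)"
    using real_analytic_lipschitz[OF f] by blast
  have loc: "\<exists>u k a. u > 0 \<and> a > 0 \<and> (\<forall>z\<in>sphere 0 1 \<inter> ball w u. if f w = 0 then cmod (f z) \<ge> a * dist z w ^ k else cmod (f z) \<ge> a)"
    if w: "w \<in> sphere 0 1" for w
  proof (cases "f w = 0")
    case True
    obtain t0 where t0: "w = cis t0" using circle_param[OF w] by blast
    obtain k a d where d: "a > 0" "d > 0" "\<And>h. \<bar>h\<bar> < d \<Longrightarrow> cmod (f (cis (t0 + h))) \<ge> a * \<bar>h\<bar> ^ k"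
      using real_analytic_zero_or_order[OF f] nz by blast
    have "cmod (f z) \<ge> a * dist z w ^ k" if z: "z \<in> sphere 0 1 \<inter> ball w (d / (2 * pi))" for z
    proof -
      obtain t where t: "z = cis t" "\<bar>t - t0\<bar> \<le> pi" using circle_param[of z t0] z by blast
      have "\<bar>t - t0\<bar> \<le> 2 * pi * cmod (z - w)" using arc_le_chord[OF t(2)] by (simp add: t t0)
      also have "\<dots> < d" using z by (simp add: dist_norm norm_minus_commute field_simps)
      finally have "cmod (f z) \<ge> a * \<bar>t - t0\<bar> ^ k" using d(3)[of "t - t0"] by (simp add: t)
      moreover have "dist z w ^ k \<le> \<bar>t - t0\<bar> ^ k"
        using cis_diff_le[of t t0] by (intro power_mono) (auto simp: t t0 dist_norm)
      ultimately show ?thesis using mult_left_mono[of "dist z w ^ k" "\<bar>t - t0\<bar> ^ k" a] d by linarith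
    qed
    moreover have "d / (2 * pi) > 0" using d by simp
    ultimately show ?thesis using True d by (intro exI[of _ "d / (2 * pi)"] exI[of _ k] exI[of _ a]) auto
  next
    case False
    define a where "a = cmod (f w) / 2"
    have a: "a > 0" using False by (simp add: a_def)
    have "cmod (f z) \<ge> a" if z: "z \<in> sphere 0 1 \<inter> ball w (a / (B + 1))" for z
    proof -
      have "cmod (f w - f z) \<le> B * cmod (w - z)" using B w z by auto
      also have "\<dots> \<le> (B + 1) * cmod (w - z)" by (simp add: distrib_right)
      also have "\<dots> \<le> a" using z B by (simp add: dist_norm field_simps)
      finally have "cmod (f w) - cmod (f z) \<le> a" using norm_triangle_ineq2[of "f w" "f z"] by linarith
      then show ?thesis by (simp add: a_def)
    qed
    then show ?thesis using False a B by (intro exI[of _ "a / (B + 1)"] exI[of _ 0] exI[of _ a]) auto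
  qed
  then obtain u k a where L: "\<And>w. w \<in> sphere 0 1 \<Longrightarrow> u w > 0 \<and> a w > 0 \<and>
      (\<forall>z\<in>sphere 0 1 \<inter> ball w (u w). if f w = 0 then cmod (f z) \<ge> a w * dist z w ^ k w else cmod (f z) \<ge> a w)"
    by metis
  have "compact (sphere (0::complex) 1)" by simp
  then obtain F where F: "F \<subseteq> sphere 0 1" "finite F" "sphere 0 1 \<subseteq> (\<Union>w\<in>F. ball w (u w))"
  proof (rule compactE_image[of "sphere 0 1" "sphere 0 1" "\<lambda>w. ball w (u w)"])
    show "sphere 0 1 \<subseteq> (\<Union>w\<in>sphere 0 1. ball w (u w))" using L centre_in_ball by blast
  qed (use that in auto)
  have Fne: "F \<noteq> {}"
  proof
    assume "F = {}"
    then have "(1::complex) \<in> {}" using F(3) by auto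
    then show False by simp
  qed
  \<comment> \<open>The point 1 keeps \<open>Z\<close> nonempty, so that \<open>infdist\<close> is
    meaningful. It is itself a root of unity, hence \<open>Z\<close> consists of roots of unity
    whenever the zeros of \<open>f\<close> do.\<close>
  define Z where "Z = insert 1 {w \<in> F. f w = 0}"
  define K where "K = Max (k ` F)"
  define A where "A = Min (a ` F)"
  have Z: "finite Z" "1 \<in> Z" "Z \<noteq> {}" "Z \<subseteq> sphere 0 1" using F by (auto simp: Z_def)
  have A: "A > 0" unfolding A_def using F Fne L by (subst Min_gr_iff) auto
  have Al: "A \<le> a w" "k w \<le> K" if "w \<in> F" for w using that F by (auto simp: A_def K_def)
  show ?thesis
  proof (rule that[OF Z(1,2,4) _ A])
    show "f z = 0" if "z \<in> Z" "z \<noteq> 1" for z using that by (auto simp: Z_def)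
    fix z :: complex assume z: "z \<in> sphere 0 1"
    let ?d = "infdist z Z / 2"
    have d: "0 \<le> ?d" "?d \<le> 1" using infdist_circle_le_2[OF Z(3,4) z] by (auto simp: infdist_nonneg)
    obtain w where w: "w \<in> F" "z \<in> ball w (u w)" using F z by blast
    have Lw: "if f w = 0 then cmod (f z) \<ge> a w * dist z w ^ k w else cmod (f z) \<ge> a w"
      using L[of w] w F z by blast
    have aw: "a w > 0" using L w F by blast
    show "cmod (f z) \<ge> A * ?d ^ K"
    proof (cases "f w = 0")
      case True
      have "w \<in> Z" using True w by (simp add: Z_def)
      then have "infdist z Z \<le> dist z w" by (rule infdist_le)
      then have dw: "?d \<le> dist z w" using infdist_nonneg[of z Z] by linarith
      have "A * ?d ^ K \<le> a w * ?d ^ k w" using Al[OF w(1)] d A by (intro mult_mono power_decreasing) auto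
      also have "\<dots> \<le> a w * dist z w ^ k w" using dw d aw by (intro mult_left_mono power_mono) auto
      finally show ?thesis using Lw True by simp
    next
      case False
      have "A * ?d ^ K \<le> a w * 1" using Al[OF w(1)] d A by (intro mult_mono power_le_one) auto
      then show ?thesis using Lw False by simp
    qed
  qed
qed

text \<open>The expansion is in a real variable, so the imaginary parts of the coefficients expand
  Im f. The jumps of arg f are located among the zeros of this function.\<close>

lemma real_analytic_Im:
  assumes f: "real_analytic_on_circle f"
  shows "real_analytic_on_circle (\<lambda>z. complex_of_real (Im (f z)))"
  unfolding real_analytic_on_circle_def
proof
  fix t0
  obtain r c where r: "r > 0" and s: "\<And>t. \<bar>t - t0\<bar> < r \<Longrightarrow> (\<lambda>k. c k * of_real ((t - t0) ^ k)) sums f (cis t)"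
    using f unfolding real_analytic_on_circle_def by blast
  have "(\<lambda>k. of_real (Im (c k)) * of_real ((t - t0) ^ k)) sums complex_of_real (Im (f (cis t)))" if "\<bar>t - t0\<bar> < r" for t
  proof -
    have "(\<lambda>k. Im (c k * of_real ((t - t0) ^ k))) sums Im (f (cis t))" using s[OF that] by (rule sums_Im)
    then have "(\<lambda>k. Im (c k) * (t - t0) ^ k) sums Im (f (cis t))" by (simp del: of_real_power)
    then have "(\<lambda>k. complex_of_real (Im (c k) * (t - t0) ^ k)) sums complex_of_real (Im (f (cis t)))" by (rule sums_of_real)
    then show ?thesis by simp
  qed
  then show "\<exists>r>0. \<exists>c. \<forall>t. \<bar>t - t0\<bar> < r \<longrightarrow> (\<lambda>k. c k * of_real ((t - t0) ^ k)) sums complex_of_real (Im (f (cis t)))"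
    using r by (intro exI[of _ r] conjI exI[of _ "\<lambda>k. of_real (Im (c k))"]) auto
qed

section \<open>Singularities of the logarithm along the circle\<close>

lemma mild_singularitiesI:
  assumes "\<And>\<epsilon>. \<epsilon> > 0 \<Longrightarrow> \<exists>C. \<forall>z\<in>sphere 0 1 - S. \<bar>U z\<bar> \<le> C * infdist z S powr (- \<epsilon>)"
    and "\<And>\<eta> z w. 0 < \<eta> \<Longrightarrow> \<eta> < 1 \<Longrightarrow> z \<in> sphere 0 1 \<Longrightarrow> w \<in> sphere 0 1 \<Longrightarrow> infdist z S \<ge> \<eta> \<Longrightarrow>
       infdist w S \<ge> \<eta> \<Longrightarrow> \<bar>U z - U w\<bar> \<le> C * cmod (z - w) / \<eta> ^ K"
  shows "mild_singularities S U"
  unfolding mild_singularities_def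
proof (rule conjI, use assms(1) in blast, rule exI[of _ "real K"], rule conjI, simp, rule exI[of _ C], intro allI impI ballI)
  fix \<eta> :: real and z w :: complex
  assume *: "0 < \<eta>" "\<eta> < 1" "z \<in> sphere 0 1" "w \<in> sphere 0 1" "\<eta> \<le> infdist z S" "\<eta> \<le> infdist w S"
  have "\<eta> powr (- real K) = 1 / \<eta> ^ K" using * by (simp add: powr_minus powr_realpow divide_inverse)
  then show "\<bar>U z - U w\<bar> \<le> C * \<eta> powr (- real K) * cmod (z - w)" using assms(2)[OF *] by simp
qed

lemma ln_inverse_le_powr:
  fixes y :: real
  assumes "0 < y" "\<epsilon> > 0"
  shows "- ln y \<le> y powr (- \<epsilon>) / \<epsilon>"
proof -
  have "ln (y powr (- \<epsilon>)) \<le> y powr (- \<epsilon>) - 1" using assms by (intro ln_le_minus_one) simp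
  then have "\<epsilon> * (- ln y) \<le> y powr (- \<epsilon>)" using assms by (simp add: ln_powr)
  then show ?thesis using assms by (simp add: pos_le_divide_eq mult.commute)
qed

lemma circle_bounded_if_lipschitz:
  assumes "B \<ge> 0" "\<And>z w. z \<in> sphere 0 1 \<Longrightarrow> w \<in> sphere 0 1 \<Longrightarrow> cmod (f z - f w) \<le> B * cmod (z - w)" "z \<in> sphere 0 1"
  shows "cmod (f z) \<le> cmod (f 1) + 2 * B"
proof -
  have "cmod (f z - f 1) \<le> B * cmod (z - 1)" using assms by auto
  also have "\<dots> \<le> B * 2" using assms norm_triangle_ineq4[of z 1] by (intro mult_left_mono) auto
  finally show ?thesis using norm_triangle_ineq2[of "f z" "f 1"] by linarith
qed

text \<open>The lower bound turns -ln |f| into a constant plus K times the logarithm of the inverse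
  distance, which is below every power. Away from \<open>Z\<close> the values |f| exceed some m
  polynomial in \<eta>, and ln is Lipschitz with constant 1 / m there.\<close>

lemma mild_singularities_ln_cmod:
  assumes f: "real_analytic_on_circle f" and Z: "finite Z" "Z \<noteq> {}" "Z \<subseteq> sphere 0 1" and a: "a > 0"
    and low: "\<And>z. z \<in> sphere 0 1 \<Longrightarrow> cmod (f z) \<ge> a * (infdist z Z / 2) ^ K"
  shows "mild_singularities Z (\<lambda>z. ln (cmod (f z)))"
proof -
  obtain B where B: "B \<ge> 0" "\<And>z w. z \<in> sphere 0 1 \<Longrightarrow> w \<in> sphere 0 1 \<Longrightarrow> cmod (f z - f w) \<le> B * cmod (z - w)"
    using real_analytic_lipschitz[OF f] by blast
  define M where "M = cmod (f 1) + 2 * B + 1"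
  have M: "M \<ge> 1" "\<And>z. z \<in> sphere 0 1 \<Longrightarrow> cmod (f z) \<le> M"
    using circle_bounded_if_lipschitz[OF B] B by (force simp: M_def)+
  show ?thesis
  proof (rule mild_singularitiesI)
    fix \<epsilon> :: real assume e: "\<epsilon> > 0"
    define A where "A = ln M + \<bar>ln a\<bar>"
    define C where "C = A + real K / \<epsilon>"
    have A: "A \<ge> 0" "ln M \<le> A" "- ln a \<le> A" using ln_ge_zero[OF M(1)] unfolding A_def by linarith+
    have "\<bar>ln (cmod (f z))\<bar> \<le> (C * 2 powr \<epsilon>) * infdist z Z powr (- \<epsilon>)" if z: "z \<in> sphere 0 1 - Z" for z
    proof -
      define y where "y = infdist z Z / 2"
      have y: "0 < y" "y \<le> 1"
        using infdist_finite_pos[OF Z(1,2), of z] infdist_circle_le_2[OF Z(2,3), of z] z by (auto simp: y_def)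
      have fl: "a * y ^ K \<le> cmod (f z)" using low[of z] z by (simp add: y_def)
      have fp: "0 < a * y ^ K" using a y by simp
      have "ln (cmod (f z)) \<le> ln M" using M(2)[of z] z fl fp by (intro ln_mono) auto
      moreover have "- ln (cmod (f z)) \<le> - ln (a * y ^ K)" using ln_mono[OF fl] fl fp by simp
      moreover have "- ln (a * y ^ K) = - ln a + real K * (- ln y)" using a y by (simp add: ln_mult ln_realpow)
      moreover have "real K * (- ln y) \<le> real K * (y powr (- \<epsilon>) / \<epsilon>)" using ln_inverse_le_powr[OF y(1) e] by (intro mult_left_mono) auto
      moreover have one: "1 \<le> y powr (- \<epsilon>)" using powr_mono_both'[of "0" "\<epsilon>" y 1] y e by (simp add: powr_minus powr_le1 one_le_inverse_iff)
      moreover have "A * 1 \<le> A * y powr (- \<epsilon>)" using one A by (intro mult_left_mono) auto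
      moreover have "0 \<le> real K * (y powr (- \<epsilon>) / \<epsilon>)" using e by simp
      ultimately have "\<bar>ln (cmod (f z))\<bar> \<le> A * y powr (- \<epsilon>) + real K * (y powr (- \<epsilon>) / \<epsilon>)" using A by linarith
      also have "\<dots> = C * y powr (- \<epsilon>)" by (simp add: C_def algebra_simps)
      also have "y powr (- \<epsilon>) = 2 powr \<epsilon> * infdist z Z powr (- \<epsilon>)"
        unfolding y_def by (subst powr_divide) (simp add: powr_minus divide_inverse)
      finally show ?thesis by (simp add: mult.assoc)
    qed
    then show "\<exists>C. \<forall>z\<in>sphere 0 1 - Z. \<bar>ln (cmod (f z))\<bar> \<le> C * infdist z Z powr (- \<epsilon>)" by blast
  next
    fix \<eta> :: real and z w :: complex
    assume *: "0 < \<eta>" "\<eta> < 1" "z \<in> sphere 0 1" "w \<in> sphere 0 1" "\<eta> \<le> infdist z Z" "\<eta> \<le> infdist w Z"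
    define m where "m = a * (\<eta> / 2) ^ K"
    have m: "m > 0" using a * by (simp add: m_def)
    have mb: "m \<le> cmod (f v)" if "v \<in> sphere 0 1" "\<eta> \<le> infdist v Z" for v
    proof -
      have "m \<le> a * (infdist v Z / 2) ^ K" unfolding m_def using a * that by (intro mult_left_mono power_mono) auto
      then show ?thesis using low[OF that(1)] by linarith
    qed
    have lnl: "ln p - ln q \<le> (p - q) / m" if "q \<le> p" "m \<le> q" for p q
    proof -
      have "ln p - ln q = ln (p / q)" using that m by (simp add: ln_div)
      also have "\<dots> \<le> p / q - 1" using that m by (intro ln_le_minus_one) auto
      also have "\<dots> = (p - q) / q" using that m by (simp add: field_simps)
      also have "\<dots> \<le> (p - q) / m" using that m by (intro divide_left_mono) auto
      finally show ?thesis .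
    qed
    have "\<bar>ln (cmod (f z)) - ln (cmod (f w))\<bar> \<le> \<bar>cmod (f z) - cmod (f w)\<bar> / m"
    proof (cases "cmod (f w) \<le> cmod (f z)")
      case True
      then have "ln (cmod (f w)) \<le> ln (cmod (f z))" using mb[OF *(4,6)] m by (intro ln_mono) auto
      then show ?thesis using lnl[OF True mb[OF *(4,6)]] True by simp
    next
      case False
      then have "ln (cmod (f z)) \<le> ln (cmod (f w))" using mb[OF *(3,5)] m by (intro ln_mono) auto
      then show ?thesis using lnl[OF _ mb[OF *(3,5)], of "cmod (f w)"] False by simp
    qed
    also have "\<dots> \<le> B * cmod (z - w) / m"
      using order_trans[OF norm_triangle_ineq3 B(2)[OF *(3,4)]] m by (intro divide_right_mono) auto
    also have "\<dots> = (B * 2 ^ K / a) * cmod (z - w) / \<eta> ^ K" by (simp add: m_def power_divide)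
    finally show "\<bar>ln (cmod (f z)) - ln (cmod (f w))\<bar> \<le> (B * 2 ^ K / a) * cmod (z - w) / \<eta> ^ K" .
  qed
qed

lemma abs_Im_Ln_le: "w \<noteq> 0 \<Longrightarrow> \<bar>Im (Ln w)\<bar> \<le> pi"
  using mpi_less_Im_Ln[of w] Im_Ln_le_pi[of w] by linarith

lemma Ln_lipschitz_convex:
  assumes "convex X" "\<And>v. v \<in> X \<Longrightarrow> v \<notin> \<real>\<^sub>\<le>\<^sub>0 \<and> m \<le> cmod v" "m > 0" "p \<in> X" "q \<in> X"
  shows "cmod (Ln p - Ln q) \<le> 1 / m * cmod (p - q)"
proof (rule field_differentiable_bound[OF assms(1), of Ln "\<lambda>v. inverse v"])
  fix v assume v: "v \<in> X"
  then have "v \<noteq> 0" using assms(2)[OF v] assms(3) by auto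
  show "(Ln has_field_derivative inverse v) (at v within X)"
    using assms(2)[OF v] has_field_derivative_at_within has_field_derivative_Ln by blast
  have "m \<le> cmod v" "0 < cmod v" using assms(2)[OF v] \<open>v \<noteq> 0\<close> by auto
  then have "1 / cmod v \<le> 1 / m" using assms(3) by (intro divide_left_mono) auto
  then show "cmod (inverse v) \<le> 1 / m" by (simp add: norm_divide inverse_eq_divide)
qed (use assms in auto)

text \<open>On one side of the real axis the points lie in a convex half-plane where Ln is Lipschitz
  with constant 1 / m. On opposite sides they are at least 2 m apart, and the trivial bound 2 pi for
  the difference of the arguments is good enough. On the real line the argument is constant, 0 or
  pi, on each half-line.\<close>

lemma Im_Ln_lipschitz:
  assumes m: "m > 0" and pq: "(m \<le> \<bar>Im p\<bar> \<and> m \<le> \<bar>Im q\<bar>) \<or> (Im p = 0 \<and> Im q = 0 \<and> m \<le> \<bar>Re p\<bar> \<and> m \<le> \<bar>Re q\<bar>)"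
  shows "\<bar>Im (Ln p) - Im (Ln q)\<bar> \<le> 2 * pi / m * cmod (p - q)"
proof -
  have far: ?thesis if "2 * m \<le> cmod (p - q)"
  proof -
    have "\<bar>Im (Ln p) - Im (Ln q)\<bar> \<le> 2 * pi" using pq m by (intro order_trans[OF abs_triangle_ineq4]) (smt (verit) abs_Im_Ln_le zero_complex.sel)
    also have "\<dots> \<le> 2 * pi / m * (2 * m)" using m by simp
    also have "\<dots> \<le> 2 * pi / m * cmod (p - q)" using that m by (intro mult_left_mono) auto
    finally show ?thesis .
  qed
  have close: ?thesis if "cmod (Ln p - Ln q) \<le> 1 / m * cmod (p - q)"
  proof -
    have "\<bar>Im (Ln p) - Im (Ln q)\<bar> \<le> cmod (Ln p - Ln q)" using abs_Im_le_cmod[of "Ln p - Ln q"] by simp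
    also have "\<dots> \<le> 1 / m * cmod (p - q)" by (rule that)
    also have "\<dots> \<le> 2 * pi / m * cmod (p - q)" using m pi_ge_two by (intro mult_right_mono divide_right_mono) auto
    finally show ?thesis .
  qed
  from pq show ?thesis
  proof
    assume I: "m \<le> \<bar>Im p\<bar> \<and> m \<le> \<bar>Im q\<bar>"
    have ge: "m \<le> cmod v" if "m \<le> \<bar>Im v\<bar>" for v using that abs_Im_le_cmod[of v] by linarith
    consider "m \<le> Im p" "m \<le> Im q" | "Im p \<le> - m" "Im q \<le> - m" | "2 * m \<le> \<bar>Im p - Im q\<bar>"
      using I m by linarith
    then show ?thesis
    proof cases
      case 1
      show ?thesis
      proof (rule close, rule Ln_lipschitz_convex)
        show "convex {v. m \<le> Im v}" using convex_halfspace_Im_ge[of m] by simp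
        show "v \<notin> \<real>\<^sub>\<le>\<^sub>0 \<and> m \<le> cmod v" if "v \<in> {v. m \<le> Im v}" for v
          using that m ge[of v] by (auto simp: complex_nonpos_Reals_iff)
      qed (use 1 m in auto)
    next
      case 2
      show ?thesis
      proof (rule close, rule Ln_lipschitz_convex)
        show "convex {v. Im v \<le> - m}" using convex_halfspace_Im_le[of "- m"] by simp
        show "v \<notin> \<real>\<^sub>\<le>\<^sub>0 \<and> m \<le> cmod v" if "v \<in> {v. Im v \<le> - m}" for v
          using that m ge[of v] by (auto simp: complex_nonpos_Reals_iff)
      qed (use 2 m in auto)
    next
      case 3
      then show ?thesis using far abs_Im_le_cmod[of "p - q"] by simp
    qed
  next
    assume R: "Im p = 0 \<and> Im q = 0 \<and> m \<le> \<bar>Re p\<bar> \<and> m \<le> \<bar>Re q\<bar>"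
    then have pr: "p = of_real (Re p)" "q = of_real (Re q)" by (auto simp: complex_eq_iff)
    have pos: "Im (Ln (of_real y)) = 0" if "y > 0" for y :: real using that by (simp add: Ln_of_real)
    have neg: "Im (Ln (of_real y)) = pi" if "y < 0" for y :: real using that Im_Ln_eq_pi[of "of_real y"] by (simp add: Im_Ln_eq_pi_half)
    consider "Re p > 0" "Re q > 0" | "Re p < 0" "Re q < 0" | "2 * m \<le> \<bar>Re p - Re q\<bar>" using R m by linarith
    then show ?thesis
    proof cases
      case 1
      then have "Im (Ln p) = Im (Ln q)" using pos pr by metis
      then show ?thesis using m by simp
    next
      case 2
      then have "Im (Ln p) = Im (Ln q)" using neg pr by metis
      then show ?thesis using m by simp
    next
      case 3
      then show ?thesis using far abs_Re_le_cmod[of "p - q"] by simp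
    qed
  qed
qed

text \<open>The argument can jump only at zeros of Im f, and analyticity gives a lower bound for |Im
  f| away from a finite set. If Im f vanishes identically, the argument is 0 or pi and changes only
  at zeros of f. Nothing is said about \<open>Z\<close> being made of roots of unity; the bound pi
  on the argument compensates for that later.\<close>

lemma mild_singularities_Im_Ln:
  assumes f: "real_analytic_on_circle f" and nz: "\<not> (\<forall>z\<in>sphere 0 1. f z = 0)"
  obtains Z where "finite Z" "Z \<noteq> {}" "Z \<subseteq> sphere 0 1" "mild_singularities Z (\<lambda>z. Im (Ln (f z)))"
proof -
  obtain B where B: "B \<ge> 0" "\<And>z w. z \<in> sphere 0 1 \<Longrightarrow> w \<in> sphere 0 1 \<Longrightarrow> cmod (f z - f w) \<le> B * cmod (z - w)"
    using real_analytic_lipschitz[OF f] by blast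
  have "\<exists>Z K a. finite Z \<and> Z \<noteq> {} \<and> Z \<subseteq> sphere 0 1 \<and> a > 0 \<and>
    ((\<forall>z\<in>sphere 0 1. a * (infdist z Z / 2) ^ K \<le> \<bar>Im (f z)\<bar>) \<or>
     (\<forall>z\<in>sphere 0 1. Im (f z) = 0 \<and> a * (infdist z Z / 2) ^ K \<le> \<bar>Re (f z)\<bar>))"
  proof (cases "\<forall>z\<in>sphere 0 1. Im (f z) = 0")
    case True
    obtain Z K a where Z: "finite Z" "1 \<in> Z" "Z \<subseteq> sphere 0 1" "a > 0"
      "\<And>z. z \<in> sphere 0 1 \<Longrightarrow> cmod (f z) \<ge> a * (infdist z Z / 2) ^ K"
      by (rule real_analytic_lower_bound[OF f nz]) blast
    have "cmod (f z) = \<bar>Re (f z)\<bar>" if "z \<in> sphere 0 1" for z using True that by (simp add: cmod_eq_Re)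
    then have "\<forall>z\<in>sphere 0 1. Im (f z) = 0 \<and> a * (infdist z Z / 2) ^ K \<le> \<bar>Re (f z)\<bar>" using Z(5) True by simp
    then show ?thesis using Z(1-4) by blast
  next
    case False
    then have nz': "\<not> (\<forall>z\<in>sphere 0 1. complex_of_real (Im (f z)) = 0)" by simp
    obtain Z K a where Z: "finite Z" "1 \<in> Z" "Z \<subseteq> sphere 0 1" "a > 0"
      "\<And>z. z \<in> sphere 0 1 \<Longrightarrow> cmod (complex_of_real (Im (f z))) \<ge> a * (infdist z Z / 2) ^ K"
      by (rule real_analytic_lower_bound[OF real_analytic_Im[OF f] nz']) blast
    have "\<forall>z\<in>sphere 0 1. a * (infdist z Z / 2) ^ K \<le> \<bar>Im (f z)\<bar>" using Z(5) by simp
    then show ?thesis using Z(1-4) by blast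
  qed
  then obtain Z K a where Z: "finite Z" "Z \<noteq> {}" "Z \<subseteq> sphere 0 1" and a: "a > 0" and
    low: "(\<forall>z\<in>sphere 0 1. a * (infdist z Z / 2) ^ K \<le> \<bar>Im (f z)\<bar>) \<or>
     (\<forall>z\<in>sphere 0 1. Im (f z) = 0 \<and> a * (infdist z Z / 2) ^ K \<le> \<bar>Re (f z)\<bar>)" by blast
  have "mild_singularities Z (\<lambda>z. Im (Ln (f z)))"
  proof (rule mild_singularitiesI)
    fix \<epsilon> :: real assume e: "\<epsilon> > 0"
    have "\<bar>Im (Ln (f z))\<bar> \<le> (pi * 2 powr \<epsilon>) * infdist z Z powr (- \<epsilon>)" if z: "z \<in> sphere 0 1 - Z" for z
    proof -
      have d: "0 < infdist z Z" "infdist z Z \<le> 2"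
        using infdist_finite_pos[OF Z(1,2), of z] infdist_circle_le_2[OF Z(2,3), of z] z by auto
      have "1 = 2 powr \<epsilon> * (2::real) powr (- \<epsilon>)" by (simp flip: powr_add)
      also have "\<dots> \<le> 2 powr \<epsilon> * infdist z Z powr (- \<epsilon>)" using d e by (intro mult_left_mono powr_mono2') auto
      finally have "pi * 1 \<le> pi * (2 powr \<epsilon> * infdist z Z powr (- \<epsilon>))" by (rule mult_left_mono) simp
      moreover have "0 < a * (infdist z Z / 2) ^ K" using a d by simp
      then have "f z \<noteq> 0" using low z by fastforce
      then have "\<bar>Im (Ln (f z))\<bar> \<le> pi" by (rule abs_Im_Ln_le)
      ultimately show ?thesis unfolding mult_1_right mult.assoc by (rule order_trans[rotated])
    qed
    then show "\<exists>C. \<forall>z\<in>sphere 0 1 - Z. \<bar>Im (Ln (f z))\<bar> \<le> C * infdist z Z powr (- \<epsilon>)" by blast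
  next
    fix \<eta> :: real and z w :: complex
    assume *: "0 < \<eta>" "\<eta> < 1" "z \<in> sphere 0 1" "w \<in> sphere 0 1" "\<eta> \<le> infdist z Z" "\<eta> \<le> infdist w Z"
    define m where "m = a * (\<eta> / 2) ^ K"
    have m: "m > 0" using a * by (simp add: m_def)
    have mb: "m \<le> a * (infdist v Z / 2) ^ K" if "\<eta> \<le> infdist v Z" for v
      unfolding m_def using a * that by (intro mult_left_mono power_mono) auto
    have "(m \<le> \<bar>Im (f z)\<bar> \<and> m \<le> \<bar>Im (f w)\<bar>) \<or> (Im (f z) = 0 \<and> Im (f w) = 0 \<and> m \<le> \<bar>Re (f z)\<bar> \<and> m \<le> \<bar>Re (f w)\<bar>)"
      using low * order_trans[OF mb[OF *(5)]] order_trans[OF mb[OF *(6)]] by blast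
    from Im_Ln_lipschitz[OF m this]
    have "\<bar>Im (Ln (f z)) - Im (Ln (f w))\<bar> \<le> 2 * pi / m * cmod (f z - f w)" .
    also have "\<dots> \<le> 2 * pi / m * (B * cmod (z - w))" using B(2)[OF *(3,4)] m by (intro mult_left_mono) auto
    also have "\<dots> = (2 * pi * B * 2 ^ K / a) * cmod (z - w) / \<eta> ^ K" by (simp add: m_def power_divide)
    finally show "\<bar>Im (Ln (f z)) - Im (Ln (f w))\<bar> \<le> (2 * pi * B * 2 ^ K / a) * cmod (z - w) / \<eta> ^ K" .
  qed
  then show ?thesis using that Z by blast
qed

section \<open>Growth along the orbit\<close>

definition subpolynomial :: "(nat \<Rightarrow> real) \<Rightarrow> bool" where
  "subpolynomial u \<longleftrightarrow> (\<forall>\<epsilon>>0. \<exists>C. \<forall>m\<ge>1. \<bar>u m\<bar> \<le> C * real m powr \<epsilon>)"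

lemma subpolynomial_bounded:
  assumes "\<And>m. m \<ge> 1 \<Longrightarrow> \<bar>u m\<bar> \<le> c"
  shows "subpolynomial u"
  unfolding subpolynomial_def
proof (intro allI impI exI[of _ c])
  fix \<epsilon> :: real and m :: nat assume "\<epsilon> > 0" "m \<ge> 1"
  then have "1 \<le> real m powr \<epsilon>" by (simp add: ge_one_powr_ge_zero)
  moreover have "0 \<le> c" using assms[of m] \<open>m \<ge> 1\<close> by linarith
  ultimately have "c * 1 \<le> c * real m powr \<epsilon>" by (intro mult_left_mono) auto
  then show "\<bar>u m\<bar> \<le> c * real m powr \<epsilon>" using assms[of m] \<open>m \<ge> 1\<close> by linarith
qed

lemma subpolynomial_power:
  assumes "subpolynomial u"
  shows "subpolynomial (\<lambda>m. u m ^ Suc n)"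
  unfolding subpolynomial_def
proof (intro allI impI)
  fix \<epsilon> :: real assume "\<epsilon> > 0"
  then have "\<epsilon> / real (Suc n) > 0" by simp
  then obtain C where C: "\<And>m. m \<ge> 1 \<Longrightarrow> \<bar>u m\<bar> \<le> C * real m powr (\<epsilon> / real (Suc n))"
    using assms unfolding subpolynomial_def by blast
  have "\<bar>u m ^ Suc n\<bar> \<le> C ^ Suc n * real m powr \<epsilon>" if "m \<ge> 1" for m
  proof -
    have "\<bar>u m ^ Suc n\<bar> = \<bar>u m\<bar> ^ Suc n" by (rule power_abs)
    also have "\<dots> \<le> (C * real m powr (\<epsilon> / real (Suc n))) ^ Suc n" using C[OF that] by (intro power_mono) auto
    also have "\<dots> = C ^ Suc n * (real m powr (\<epsilon> / real (Suc n))) ^ Suc n" by (rule power_mult_distrib)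
    also have "(real m powr (\<epsilon> / real (Suc n))) ^ Suc n = real m powr \<epsilon>"
    proof -
      have "(real m powr (\<epsilon> / real (Suc n))) ^ Suc n = (real m powr (\<epsilon> / real (Suc n))) powr real (Suc n)"
        using that by (intro powr_realpow[symmetric]) simp
      also have "\<dots> = real m powr (\<epsilon> / real (Suc n) * real (Suc n))" by (rule powr_powr)
      finally show ?thesis by (simp del: of_nat_Suc)
    qed
    finally show ?thesis .
  qed
  then show "\<exists>C. \<forall>m\<ge>1. \<bar>u m ^ Suc n\<bar> \<le> C * real m powr \<epsilon>" by blast
qed

text \<open>A point of finite type keeps a polynomial distance from the roots of unity.\<close>

lemma subpolynomial_roots_of_unity:
  fixes t K \<gamma> :: real
  defines "x \<equiv> cis (2 * pi * t)"
  assumes K: "K > 0" and gam: "\<gamma> > 0"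
    and dio: "\<And>m::int. m \<noteq> 0 \<Longrightarrow> unit_norm (frac (of_int m * t)) > K / \<bar>of_int m\<bar> powr \<gamma>"
    and Z: "finite Z" "Z \<noteq> {}" "Z \<subseteq> sphere 0 1" and roots: "\<And>z. z \<in> Z \<Longrightarrow> root_of_unity z"
    and U: "mild_singularities Z U"
  shows "subpolynomial (\<lambda>m. U (x ^ m))"
proof -
  have xn: "x ^ m \<in> sphere 0 1" for m by (simp add: x_def norm_power)
  have each: "\<exists>b>0. \<forall>m\<ge>1. b * real m powr (- \<gamma>) \<le> dist (x ^ m) z" if z: "z \<in> Z" for z
  proof -
    obtain p where p: "p \<ge> 1" "z ^ p = 1" using roots[OF z] unfolding root_of_unity_def by blast
    define b where "b = K * real p powr (- \<gamma>) / real p"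
    have "b * real m powr (- \<gamma>) \<le> dist (x ^ m) z" if m: "m \<ge> 1" for m
    proof -
      \<comment> \<open>If z^p = 1, then |x^(m p) - 1| is at most p |x^m - z|; the Diophantine
        condition at m p bounds it from below.\<close>
      have "K * (real m powr (- \<gamma>) * real p powr (- \<gamma>)) = K / \<bar>of_int (int (m * p))\<bar> powr \<gamma>"
        using m p by (simp add: powr_mult powr_minus divide_inverse)
      also have "\<dots> < unit_norm (frac (of_int (int (m * p)) * t))" using m p by (intro dio) auto
      also have "\<dots> \<le> cmod (cis (2 * pi * (of_int (int (m * p)) * t)) - 1)" by (rule unit_norm_le_dist)
      also have "cis (2 * pi * (of_int (int (m * p)) * t)) = x ^ (m * p)"
        unfolding x_def Complex.DeMoivre by (simp add: mult_ac)
      also have "cmod (x ^ (m * p) - 1) = cmod ((x ^ m) ^ p - z ^ p)" by (simp add: p power_mult)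
      also have "\<dots> \<le> real p * cmod (x ^ m - z)" using xn[of m] z Z by (intro norm_power_diff) auto
      finally show ?thesis using p by (simp add: b_def dist_norm pos_divide_le_eq mult_ac)
    qed
    moreover have "b > 0" using K p by (simp add: b_def)
    ultimately show ?thesis by blast
  qed
  obtain b where b: "\<And>z. z \<in> Z \<Longrightarrow> b z > 0 \<and> (\<forall>m\<ge>1. b z * real m powr (- \<gamma>) \<le> dist (x ^ m) z)"
    using each by metis
  define \<beta> where "\<beta> = Min (b ` Z)"
  have beta: "\<beta> > 0" unfolding \<beta>_def using b Z by (subst Min_gr_iff) auto
  have dist: "\<beta> * real m powr (- \<gamma>) \<le> infdist (x ^ m) Z" if m: "m \<ge> 1" for m
  proof -
    obtain z where z: "z \<in> Z" "infdist (x ^ m) Z = dist (x ^ m) z"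
      using infdist_attains_inf[of Z "x ^ m"] Z by (auto intro: finite_imp_closed)
    have "\<beta> * real m powr (- \<gamma>) \<le> b z * real m powr (- \<gamma>)"
      using z Z by (intro mult_right_mono) (auto simp: \<beta>_def)
    also have "\<dots> \<le> dist (x ^ m) z" using b[OF z(1)] m by blast
    finally show ?thesis by (simp only: z(2))
  qed
  show ?thesis
    unfolding subpolynomial_def
  proof (intro allI impI)
    fix \<epsilon> :: real assume e: "\<epsilon> > 0"
    define \<epsilon>' where "\<epsilon>' = \<epsilon> / \<gamma>"
    have e': "\<epsilon>' > 0" "\<gamma> * \<epsilon>' = \<epsilon>" using e gam by (auto simp: \<epsilon>'_def)
    obtain C where C: "\<forall>z\<in>sphere 0 1 - Z. \<bar>U z\<bar> \<le> C * infdist z Z powr (- \<epsilon>')"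
      using conjunct1[OF U[unfolded mild_singularities_def]] e' by blast
    have "\<bar>U (x ^ m)\<bar> \<le> (\<bar>C\<bar> * \<beta> powr (- \<epsilon>')) * real m powr \<epsilon>" if m: "m \<ge> 1" for m
    proof -
      have bm: "0 < \<beta> * real m powr (- \<gamma>)" using beta m by simp
      then have "infdist (x ^ m) Z > 0" using dist[OF m] by linarith
      then have "x ^ m \<notin> Z" by auto
      then have "\<bar>U (x ^ m)\<bar> \<le> C * infdist (x ^ m) Z powr (- \<epsilon>')" using C xn[of m] by blast
      also have "\<dots> \<le> \<bar>C\<bar> * infdist (x ^ m) Z powr (- \<epsilon>')" by (intro mult_right_mono) auto
      also have "\<dots> \<le> \<bar>C\<bar> * (\<beta> * real m powr (- \<gamma>)) powr (- \<epsilon>')"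
        using dist[OF m] bm e' by (intro mult_left_mono powr_mono2') auto
      also have "(\<beta> * real m powr (- \<gamma>)) powr (- \<epsilon>') = \<beta> powr (- \<epsilon>') * real m powr \<epsilon>"
        using beta by (simp add: powr_mult powr_powr e'(2))
      finally show ?thesis by (simp only: mult.assoc)
    qed
    then show "\<exists>C. \<forall>m\<ge>1. \<bar>U (x ^ m)\<bar> \<le> C * real m powr \<epsilon>" by blast
  qed
qed

section \<open>Weights with regular averages\<close>

text \<open>The conditions on the weights in \<open>lin_stat_clt\<close>. Even moments of every
  order occur because the order used in \<open>last_cycle_bound\<close> grows as \<theta> tends to
  0.\<close>

definition regular_weights :: "(nat \<Rightarrow> real) \<Rightarrow> real \<Rightarrow> real \<Rightarrow> bool" where
  "regular_weights u \<mu> V \<longleftrightarrow>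
    (\<exists>C. \<forall>m\<ge>1. \<bar>u m\<bar> \<le> C * real m) \<and>
    (\<exists>\<delta> C. 0 < \<delta> \<and> \<delta> < 1 \<and>
      (\<forall>N. \<bar>\<Sum>m=1..N. u m - \<mu>\<bar> \<le> C * real N powr (1 - \<delta>)) \<and>
      (\<forall>N. \<bar>\<Sum>m=1..N. (u m)\<^sup>2 - V\<bar> \<le> C * real N powr (1 - \<delta>))) \<and>
    (\<forall>k. \<exists>C. \<forall>N. (\<Sum>m=1..N. u m ^ (2 * k)) \<le> C * real N)"

lemma lin_stat_clt_regular:
  assumes th: "\<theta> > 0" and V: "V \<ge> 0" and u: "regular_weights u \<mu> V"
  obtains K where "\<And>n g g'. n \<ge> 3 \<Longrightarrow> (\<And>x. (g has_real_derivative g' x) (at x)) \<Longrightarrow> (\<And>x. \<bar>g' x\<bar> \<le> 1) \<Longrightarrow>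
    \<bar>lin_stat \<theta> u n (\<lambda>x. g (x / sqrt (ln n) - \<theta> * sqrt (ln n) * \<mu>)) / ewens_weight \<theta> n
      - (\<integral>x. std_normal_density x * g (sqrt (\<theta> * V) * x) \<partial>lborel)\<bar> \<le> K / sqrt (ln n)"
proof -
  obtain C0 where C0: "\<And>m. m \<ge> 1 \<Longrightarrow> \<bar>u m\<bar> \<le> C0 * real m" using u unfolding regular_weights_def by blast
  obtain \<delta> C1 where d: "0 < \<delta>" "\<delta> < 1" and C1: "\<And>N. \<bar>\<Sum>m=1..N. u m - \<mu>\<bar> \<le> C1 * real N powr (1 - \<delta>)"
    "\<And>N. \<bar>\<Sum>m=1..N. (u m)\<^sup>2 - V\<bar> \<le> C1 * real N powr (1 - \<delta>)"
    using u unfolding regular_weights_def by blast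
  define C where "C = max C0 C1"
  have a0: "\<bar>u m\<bar> \<le> C * real m" if "m \<ge> 1" for m
    by (rule order_trans[OF C0[OF that]]) (intro mult_right_mono, auto simp: C_def)
  have a1: "C1 * real N powr (1 - \<delta>) \<le> C * real N powr (1 - \<delta>)" for N
    by (intro mult_right_mono) (auto simp: C_def)
  have a3: "\<exists>C. \<forall>N. (\<Sum>m=1..N. u m ^ (2 * k)) \<le> C * real N" for k using u unfolding regular_weights_def by blast
  show ?thesis
  proof (rule lin_stat_clt[OF th V d a0 order_trans[OF C1(1) a1] order_trans[OF C1(2) a1] a3])
    fix K
    assume "\<And>n g g'. n \<ge> 3 \<Longrightarrow> (\<And>x. (g has_real_derivative g' x) (at x)) \<Longrightarrow> (\<And>x. \<bar>g' x\<bar> \<le> 1) \<Longrightarrow>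
      \<bar>lin_stat \<theta> u n (\<lambda>x. g (x / sqrt (ln n) - \<theta> * sqrt (ln n) * \<mu>)) / ewens_weight \<theta> n
        - (\<integral>x. std_normal_density x * g (sqrt (\<theta> * V) * x) \<partial>lborel)\<bar> \<le> K / sqrt (ln n)"
    then show thesis by (rule that)
  qed
qed

lemma powr_bound_weaken:
  assumes "\<And>N. \<bar>s N\<bar> \<le> C * real N powr (1 - \<delta>)" "\<delta>' \<le> \<delta>" "C \<le> C'" "0 \<le> C'"
  shows "\<bar>s N\<bar> \<le> C' * real N powr (1 - \<delta>')"
proof (cases "N = 0")
  case True
  then show ?thesis using assms(1)[of 0] by simp
next
  case False
  have "\<bar>s N\<bar> \<le> C * real N powr (1 - \<delta>)" by (rule assms)
  also have "\<dots> \<le> C' * real N powr (1 - \<delta>)" using assms by (intro mult_right_mono) auto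
  also have "\<dots> \<le> C' * real N powr (1 - \<delta>')" using assms False by (intro mult_left_mono powr_mono) auto
  finally show ?thesis .
qed

text \<open>Powers of \<open>U\<close> again have mild singularities and subpolynomial growth along
  the orbit, so equidistribution applies to each of them and yields the averages of \<open>U\<close>
  and \<open>U^2\<close> as well as the higher moments.\<close>

lemma circle_regular_weights:
  fixes t K \<gamma> :: real and U :: "complex \<Rightarrow> real"
  defines "x \<equiv> cis (2 * pi * t)"
  assumes K: "K > 0" and gam: "\<gamma> > 0"
    and dio: "\<And>m::int. m \<noteq> 0 \<Longrightarrow> unit_norm (frac (of_int m * t)) > K / \<bar>of_int m\<bar> powr \<gamma>"
    and S: "finite S" "S \<noteq> {}" "S \<subseteq> sphere 0 1" and U: "mild_singularities S U"
    and meas: "(\<lambda>s. U (cis (2 * pi * s))) \<in> borel_measurable borel"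
    and growth: "subpolynomial (\<lambda>m. U (x ^ m))"
  shows "set_integrable lborel {0..1} (\<lambda>s. U (cis (2 * pi * s)))"
    and "regular_weights (\<lambda>m. U (x ^ m)) (circle_integral U) (circle_integral (\<lambda>z. (U z)\<^sup>2))"
proof -
  note eq = singular_equidistribution[OF K gam dio S, folded x_def]
  have pow: "\<exists>\<delta> C. 0 < \<delta> \<and> \<delta> < 1 \<and>
      (\<forall>N. \<bar>(\<Sum>m=1..N. U (x ^ m) ^ Suc k) - real N * circle_integral (\<lambda>z. U z ^ Suc k)\<bar> \<le> C * real N powr (1 - \<delta>))" for k
  proof (rule eq(2))
    show "mild_singularities S (\<lambda>z. U z ^ Suc k)" by (rule mild_singularities_power[OF S(1,2) U])
    show "(\<lambda>s. U (cis (2 * pi * s)) ^ Suc k) \<in> borel_measurable borel" using meas by (rule borel_measurable_power)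
    show "\<exists>C. \<forall>m\<ge>1. \<bar>U (x ^ m) ^ Suc k\<bar> \<le> C * real m powr \<epsilon>" if "\<epsilon> > 0" for \<epsilon>
      using subpolynomial_power[OF growth, of k] that unfolding subpolynomial_def by blast
  qed
  show "set_integrable lborel {0..1} (\<lambda>s. U (cis (2 * pi * s)))"
    using growth by (intro eq(1)[OF _ U meas]) (auto simp: subpolynomial_def)
  show "regular_weights (\<lambda>m. U (x ^ m)) (circle_integral U) (circle_integral (\<lambda>z. (U z)\<^sup>2))"
    unfolding regular_weights_def
  proof (intro conjI allI)
    obtain C where "\<forall>m\<ge>1. \<bar>U (x ^ m)\<bar> \<le> C * real m powr 1"
      using spec[OF growth[unfolded subpolynomial_def], of 1] zero_less_one by blast
    then show "\<exists>C. \<forall>m\<ge>1. \<bar>U (x ^ m)\<bar> \<le> C * real m" by auto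
  next
    let ?s1 = "\<lambda>N. (\<Sum>m=1..N. U (x ^ m)) - real N * circle_integral U"
    let ?s2 = "\<lambda>N. (\<Sum>m=1..N. (U (x ^ m))\<^sup>2) - real N * circle_integral (\<lambda>z. (U z)\<^sup>2)"
    obtain \<delta>1 C1 where 1: "0 < \<delta>1" "\<delta>1 < 1" "\<And>N. \<bar>?s1 N\<bar> \<le> C1 * real N powr (1 - \<delta>1)"
      using pow[of 0] by auto
    obtain \<delta>2 C2 where 2: "0 < \<delta>2" "\<delta>2 < 1" "\<And>N. \<bar>?s2 N\<bar> \<le> C2 * real N powr (1 - \<delta>2)"
      using pow[of 1] by (auto simp: eval_nat_numeral)
    define \<delta> where "\<delta> = min \<delta>1 \<delta>2"
    define C where "C = max 0 (max C1 C2)"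
    have "\<bar>?s1 N\<bar> \<le> C * real N powr (1 - \<delta>)" for N
      by (rule powr_bound_weaken[OF 1(3)]) (auto simp: \<delta>_def C_def)
    moreover have "\<bar>?s2 N\<bar> \<le> C * real N powr (1 - \<delta>)" for N
      by (rule powr_bound_weaken[OF 2(3)]) (auto simp: \<delta>_def C_def)
    moreover have "0 < \<delta>" "\<delta> < 1" using 1 2 by (auto simp: \<delta>_def)
    ultimately show "\<exists>\<delta> C. 0 < \<delta> \<and> \<delta> < 1 \<and>
      (\<forall>N. \<bar>\<Sum>m=1..N. U (x ^ m) - circle_integral U\<bar> \<le> C * real N powr (1 - \<delta>)) \<and>
      (\<forall>N. \<bar>\<Sum>m=1..N. (U (x ^ m))\<^sup>2 - circle_integral (\<lambda>z. (U z)\<^sup>2)\<bar> \<le> C * real N powr (1 - \<delta>))"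
      unfolding sum_subtractf by (intro exI[of _ \<delta>] exI[of _ C]) simp
  next
    fix k
    show "\<exists>C. \<forall>N. (\<Sum>m=1..N. U (x ^ m) ^ (2 * k)) \<le> C * real N"
    proof (cases "2 * k")
      case 0
      then show ?thesis by (intro exI[of _ 1]) simp
    next
      case (Suc j)
      let ?I = "circle_integral (\<lambda>z. U z ^ Suc j)"
      obtain \<delta> C where *: "0 < \<delta>" "\<And>N. \<bar>(\<Sum>m=1..N. U (x ^ m) ^ Suc j) - real N * ?I\<bar> \<le> C * real N powr (1 - \<delta>)"
        using pow[of j] by blast
      have "(\<Sum>m=1..N. U (x ^ m) ^ Suc j) \<le> (\<bar>?I\<bar> + \<bar>C\<bar>) * real N" for N
      proof -
        have "\<bar>(\<Sum>m=1..N. U (x ^ m) ^ Suc j) - real N * ?I\<bar> \<le> \<bar>C\<bar> * real N powr (1 - 0)"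
          by (rule powr_bound_weaken[OF *(2)]) (use *(1) in auto)
        moreover have "real N * ?I \<le> real N * \<bar>?I\<bar>" by (intro mult_left_mono) auto
        moreover have "real N powr (1 - 0) = real N" by simp
        ultimately show ?thesis unfolding distrib_right by (simp add: mult.commute)
      qed
      then show ?thesis unfolding Suc by blast
    qed
  qed
qed

section \<open>Periodic weights\<close>

text \<open>After subtraction of the mean a full period sums to zero, so the partial sums are
  periodic themselves.\<close>

lemma periodic_sum_bounded:
  fixes u :: "nat \<Rightarrow> real"
  assumes p: "p \<ge> 1" and per: "\<And>m. u (m + p) = u m"
  shows "\<exists>C\<ge>0. \<forall>N. \<bar>\<Sum>m=1..N. u m - (\<Sum>m=1..p. u m) / real p\<bar> \<le> C"
proof -
  define w where "w = (\<lambda>m. u m - (\<Sum>m=1..p. u m) / real p)"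
  define s where "s = (\<lambda>N. \<Sum>m=1..N. w m)"
  have "s (N + p) = s N" for N
  proof (induction N)
    case 0
    show ?case using p by (simp add: s_def w_def sum_subtractf)
  next
    case (Suc N)
    have "w (Suc (N + p)) = w (Suc N)" using per[of "Suc N"] by (simp add: w_def)
    then show ?case using Suc by (simp add: s_def)
  qed
  then have "s (N + k * p) = s N" for N k by (induction k) (simp_all add: add.assoc[symmetric] add.commute[of p])
  then have red: "s N = s (N mod p)" for N by (metis mod_mult_div_eq add.commute mult.commute)
  have "\<bar>s N\<bar> \<le> (\<Sum>j<p. \<bar>s j\<bar>)" for N
    unfolding red[of N] using p by (intro member_le_sum[where f="\<lambda>j. \<bar>s j\<bar>"]) auto
  then show ?thesis unfolding s_def w_def by (intro exI[of _ "\<Sum>j<p. \<bar>s j\<bar>"]) (auto simp: s_def w_def intro!: sum_nonneg)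
qed

lemma periodic_regular_weights:
  fixes u :: "nat \<Rightarrow> real"
  assumes p: "p \<ge> 1" and per: "\<And>m. u (m + p) = u m"
  shows "regular_weights u ((\<Sum>m=1..p. u m) / real p) ((\<Sum>m=1..p. (u m)\<^sup>2) / real p)"
proof -
  have "u (N + k * p) = u N" for N k
    by (induction k) (simp_all add: per add.assoc[symmetric] add.commute[of p])
  then have red: "u N = u (N mod p)" for N by (metis mod_mult_div_eq add.commute mult.commute)
  define c where "c = (\<Sum>j<p. \<bar>u j\<bar>)"
  have c: "\<bar>u N\<bar> \<le> c" for N
    unfolding red[of N] c_def using p by (intro member_le_sum[where f="\<lambda>j. \<bar>u j\<bar>"]) auto
  have c0: "0 \<le> c" unfolding c_def by (intro sum_nonneg) auto
  \<comment> \<open>Any \<delta> in (0, 1) works for a bounded error. At N = 0 the power is 0, hence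
    the condition \<open>s 0 = 0\<close>.\<close>
  have weak: "\<bar>s N\<bar> \<le> C * real N powr (1 - 1 / 2)" if "\<And>N. \<bar>s N\<bar> \<le> C1" "C1 \<le> C" "0 \<le> C" "s 0 = 0" for C1 C N and s :: "nat \<Rightarrow> real"
  proof (cases "N = 0")
    case False
    then have "1 \<le> real N powr (1 - 1 / 2)" by (intro ge_one_powr_ge_zero) auto
    then have "C * 1 \<le> C * real N powr (1 - 1 / 2)" using that by (intro mult_left_mono) auto
    then show ?thesis using that(1)[of N] that(2) by linarith
  qed (use that in simp)
  obtain C1 where C1: "\<And>N. \<bar>\<Sum>m=1..N. u m - (\<Sum>m=1..p. u m) / real p\<bar> \<le> C1"
    using periodic_sum_bounded[where u=u, OF p per] by blast
  obtain C2 where C2: "\<And>N. \<bar>\<Sum>m=1..N. (u m)\<^sup>2 - (\<Sum>m=1..p. (u m)\<^sup>2) / real p\<bar> \<le> C2"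
    using periodic_sum_bounded[OF p, of "\<lambda>m. (u m)\<^sup>2"] per by auto
  define C where "C = max 0 (max C1 C2)"
  show ?thesis
    unfolding regular_weights_def
  proof (intro conjI allI)
    have "\<bar>u m\<bar> \<le> c * real m" if "m \<ge> 1" for m
      using c[of m] mult_left_mono[of 1 "real m" c] c0 that by simp
    then show "\<exists>C. \<forall>m\<ge>1. \<bar>u m\<bar> \<le> C * real m" by blast
  next
    have "\<bar>\<Sum>m=1..N. u m - (\<Sum>m=1..p. u m) / real p\<bar> \<le> C * real N powr (1 - 1 / 2)" for N
      by (rule weak[OF C1]) (auto simp: C_def)
    moreover have "\<bar>\<Sum>m=1..N. (u m)\<^sup>2 - (\<Sum>m=1..p. (u m)\<^sup>2) / real p\<bar> \<le> C * real N powr (1 - 1 / 2)" for N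
      by (rule weak[OF C2]) (auto simp: C_def)
    ultimately show "\<exists>\<delta> C. 0 < \<delta> \<and> \<delta> < 1 \<and>
      (\<forall>N. \<bar>\<Sum>m=1..N. u m - (\<Sum>m=1..p. u m) / real p\<bar> \<le> C * real N powr (1 - \<delta>)) \<and>
      (\<forall>N. \<bar>\<Sum>m=1..N. (u m)\<^sup>2 - (\<Sum>m=1..p. (u m)\<^sup>2) / real p\<bar> \<le> C * real N powr (1 - \<delta>))"
      by (intro exI[of _ "1/2::real"] exI[of _ C]) auto
  next
    fix k
    have "(\<Sum>m=1..N. u m ^ (2 * k)) \<le> (\<Sum>m=1..N. c ^ (2 * k))" for N
      by (intro sum_mono) (metis c abs_ge_zero power_even_abs power_mono even_mult_iff even_numeral)
    then show "\<exists>C. \<forall>N. (\<Sum>m=1..N. u m ^ (2 * k)) \<le> C * real N" by (intro exI[of _ "c ^ (2 * k)"]) (simp add: mult.commute)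
  qed
qed

section \<open>From linear statistics to the Wasserstein distance\<close>

text \<open>Writing the law as that of \<open>sqrt v\<close> times a standard normal variable treats
  the degenerate case \<open>v = 0\<close> together with the others.\<close>

lemma gaussian_rv_expectation:
  fixes X :: "'w \<Rightarrow> real"
  assumes P: "prob_space M" and X: "gaussian_rv M X" and m0: "(\<integral>\<omega>. X \<omega> \<partial>M) = 0" and v: "covariance M X X = v"
  shows "v \<ge> 0"
    and "g \<in> borel_measurable borel \<Longrightarrow> (\<integral>\<omega>. g (X \<omega>) \<partial>M) = (\<integral>x. std_normal_density x * g (sqrt v * x) \<partial>lborel)"
proof -
  interpret prob_space M by (rule P)
  have Xm: "X \<in> borel_measurable M" using X unfolding gaussian_rv_def by blast
  have v': "v = (\<integral>\<omega>. (X \<omega>)\<^sup>2 \<partial>M)" using v by (simp add: covariance_def m0 power2_eq_square)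
  show "v \<ge> 0" unfolding v' by simp
  assume g: "g \<in> borel_measurable borel"
  consider \<mu> \<sigma> where "\<sigma> > 0" "distributed M lborel X (normal_density \<mu> \<sigma>)" | \<mu> where "AE \<omega> in M. X \<omega> = \<mu>"
    using X unfolding gaussian_rv_def by blast
  then show "(\<integral>\<omega>. g (X \<omega>) \<partial>M) = (\<integral>x. std_normal_density x * g (sqrt v * x) \<partial>lborel)"
  proof cases
    case 1
    have mu: "\<mu> = 0" using normal_distributed_expectation[OF 1] m0 by simp
    have "v = \<sigma>\<^sup>2" using normal_distributed_variance[OF 1] m0 v' by simp
    then have sv: "sqrt v = \<sigma>" using 1 by simp
    have "distributed M lborel (\<lambda>\<omega>. X \<omega> / \<sigma>) std_normal_density"
      using normal_standard_normal_convert[OF 1(1), of X \<mu>] 1(2) Xm by (simp add: mu)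
    from distributed_integral[OF this, of "\<lambda>y. g (\<sigma> * y)"]
    have "(\<integral>x. std_normal_density x * g (\<sigma> * x) \<partial>lborel) = (\<integral>\<omega>. g (\<sigma> * (X \<omega> / \<sigma>)) \<partial>M)"
      using g by (simp add: normal_density_nonneg)
    then show ?thesis using 1(1) by (simp add: sv)
  next
    case 2
    have "(\<integral>\<omega>. X \<omega> \<partial>M) = (\<integral>\<omega>. \<mu> \<partial>M)" using 2 Xm by (intro integral_cong_AE) auto
    then have mu: "\<mu> = 0" using m0 by (simp add: prob_space)
    have "v = (\<integral>\<omega>. 0 \<partial>M)" unfolding v' using 2 Xm mu by (intro integral_cong_AE) auto
    moreover have "(\<integral>\<omega>. g (X \<omega>) \<partial>M) = (\<integral>\<omega>. g 0 \<partial>M)"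
      using 2 mu measurable_compose[OF Xm g] by (intro integral_cong_AE) auto
    ultimately show ?thesis by (simp add: prob_space)
  qed
qed

lemma integral_ewens:
  assumes "\<theta> > 0"
  shows "(\<integral>\<sigma>. h (counts n \<sigma>) \<partial>ewens \<theta> n) = ewens_sum \<theta> n h / ewens_weight \<theta> n"
proof -
  have ph: "pochhammer \<theta> n > 0" using assms by (rule pochhammer_pos)
  have "(\<integral>\<sigma>. h (counts n \<sigma>) \<partial>ewens \<theta> n) = (\<Sum>\<sigma>\<in>perms n. h (counts n \<sigma>) * (\<theta> ^ num_cycles n \<sigma> / pochhammer \<theta> n))"
    unfolding ewens_def using assms ph by (subst lebesgue_integral_point_measure_finite) (auto simp: mult.commute)
  also have "\<dots> = (\<Sum>\<sigma>\<in>perms n. \<theta> ^ num_cycles n \<sigma> * h (counts n \<sigma>)) / pochhammer \<theta> n"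
    by (simp add: sum_divide_distrib mult_ac)
  also have "\<dots> = ewens_sum \<theta> n h / ewens_weight \<theta> n" by (simp add: ewens_sum_def ewens_weight_def)
  finally show ?thesis .
qed

text \<open>The constant of \<open>lin_stat_clt_regular\<close> is the same for all test functions,
  so it survives the supremum. General weights allow one use for the real part and one for the
  imaginary part.\<close>

lemma wasserstein_lin_stat_le:
  fixes X :: "'w \<Rightarrow> real"
  assumes th: "\<theta> > 0" and u: "regular_weights u \<mu> V"
    and M: "prob_space M" "gaussian_rv M X" "(\<integral>\<omega>. X \<omega> \<partial>M) = 0" "covariance M X X = \<theta> * V"
    and W: "\<And>n \<sigma>. W n \<sigma> = (\<Sum>m=1..n. u m * real (cycle_count n m \<sigma>)) / sqrt (ln (real n)) - \<theta> * sqrt (ln (real n)) * \<mu>"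
  shows "\<exists>C::real. \<forall>\<^sub>F n in sequentially. wasserstein M X (ewens \<theta> n) (W n) \<le> ennreal (C * ln (real n) powr (-1/2))"
proof -
  have V: "V \<ge> 0" using gaussian_rv_expectation(1)[OF M] th by (simp add: zero_le_mult_iff)
  obtain K where K: "\<And>n g g'. n \<ge> 3 \<Longrightarrow> (\<And>x. (g has_real_derivative g' x) (at x)) \<Longrightarrow> (\<And>x. \<bar>g' x\<bar> \<le> 1) \<Longrightarrow>
    \<bar>lin_stat \<theta> u n (\<lambda>x. g (x / sqrt (ln n) - \<theta> * sqrt (ln n) * \<mu>)) / ewens_weight \<theta> n
      - (\<integral>x. std_normal_density x * g (sqrt (\<theta> * V) * x) \<partial>lborel)\<bar> \<le> K / sqrt (ln n)"
    by (rule lin_stat_clt_regular[OF th V u]) blast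
  have "wasserstein M X (ewens \<theta> n) (W n) \<le> ennreal (K * ln (real n) powr (-1/2))" if n: "n \<ge> 3" for n
    unfolding wasserstein_def
  proof (rule SUP_least)
    fix g assume "g \<in> wasserstein_tests"
    then have g: "\<And>y. g differentiable at y" "\<And>y. \<bar>deriv g y\<bar> \<le> 1"
      by (auto simp: wasserstein_tests_def C1_differentiable_on_eq)
    have dg: "(g has_real_derivative deriv g y) (at y)" for y
      using g(1)[of y] by (metis DERIV_deriv_iff_real_differentiable)
    then have "continuous_on UNIV g" by (intro continuous_at_imp_continuous_on ballI DERIV_isCont) auto
    then have "g \<in> borel_measurable borel" by (rule borel_measurable_continuous_onI)
    note 1 = gaussian_rv_expectation(2)[OF M this]
    have 2: "(\<integral>\<sigma>. g (W n \<sigma>) \<partial>ewens \<theta> n) = lin_stat \<theta> u n (\<lambda>x. g (x / sqrt (ln n) - \<theta> * sqrt (ln n) * \<mu>)) / ewens_weight \<theta> n"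
      using integral_ewens[OF th, where n = n and h = "\<lambda>c. g ((\<Sum>m=1..n. u m * real (c m)) / sqrt (ln (real n)) - \<theta> * sqrt (ln (real n)) * \<mu>)"]
      by (simp add: W lin_stat_def counts_def)
    have "\<bar>(\<integral>\<omega>. g (X \<omega>) \<partial>M) - (\<integral>\<sigma>. g (W n \<sigma>) \<partial>ewens \<theta> n)\<bar> \<le> K / sqrt (ln n)"
      unfolding 1 2 using K[OF n dg g(2)] by (simp only: abs_minus_commute)
    also have "K / sqrt (ln n) = K * ln (real n) powr (-1/2)"
      using ln_ge_1[OF n] by (simp add: powr_half_sqrt[symmetric] powr_minus_divide)
    finally show "ennreal \<bar>(\<integral>\<omega>. g (X \<omega>) \<partial>M) - (\<integral>\<sigma>. g (W n \<sigma>) \<partial>ewens \<theta> n)\<bar> \<le> ennreal (K * ln (real n) powr (-1/2))"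
      by (rule ennreal_leI)
  qed
  then show ?thesis unfolding eventually_sequentially by blast
qed

section \<open>The weights given by log f\<close>

text \<open>The two parts have different singular sets. For ln |f| it consists of roots of unity,
  and finite type limits the growth along the orbit. For arg f it comes from
  \<open>mild_singularities_Im_Ln\<close>, and growth is limited by the bound pi; this uses that f
  does not vanish on the orbit, as a zero x^m would make x a root of unity.\<close>

lemma regular_weights_finite_type:
  assumes f: "real_analytic_on_circle f" and x: "x \<in> sphere 0 1" "\<not> root_of_unity x" "finite_type x"
    and zeros: "\<forall>z\<in>sphere 0 1. f z = 0 \<longrightarrow> root_of_unity z"
  shows "m \<ge> 1 \<Longrightarrow> f (x ^ m) \<noteq> 0"
    and "regular_weights (\<lambda>m. ln (cmod (f (x ^ m)))) (Re (mean_log f x)) (V_a f x)"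
    and "regular_weights (\<lambda>m. Im (Ln (f (x ^ m)))) (Im (mean_log f x)) (V_b f x)"
proof -
  obtain t K \<gamma> where xt: "x = cis (2 * pi * t)" and K: "K > 0" "\<gamma> > 0"
    and dio: "\<And>m::int. m \<noteq> 0 \<Longrightarrow> unit_norm (frac (of_int m * t)) > K / \<bar>of_int m\<bar> powr \<gamma>"
    using x(3) unfolding finite_type_def by blast
  have fx: "f (x ^ m) \<noteq> 0" if m: "m \<ge> 1" for m
  proof
    assume "f (x ^ m) = 0"
    moreover have "x ^ m \<in> sphere 0 1" using x(1) by (simp add: norm_power)
    ultimately have "root_of_unity (x ^ m)" using zeros by blast
    then obtain p where "p \<ge> 1" "x ^ (m * p) = 1" unfolding root_of_unity_def power_mult by blast
    moreover from this m have "m * p \<ge> 1" by simp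
    ultimately show False using x(2) unfolding root_of_unity_def by blast
  qed
  then show "m \<ge> 1 \<Longrightarrow> f (x ^ m) \<noteq> 0" .
  have "f x \<noteq> 0" using fx[of 1] by simp
  then have nz: "\<not> (\<forall>z\<in>sphere 0 1. f z = 0)" using x(1) by blast
  define A where "A = (\<lambda>z. ln (cmod (f z)))"
  define B where "B = (\<lambda>z. Im (Ln (f z)))"
  let ?e = "\<lambda>s. cis (2 * pi * s)"
  obtain L where L: "L \<ge> 0" "\<And>z w. z \<in> sphere 0 1 \<Longrightarrow> w \<in> sphere 0 1 \<Longrightarrow> cmod (f z - f w) \<le> L * cmod (z - w)"
    by (rule real_analytic_lipschitz[OF f]) blast
  have "L-lipschitz_on (sphere 0 1) f" using L by (intro lipschitz_onI) (auto simp: dist_norm)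
  then have "continuous_on UNIV (\<lambda>s. f (?e s))"
    by (intro continuous_on_compose2[OF lipschitz_on_continuous_on, of L "sphere 0 1" f] continuous_intros) auto
  then have fm [measurable]: "(\<lambda>s. f (?e s)) \<in> borel_measurable borel" by (rule borel_measurable_continuous_onI)
  have meas [measurable]: "(\<lambda>s. Ln (f (?e s))) \<in> borel_measurable borel"
    "(\<lambda>s. A (?e s)) \<in> borel_measurable borel" "(\<lambda>s. B (?e s)) \<in> borel_measurable borel"
    unfolding A_def B_def by measurable

  obtain Z k a where Z: "finite Z" "1 \<in> Z" "Z \<subseteq> sphere 0 1" "\<And>z. z \<in> Z \<Longrightarrow> z \<noteq> 1 \<Longrightarrow> f z = 0" "a > 0"
    and low: "\<And>z. z \<in> sphere 0 1 \<Longrightarrow> cmod (f z) \<ge> a * (infdist z Z / 2) ^ k"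
    by (rule real_analytic_lower_bound[OF f nz]) blast
  have Zne: "Z \<noteq> {}" using Z(2) by blast
  have mildA: "mild_singularities Z A"
    unfolding A_def by (rule mild_singularities_ln_cmod[OF f Z(1) Zne Z(3,5) low])
  have "root_of_unity z" if "z \<in> Z" for z
  proof (cases "z = 1")
    case True
    then show ?thesis unfolding root_of_unity_def by auto
  qed (use that Z zeros in blast)
  from subpolynomial_roots_of_unity[OF K dio Z(1) Zne Z(3) this mildA, folded xt]
  have growA: "subpolynomial (\<lambda>m. A (x ^ m))" .
  note regA = circle_regular_weights[OF K dio Z(1) Zne Z(3) mildA meas(2), folded xt, OF _ growA]

  obtain S where S: "finite S" "S \<noteq> {}" "S \<subseteq> sphere 0 1" "mild_singularities S B"
    unfolding B_def by (rule mild_singularities_Im_Ln[OF f nz]) blast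
  have growB: "subpolynomial (\<lambda>m. B (x ^ m))"
    by (rule subpolynomial_bounded[of _ pi]) (simp only: B_def abs_Im_Ln_le fx not_False_eq_True)
  note regB = circle_regular_weights[OF K dio S meas(3), folded xt, OF _ growB]

  have intc: "set_integrable lborel {0..1} (\<lambda>s. complex_of_real (h s))" if "set_integrable lborel {0..1} h" for h
    using that by (simp add: set_integrable_def scaleR_conv_of_real complex_of_real_integrable_eq flip: of_real_mult)
  have "AE s in lborel. s \<in> {0..1} \<longrightarrow> Ln (f (?e s)) = of_real (A (?e s)) + \<i> * of_real (B (?e s))"
    using finite_circle_preimage[OF Z(1)]
  proof eventually_elim
    case (elim s)
    show ?case
    proof
      assume "s \<in> {0..1}"
      then have "?e s \<notin> Z" using elim by blast
      then have "0 < a * (infdist (?e s) Z / 2) ^ k" using infdist_finite_pos[OF Z(1) Zne] Z(5) by simp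
      then have "f (?e s) \<noteq> 0" using low[of "?e s"] by auto
      then show "Ln (f (?e s)) = of_real (A (?e s)) + \<i> * of_real (B (?e s))" by (simp add: complex_eq_iff A_def B_def)
    qed
  qed
  then have "circle_integral (\<lambda>z. Ln (f z)) = circle_integral (\<lambda>z. of_real (A z) + \<i> * of_real (B z))"
    by (intro set_lebesgue_integral_cong_AE) auto
  \<comment> \<open>The integral may be split because each part is integrable on its own, the first
    conclusion of \<open>circle_regular_weights\<close>.\<close>
  also have "\<dots> = circle_integral (\<lambda>z. complex_of_real (A z)) + circle_integral (\<lambda>z. \<i> * of_real (B z))"
    using intc regA(1) regB(1) dio by (intro set_integral_add(2) set_integrable_mult_right) blast+
  also have "\<dots> = of_real (circle_integral A) + \<i> * of_real (circle_integral B)"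
    by (simp add: set_integral_complex_of_real)
  finally have "mean_log f x = of_real (circle_integral A) + \<i> * of_real (circle_integral B)"
    using x(2) by (simp add: mean_log_def circle_mean_def)
  then have ml: "Re (mean_log f x) = circle_integral A" "Im (mean_log f x) = circle_integral B" by simp_all
  have V: "V_a f x = circle_integral (\<lambda>z. (A z)\<^sup>2)" "V_b f x = circle_integral (\<lambda>z. (B z)\<^sup>2)"
    using x(2) by (simp_all add: V_a_def V_b_def circle_mean_def A_def B_def)
  show "regular_weights (\<lambda>m. ln (cmod (f (x ^ m)))) (Re (mean_log f x)) (V_a f x)"
    using regA(2) dio unfolding ml V A_def by blast
  show "regular_weights (\<lambda>m. Im (Ln (f (x ^ m)))) (Im (mean_log f x)) (V_b f x)"
    using regB(2) dio unfolding ml V B_def by blast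
qed

lemma regular_weights_root_of_unity:
  assumes x: "root_of_unity x" and fx: "\<forall>m\<in>{1..unity_order x}. f (x ^ m) \<noteq> 0"
  shows "f (x ^ m) \<noteq> 0"
    and "regular_weights (\<lambda>m. ln (cmod (f (x ^ m)))) (Re (mean_log f x)) (V_a f x)"
    and "regular_weights (\<lambda>m. Im (Ln (f (x ^ m)))) (Im (mean_log f x)) (V_b f x)"
proof -
  define p where "p = unity_order x"
  have "p \<ge> 1 \<and> x ^ p = 1"
    unfolding p_def unity_order_def by (rule LeastI_ex) (use x in \<open>auto simp: root_of_unity_def\<close>)
  then have p: "p \<ge> 1" "x ^ p = 1" by auto
  have per: "x ^ (m + p) = x ^ m" for m by (simp add: power_add p)
  have nz: "f (x ^ m) \<noteq> 0" for m
  proof (cases "m mod p = 0")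
    case True
    \<comment> \<open>The residue 0 is represented by the exponent \<open>p\<close>, since the
      hypothesis is about exponents from 1 to \<open>p\<close>.\<close>
    then have "x ^ m = x ^ p" using p by (metis mod_0_imp_dvd dvdE power_mult power_one)
    moreover have "f (x ^ p) \<noteq> 0" using bspec[OF fx, of p] p(1) by (simp add: p_def)
    ultimately show ?thesis by simp
  next
    case False
    have "x ^ m = x ^ (m mod p + p * (m div p))" by simp
    also have "\<dots> = x ^ (m mod p)" unfolding power_add power_mult by (simp add: p)
    finally have "x ^ m = x ^ (m mod p)" .
    moreover have "m mod p \<in> {1..p}" using False p by (simp add: Suc_le_eq less_imp_le)
    ultimately show ?thesis using fx unfolding p_def by auto
  qed
  then show "f (x ^ m) \<noteq> 0" .
  have mean: "Re (mean_log f x) = (\<Sum>m=1..p. ln (cmod (f (x ^ m)))) / real p"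
    "Im (mean_log f x) = (\<Sum>m=1..p. Im (Ln (f (x ^ m)))) / real p"
    using x nz by (simp_all add: mean_log_def circle_mean_def Re_sum Im_sum divide_inverse mult.commute flip: p_def)
  have V: "V_a f x = (\<Sum>m=1..p. (ln (cmod (f (x ^ m))))\<^sup>2) / real p" "V_b f x = (\<Sum>m=1..p. (Im (Ln (f (x ^ m))))\<^sup>2) / real p"
    using x by (simp_all add: V_a_def V_b_def circle_mean_def divide_inverse mult.commute flip: p_def)
  show "regular_weights (\<lambda>m. ln (cmod (f (x ^ m)))) (Re (mean_log f x)) (V_a f x)"
    unfolding mean V by (rule periodic_regular_weights[OF p(1)]) (simp only: per)
  show "regular_weights (\<lambda>m. Im (Ln (f (x ^ m)))) (Im (mean_log f x)) (V_b f x)"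
    unfolding mean V by (rule periodic_regular_weights[OF p(1)]) (simp only: per)
qed

theorem theorem6p2:
  fixes \<theta> :: real and f :: "complex \<Rightarrow> complex" and x :: complex
    and M :: "'w measure" and N_a N_b :: "'w \<Rightarrow> real"
  assumes "\<theta> > 0"
    and "real_analytic_on_circle f"
    and "x \<in> sphere 0 1"
    and "(\<not> root_of_unity x \<and> finite_type x \<and> (\<forall>z\<in>sphere 0 1. f z = 0 \<longrightarrow> root_of_unity z)) \<or>
         (root_of_unity x \<and> (\<forall>m\<in>{1..unity_order x}. f (x ^ m) \<noteq> 0))"
    and "centered_gaussian_vector2 M N_a N_b (\<theta> * V_a f x) (\<theta> * E_ab f x) (\<theta> * V_b f x)"
  shows "(\<exists>C::real. \<forall>\<^sub>F n in sequentially.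
            wasserstein M N_a (ewens \<theta> n) (\<lambda>\<sigma>. Re (normalized_w \<theta> n f x \<sigma>))
              \<le> ennreal (C * ln (real n) powr (-1/2))) \<and>
         (\<exists>C::real. \<forall>\<^sub>F n in sequentially.
            wasserstein M N_b (ewens \<theta> n) (\<lambda>\<sigma>. Im (normalized_w \<theta> n f x \<sigma>))
              \<le> ennreal (C * ln (real n) powr (-1/2)))"
proof -
  have "(\<forall>m\<ge>1. f (x ^ m) \<noteq> 0) \<and> regular_weights (\<lambda>m. ln (cmod (f (x ^ m)))) (Re (mean_log f x)) (V_a f x) \<and>
    regular_weights (\<lambda>m. Im (Ln (f (x ^ m)))) (Im (mean_log f x)) (V_b f x)"
    using assms(4)
  proof (elim disjE conjE)
    assume *: "\<not> root_of_unity x" "finite_type x" "\<forall>z\<in>sphere 0 1. f z = 0 \<longrightarrow> root_of_unity z"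
    show ?thesis using regular_weights_finite_type[OF assms(2,3) *] by blast
  next
    assume *: "root_of_unity x" "\<forall>m\<in>{1..unity_order x}. f (x ^ m) \<noteq> 0"
    show ?thesis using regular_weights_root_of_unity[OF *] by blast
  qed
  then have nz: "\<And>m. m \<ge> 1 \<Longrightarrow> f (x ^ m) \<noteq> 0"
    and reg: "regular_weights (\<lambda>m. ln (cmod (f (x ^ m)))) (Re (mean_log f x)) (V_a f x)"
      "regular_weights (\<lambda>m. Im (Ln (f (x ^ m)))) (Im (mean_log f x)) (V_b f x)" by blast+
  have G: "prob_space M" "\<And>u v. gaussian_rv M (\<lambda>\<omega>. u * N_a \<omega> + v * N_b \<omega>)"
    "(\<integral>\<omega>. N_a \<omega> \<partial>M) = 0" "(\<integral>\<omega>. N_b \<omega> \<partial>M) = 0"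
    "covariance M N_a N_a = \<theta> * V_a f x" "covariance M N_b N_b = \<theta> * V_b f x"
    using assms(5) unfolding centered_gaussian_vector2_def gaussian_vector2_def by blast+
  have g: "gaussian_rv M N_a" "gaussian_rv M N_b" using G(2)[of 1 0] G(2)[of 0 1] by simp_all
  \<comment> \<open>The real part of \<open>Ln\<close> is \<open>ln (cmod ...)\<close> at nonzero
    arguments, whence the appeal to \<open>nz\<close>.\<close>
  have "Re (wn n f x \<sigma>) = (\<Sum>m=1..n. ln (cmod (f (x ^ m))) * real (cycle_count n m \<sigma>))" for n \<sigma>
    unfolding wn_def Re_sum by (intro sum.cong) (use nz in \<open>auto simp: mult.commute\<close>)
  then have re: "Re (normalized_w \<theta> n f x \<sigma>) = (\<Sum>m=1..n. ln (cmod (f (x ^ m))) * real (cycle_count n m \<sigma>)) / sqrt (ln (real n))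
      - \<theta> * sqrt (ln (real n)) * Re (mean_log f x)" for n \<sigma>
    by (simp add: normalized_w_def)
  have "Im (wn n f x \<sigma>) = (\<Sum>m=1..n. Im (Ln (f (x ^ m))) * real (cycle_count n m \<sigma>))" for n \<sigma>
    unfolding wn_def Im_sum by (intro sum.cong) (auto simp: mult.commute)
  then have im: "Im (normalized_w \<theta> n f x \<sigma>) = (\<Sum>m=1..n. Im (Ln (f (x ^ m))) * real (cycle_count n m \<sigma>)) / sqrt (ln (real n))
      - \<theta> * sqrt (ln (real n)) * Im (mean_log f x)" for n \<sigma>
    by (simp add: normalized_w_def)
  show ?thesis
    using wasserstein_lin_stat_le[OF assms(1) reg(1) G(1) g(1) G(3,5) re]
      wasserstein_lin_stat_le[OF assms(1) reg(2) G(1) g(2) G(4,6) im] by (rule conjI)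
qed

end
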